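(* Let $\mathcal{I}\subset\mathcal{B}_N^d$ be finite, $\mathbf z$ a generating vector, $\tilde M:=2\max_{\mathbf k\in\mathcal{I}}|\mathbf k\cdot\mathbf z|+1$, and $\tilde M^\ell:=2\max_{\mathbf k\in\mathcal{I}}|\mathbf k_\ell'\cdot\mathbf z_\ell'|+1$ for $\ell\in[d]$. Let $\Lambda(\mathbf z,M)$ be a rank-1 lattice which is reconstructing for $\mathcal{I}$ and for $\{\mathbf k-k_\ell\mathbf e_\ell\mid\mathbf k\in\mathcal{I}\}$ for all $\ell\in[d]$, with $M\le\min\{\tilde M,\min_{\ell\in[d]}\tilde M^\ell\}$, let $f\in\mathcal{W}(\mathbb{T}^d)\cap C(\mathbb{T}^d)$ with Fourier coefficients $c=c(f)$, and let each function sample be possibly corrupted by noise at most $e_\infty\ge0$ in absolute magnitude. Apply the Two-Dimensional DFT algorithm with the following modifications: 1. use the sublinear-time SFT algorithm $\mathcal{A}^{\mathrm{sub}}_{2s,\tilde M}$ or $\mathcal{A}^{\mathrm{sub,MC}}_{2s,\tilde M}$ for the SFT of $a(t)=f(t\mathbf z)$ in step (i), and $\mathcal{A}^{\mathrm{sub}}_{2s,\tilde M^\ell}$ or $\mathcal{A}^{\mathrm{sub,MC}}_{2s,\tilde M^\ell}$ for the SFTs of $a_j^\ell$ in step (ii) (so that $\omega$ ranges over $\mathcal{B}_{\tilde M}$ and the columns $\omega'$ of $\mathbf V^\ell$ over $\mathcal{B}_{\tilde M^\ell}$), and 2. in the minimization in step (iii) only check the equality $hz_\ell+\omega'=\omega$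 (rather than equivalence modulo $M$). Then it produces $\mathbf b=(b_{\mathbf k})_{\mathbf k\in\mathcal{B}_N^d}$, a $2s$-sparse approximation of $c$ satisfying the error estimate $$\|\mathbf b-c\|_{\ell^2(\mathbb{Z}^d)}\le98\left(\frac{\|c|_{\mathcal{I}}-(c|_{\mathcal{I}})_s^{\mathrm{opt}}\|_1}{\sqrt s}+\sqrt s\,\|c-c|_{\mathcal{I}}\|_1+\sqrt s\,e_\infty\right)+\|c-c|_{\mathcal{I}}\|_2,$$ albeit with probability $1-\sigma\in[0,1)$ for the Monte Carlo version. Letting $\bar M=\max(\tilde M,\max_{\ell\in[d]}\tilde M^\ell)$, the total number of evaluations of $f$ is $$\mathcal{O}\left(\frac{dNs^2\log^4\bar M}{\log s}\right)\quad\text{or}\quad\mathcal{O}\left(dNs\log^3\bar M\,\log\left(\frac{dN\bar M}\sigma\right)\right)$$ with associated computational complexities $$\mathcal{O}\left(dNs\left(\frac{s\log^4\bar M}{\log s}+N\log N\right)\right)\quad\text{or}\quad\mathcal{O}\left(dNs\left(\log^3\bar M\,\log\left(\frac{dN\bar M}\sigma\right)+N\log N\right)\right)$$ for $\mathcal{A}^{\mathrm{sub}}_{2s,\cdot}$ and $\mathcal{A}^{\mathrm{sub,MC}}_{2s,\cdot}$ respectively (in the latter case with the failure probability of the individual univariate SFTs chosen suitably in terms of $\sigma$, $d$ and $N$).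
   Context: Notation. $\mathbb{T}=[0,1]$ with endpoints identified; $[n]=\{0,\dots,n-1\}$; $\mathcal{B}_N:=(-\lceil N/2\rceil,\lfloor N/2\rfloor]\cap\mathbb{Z}$. For $f:\mathbb{T}^d\to\mathbb{C}$, $c_{\mathbf k}(f)=\int_{\mathbb{T}^d}f(\mathbf x)e^{-2\pi i\mathbf k\cdot\mathbf x}\,d\mathbf x$ and $c(f)=(c_{\mathbf k}(f))_{\mathbf k\in\mathbb{Z}^d}$; $\mathcal{W}(\mathbb{T}^d)=\{f\in L^1(\mathbb{T}^d):\sum_{\mathbf k}|c_{\mathbf k}(f)|<\infty\}$ and $C(\mathbb{T}^d)$ is the space of continuous functions. $c|_{\mathcal{I}}$ is the restriction to $\mathcal{I}$; finite vectors and restrictions are extended by zero when compared with sequences on larger index sets, and norms of sequences are those of $\ell^p(\mathbb{Z}^d)$. For a vector $\mathbf y$, $\mathbf y_s^{\mathrm{opt}}$ is $\mathbf y$ restricted to its $s$ largest-magnitude entries. "$s$-sparse" means at most $s$ nonzero entries; $s$ is a positive integer, and sparsity parameters $s$ are always assumed to be at most half the size of the vectors under consideration. Coordinates are indexed by $\ell\in[d]$; $\mathbf e_\ell$ is the standard basis vector; one writes $\mathbf x=(x_\ell,\mathbf x_\ell')$, $\mathbf k=(k_\ell,\mathbf k_\ell')$, $\mathbf z=(z_\ell,\mathbf z'_\ell)$, where the prime denotes the remaining $d-1$ coordinates. $\mathbf F_N$ is the length-$N$ DFT, $(\mathbf F_N\mathbf y)_h=\frac1N\sum_{j\in[N]}y_je^{-2\pi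 ihj/N}$, with indices taken modulo $N$. Reconstructing lattice. For $\mathbf z\in[M]^d$, $\Lambda(\mathbf z,M)=\{\frac jM\mathbf z\bmod1\mid j\in[M]\}$; it is reconstructing for a finite set $\mathcal{J}\subset\mathbb{Z}^d$ if $\mathbf k\mapsto\mathbf k\cdot\mathbf z\bmod M$ is injective on $\mathcal{J}$. Two-Dimensional DFT algorithm (unmodified form, with univariate SFT $\mathcal{A}$, an algorithm that takes point samples of a univariate function and returns a sparse vector in $\mathbb{C}^M$). (i) Apply $\mathcal{A}$ to $a(t)=f(t\mathbf z)$ to produce $\mathbf v$. (ii) For every $\ell\in[d]$: for every $j\in[N]$ apply $\mathcal{A}$ to $a_j^\ell(t)=f(\frac jN,t\mathbf z_\ell')$ (coordinate $\ell$ equal to $j/N$, the remaining coordinates equal to $t\mathbf z'_\ell$) to produce $\mathbf v_j^\ell$, and let $\mathbf v_j^\ell$ be row $j$ of a matrix $\mathbf V^\ell$; then apply $\mathbf F_N$ to every nonzero column of $\mathbf V^\ell$ to produce $\mathbf F_N\mathbf V^\ell$. (iii) Set $\mathbf b=(b_{\mathbf k})_{\mathbf k\in\mathcal{B}_N^d}\leftarrow\mathbf 0$. For every $\omega\in\operatorname{supp}(\mathbf v)$: for every $\ell\in[d]$ let $(k_\omega)_\ell$ be the first component of a minimizer $(h,\omega')$ of $|v_\omega-(\mathbf F_N\mathbf V^\ell)_{h,\omega'}|$ over all $h\in\mathcal{B}_N$ and column indices $\omega'$ with $hz_\ell+\omega'\equiv\omega\pmod M$; then, if $\mathbf k_\omega\cdot\mathbf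 z\equiv\omega\pmod M$, set $b_{\mathbf k_\omega}\leftarrow b_{\mathbf k_\omega}+v_\omega$. Output $\mathbf b$. The univariate SFT. For a bandwidth $L$ and univariate $a$, let $\hat a_\omega=\int_{\mathbb{T}}a(t)e^{-2\pi i\omega t}dt$, $\hat a=(\hat a_\omega)_{\omega\in\mathbb{Z}}$ and let $\hat{\mathbf a}\in\mathbb{C}^L$ be its restriction to $\mathcal{B}_L$. $\mathcal{A}^{\mathrm{sub}}_{2s,L}$ is a deterministic algorithm which, for every $a\in\mathcal{W}(\mathbb{T})\cap C(\mathbb{T})$ with noise $\mu:\mathbb{T}\to\mathbb{C}$, from point samples of $a+\mu$ outputs a $2s$-sparse $\mathbf v\in\mathbb{C}^L$ (indexed by $\mathcal{B}_L$) such that, with $\delta:=\frac{\|\hat{\mathbf a}-\hat{\mathbf a}_s^{\mathrm{opt}}\|_1}{s}+\|\hat a-\hat{\mathbf a}\|_1+\|\mu\|_\infty$: (1) every $\omega\in\mathcal{B}_L$ with $|\hat a_\omega|>(4+2\sqrt2)\delta$ lies in $\operatorname{supp}(\mathbf v)$; (2) $\|(\hat{\mathbf a}-\mathbf v)|_{\operatorname{supp}(\mathbf v)}\|_\infty\le\sqrt2\,\delta$; (3) $\|\hat{\mathbf a}-\mathbf v\|_2\le\|\hat{\mathbf a}-\hat{\mathbf a}_{2s}^{\mathrm{opt}}\|_2+(8\sqrt2+6)\sqrt s\,\delta$; (4) the number of samples and operations is $\mathcal{O}(s^2\log^4L/\log s)$. $\mathcal{A}^{\mathrm{sub,MC}}_{2s,L}$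 is a randomized variant which, for prescribed $\sigma'\in(0,1/3]$, satisfies (1)–(3) simultaneously with probability $1-\sigma'$ using $\mathcal{O}(s\log^3(L)\log(L/\sigma'))$ samples and operations.
   Formalization: The final test of step (iii) is also taken as k_ω·z = ω instead of k_ω·z ≡ ω (mod M), since with the congruence several ω may add to one b_k and the bound can fail; an ω with no admissible pair is discarded; deterministic cost bounds are for s ≥ 2. *)

theory Defs
  imports "HOL-Probability.Probability"
begin

text \<open>
  The dimension \<open>d\<close> is a number, not a type, because the constants of the complexity bounds must
  not depend on it.  Points of \<open>\<real>\<^sup>d\<close> and frequencies in \<open>\<int>\<^sup>d\<close> are extensional functions on
  \<open>{..<d}\<close>, and functions on the torus are 1-periodic functions on \<open>\<real>\<^sup>d\<close>.
\<close>

abbreviation points :: "nat \<Rightarrow> (nat \<Rightarrow> real) set" where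
  "points d \<equiv> {..<d} \<rightarrow>\<^sub>E UNIV"

abbreviation freq_lattice :: "nat \<Rightarrow> (nat \<Rightarrow> int) set" where
  "freq_lattice d \<equiv> {..<d} \<rightarrow>\<^sub>E UNIV"

definition freqs :: "nat \<Rightarrow> int set" where
  "freqs N = {- \<lceil>real N / 2\<rceil> <.. \<lfloor>real N / 2\<rfloor>}"

definition freq_box :: "nat \<Rightarrow> nat \<Rightarrow> (nat \<Rightarrow> int) set" where
  "freq_box d N = {..<d} \<rightarrow>\<^sub>E freqs N"

definition unit_measure :: "real measure" where
  "unit_measure = restrict_space lborel {0..1}"

definition torus :: "nat \<Rightarrow> (nat \<Rightarrow> real) measure" where
  "torus d = PiM {..<d} (\<lambda>_. unit_measure)"

definition fourier :: "nat \<Rightarrow> ((nat \<Rightarrow> real) \<Rightarrow> complex) \<Rightarrow> (nat \<Rightarrow> int) \<Rightarrow> complex" where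
  "fourier d f k = (LINT x | torus d. f x * cis (- (2 * pi * (\<Sum>i<d. of_int (k i) * x i))))"

definition fourier1 :: "(real \<Rightarrow> complex) \<Rightarrow> int \<Rightarrow> complex" where
  "fourier1 a \<omega> = (LINT t | unit_measure. a t * cis (- (2 * pi * of_int \<omega> * t)))"

definition periodic :: "nat \<Rightarrow> ((nat \<Rightarrow> real) \<Rightarrow> complex) \<Rightarrow> bool" where
  "periodic d f \<longleftrightarrow> (\<forall>x\<in>points d. \<forall>i<d. f (x(i := x i + 1)) = f x)"

definition periodic1 :: "(real \<Rightarrow> complex) \<Rightarrow> bool" where
  "periodic1 a \<longleftrightarrow> (\<forall>t. a (t + 1) = a t)"

definition wiener_cont :: "nat \<Rightarrow> ((nat \<Rightarrow> real) \<Rightarrow> complex) \<Rightarrow> bool" where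
  "wiener_cont d f \<longleftrightarrow> periodic d f
     \<and> continuous_map (product_topology (\<lambda>_. euclideanreal) {..<d}) euclidean f
     \<and> integrable (torus d) f
     \<and> (\<lambda>k. cmod (fourier d f k)) summable_on freq_lattice d"

definition wiener_cont1 :: "(real \<Rightarrow> complex) \<Rightarrow> bool" where
  "wiener_cont1 a \<longleftrightarrow> periodic1 a \<and> continuous_on UNIV a \<and> integrable unit_measure a
     \<and> (\<lambda>\<omega>. cmod (fourier1 a \<omega>)) summable_on UNIV"

definition l1_norm :: "'i set \<Rightarrow> ('i \<Rightarrow> complex) \<Rightarrow> real" where
  "l1_norm K x = (\<Sum>\<^sub>\<infinity>k\<in>K. cmod (x k))"

definition l2_norm :: "'i set \<Rightarrow> ('i \<Rightarrow> complex) \<Rightarrow> real" where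
  "l2_norm K x = sqrt (\<Sum>\<^sub>\<infinity>k\<in>K. (cmod (x k))\<^sup>2)"

definition restr :: "'i set \<Rightarrow> ('i \<Rightarrow> complex) \<Rightarrow> 'i \<Rightarrow> complex" where
  "restr J x = (\<lambda>k. if k \<in> J then x k else 0)"

text \<open>
  \<open>best_approx s J x\<close> is the restriction of the vector \<open>(x\<^sub>k)\<close>, \<open>k \<in> J\<close>, to its \<open>s\<close>
  largest-magnitude entries (all entries if \<open>card J < s\<close>), extended by zero.  Ties are broken
  arbitrarily.
\<close>

definition best_approx :: "nat \<Rightarrow> 'i set \<Rightarrow> ('i \<Rightarrow> complex) \<Rightarrow> 'i \<Rightarrow> complex" where
  "best_approx s J x = restr (SOME S. S \<subseteq> J \<and> card S = min s (card J)
     \<and> (\<forall>i\<in>S. \<forall>j\<in>J - S. cmod (x j) \<le> cmod (x i))) x"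

definition sparse_on :: "'i set \<Rightarrow> nat \<Rightarrow> ('i \<Rightarrow> complex) \<Rightarrow> bool" where
  "sparse_on J s x \<longleftrightarrow> {k. x k \<noteq> 0} \<subseteq> J \<and> finite {k. x k \<noteq> 0} \<and> card {k. x k \<noteq> 0} \<le> s"

text \<open>
  A program adaptively queries an oracle and may draw random numbers.  Computation between the
  queries is written with ordinary functions, so its cost is not implicit: each elementary operation
  (complex arithmetic, absolute value, comparison, access to a random-access table) is to be charged
  by a \<open>Step\<close>.  Samples and random draws count as operations, too.
\<close>

datatype ('x, 'a) prog =
    Return 'a
  | Sample 'x "complex \<Rightarrow> ('x, 'a) prog"
  | Random "nat pmf" "nat \<Rightarrow> ('x, 'a) prog"
  | Step "('x, 'a) prog"

text \<open>\<open>run g p\<close>: joint distribution of the result, the number of samples, the number of operations.\<close>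

primrec run :: "('x \<Rightarrow> complex) \<Rightarrow> ('x, 'a) prog \<Rightarrow> ('a \<times> nat \<times> nat) pmf" where
  "run g (Return a) = return_pmf (a, 0, 0)"
| "run g (Sample x k) = map_pmf (\<lambda>(a, m, n). (a, m + 1, n + 1)) (run g (k (g x)))"
| "run g (Random p k) = bind_pmf p (\<lambda>r. map_pmf (\<lambda>(a, m, n). (a, m, n + 1)) (run g (k r)))"
| "run g (Step c) = map_pmf (\<lambda>(a, m, n). (a, m, n + 1)) (run g c)"

primrec deterministic :: "('x, 'a) prog \<Rightarrow> bool" where
  "deterministic (Return a) = True"
| "deterministic (Sample x k) = (\<forall>y. deterministic (k y))"
| "deterministic (Random p k) = False"
| "deterministic (Step c) = deterministic c"

primrec bind_prog :: "('x, 'a) prog \<Rightarrow> ('a \<Rightarrow> ('x, 'b) prog) \<Rightarrow> ('x, 'b) prog" where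
  "bind_prog (Return a) f = f a"
| "bind_prog (Sample x k) f = Sample x (\<lambda>y. bind_prog (k y) f)"
| "bind_prog (Random p k) f = Random p (\<lambda>r. bind_prog (k r) f)"
| "bind_prog (Step c) f = Step (bind_prog c f)"

adhoc_overloading Monad_Syntax.bind \<rightleftharpoons> bind_prog

definition steps :: "nat \<Rightarrow> ('x, unit) prog" where
  "steps n = (Step ^^ n) (Return ())"

primrec for_each :: "'b list \<Rightarrow> 's \<Rightarrow> ('b \<Rightarrow> 's \<Rightarrow> ('x, 's) prog) \<Rightarrow> ('x, 's) prog" where
  "for_each [] s body = Return s"
| "for_each (b # bs) s body = Step (bind_prog (body b s) (\<lambda>s'. for_each bs s' body))"

definition sft_delta :: "nat \<Rightarrow> nat \<Rightarrow> (real \<Rightarrow> complex) \<Rightarrow> (real \<Rightarrow> complex) \<Rightarrow> real" where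
  "sft_delta s L a \<mu> =
     (let c = fourier1 a; c' = restr (freqs L) c in
        l1_norm UNIV (\<lambda>\<omega>. c' \<omega> - best_approx s (freqs L) c' \<omega>) / real s
        + l1_norm UNIV (\<lambda>\<omega>. c \<omega> - c' \<omega>) + (SUP t. cmod (\<mu> t)))"

definition sft_accurate ::
  "nat \<Rightarrow> nat \<Rightarrow> (real \<Rightarrow> complex) \<Rightarrow> (real \<Rightarrow> complex) \<Rightarrow> (int \<Rightarrow> complex) \<Rightarrow> bool" where
  "sft_accurate s L a \<mu> v \<longleftrightarrow>
     (let c' = restr (freqs L) (fourier1 a); \<delta> = sft_delta s L a \<mu> in
        (\<forall>\<omega>\<in>freqs L. cmod (c' \<omega>) > (4 + 2 * sqrt 2) * \<delta> \<longrightarrow> v \<omega> \<noteq> 0)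
        \<and> (\<forall>\<omega>. v \<omega> \<noteq> 0 \<longrightarrow> cmod (c' \<omega> - v \<omega>) \<le> sqrt 2 * \<delta>)
        \<and> l2_norm UNIV (\<lambda>\<omega>. c' \<omega> - v \<omega>)
            \<le> l2_norm UNIV (\<lambda>\<omega>. c' \<omega> - best_approx (2 * s) (freqs L) c' \<omega>)
              + (8 * sqrt 2 + 6) * sqrt (real s) * \<delta>)"

definition sft_input :: "(real \<Rightarrow> complex) \<Rightarrow> (real \<Rightarrow> complex) \<Rightarrow> bool" where
  "sft_input a \<mu> \<longleftrightarrow> wiener_cont1 a \<and> periodic1 \<mu> \<and> bounded (range \<mu>)"

text \<open>
  \<open>A s L\<close> has bandwidth \<open>L\<close> and returns \<open>2s\<close>-sparse vectors.  The deterministic cost bound has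
  \<open>ln s\<close> as denominator, so it is only meaningful for \<open>s \<ge> 2\<close>.
\<close>

definition sublinear_sft :: "(nat \<Rightarrow> nat \<Rightarrow> (real, int \<Rightarrow> complex) prog) \<Rightarrow> bool" where
  "sublinear_sft A \<longleftrightarrow> (\<exists>C. \<forall>s L. 1 \<le> s \<and> 2 * s \<le> L \<longrightarrow>
     deterministic (A s L) \<and>
     (\<forall>a \<mu>. sft_input a \<mu> \<longrightarrow>
        (\<forall>(v, m, n) \<in> set_pmf (run (\<lambda>t. a t + \<mu> t) (A s L)).
           sparse_on (freqs L) (2 * s) v \<and> sft_accurate s L a \<mu> v \<and>
           (2 \<le> s \<longrightarrow> real (max m n) \<le> C * (real s ^ 2 * ln (real L) ^ 4 / ln (real s))))))"

definition sublinear_sft_mc :: "(real \<Rightarrow> nat \<Rightarrow> nat \<Rightarrow> (real, int \<Rightarrow> complex) prog) \<Rightarrow> bool" where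
  "sublinear_sft_mc A \<longleftrightarrow> (\<exists>C. \<forall>\<sigma> s L. 0 < \<sigma> \<and> \<sigma> \<le> 1 / 3 \<and> 1 \<le> s \<and> 2 * s \<le> L \<longrightarrow>
     (\<forall>a \<mu>. sft_input a \<mu> \<longrightarrow>
        measure_pmf.prob (run (\<lambda>t. a t + \<mu> t) (A \<sigma> s L)) {(v, m, n). sft_accurate s L a \<mu> v} \<ge> 1 - \<sigma> \<and>
        (\<forall>(v, m, n) \<in> set_pmf (run (\<lambda>t. a t + \<mu> t) (A \<sigma> s L)).
           sparse_on (freqs L) (2 * s) v \<and>
           real (max m n) \<le> C * (real s * ln (real L) ^ 3 * ln (real L / \<sigma>)))))"

definition dft :: "nat \<Rightarrow> (nat \<Rightarrow> complex) \<Rightarrow> int \<Rightarrow> complex" where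
  "dft N y h = (\<Sum>j<N. y j * cis (- (2 * pi * of_int h * real j / real N))) / of_nat N"

text \<open>
  Applying the DFT of length \<open>N\<close> is charged with the length of a shortest linear straight-line
  program for it.  \<open>lin_slp N m S\<close>: some program with \<open>m\<close> instructions of the form
  \<open>\<alpha> u + \<beta> v\<close> computes, from the inputs \<open>y\<^sub>0, \<dots>, y\<^sub>N\<^sub>-\<^sub>1\<close>, all linear forms whose coefficient
  vectors are in \<open>S\<close>.
\<close>

inductive lin_slp :: "nat \<Rightarrow> nat \<Rightarrow> (nat \<Rightarrow> complex) set \<Rightarrow> bool" for N :: nat where
  inputs: "lin_slp N 0 ((\<lambda>i j. if j = i then 1 else 0) ` {..<N})"
| instr: "lin_slp N m S \<Longrightarrow> u \<in> S \<Longrightarrow> v \<in> S \<Longrightarrow>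
    lin_slp N (Suc m) (insert (\<lambda>j. \<alpha> * u j + \<beta> * v j) S)"

definition dft_row :: "nat \<Rightarrow> nat \<Rightarrow> nat \<Rightarrow> complex" where
  "dft_row N h = (\<lambda>j. if j < N then cis (- (2 * pi * real h * real j / real N)) / of_nat N else 0)"

definition dft_length :: "nat \<Rightarrow> nat" where
  "dft_length N = (LEAST m. \<exists>S. lin_slp N m S \<and> dft_row N ` {..<N} \<subseteq> S)"

definition dot :: "nat \<Rightarrow> (nat \<Rightarrow> int) \<Rightarrow> (nat \<Rightarrow> int) \<Rightarrow> int" where
  "dot d k z = (\<Sum>i<d. k i * z i)"

definition dot_except :: "nat \<Rightarrow> nat \<Rightarrow> (nat \<Rightarrow> int) \<Rightarrow> (nat \<Rightarrow> int) \<Rightarrow> int" where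
  "dot_except d l k z = (\<Sum>i\<in>{..<d} - {l}. k i * z i)"

definition reconstructing :: "nat \<Rightarrow> (nat \<Rightarrow> int) \<Rightarrow> nat \<Rightarrow> (nat \<Rightarrow> int) set \<Rightarrow> bool" where
  "reconstructing d z M J \<longleftrightarrow> inj_on (\<lambda>k. dot d k z mod int M) J"

definition line_bw :: "nat \<Rightarrow> (nat \<Rightarrow> int) \<Rightarrow> (nat \<Rightarrow> int) set \<Rightarrow> nat" where
  "line_bw d z I = 2 * nat (Max ((\<lambda>k. \<bar>dot d k z\<bar>) ` I)) + 1"

definition slice_bw :: "nat \<Rightarrow> (nat \<Rightarrow> int) \<Rightarrow> (nat \<Rightarrow> int) set \<Rightarrow> nat \<Rightarrow> nat" where
  "slice_bw d z I l = 2 * nat (Max ((\<lambda>k. \<bar>dot_except d l k z\<bar>) ` I)) + 1"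

definition max_bw :: "nat \<Rightarrow> (nat \<Rightarrow> int) \<Rightarrow> (nat \<Rightarrow> int) set \<Rightarrow> nat" where
  "max_bw d z I = Max (insert (line_bw d z I) (slice_bw d z I ` {..<d}))"

text \<open>
  Queries carry the SFT run they belong to, so that the noise may differ from run to run.
\<close>

datatype sft_call = Line | Slice nat nat

definition line_point :: "nat \<Rightarrow> (nat \<Rightarrow> int) \<Rightarrow> real \<Rightarrow> nat \<Rightarrow> real" where
  "line_point d z t = (\<lambda>i\<in>{..<d}. t * of_int (z i))"

definition slice_point :: "nat \<Rightarrow> nat \<Rightarrow> (nat \<Rightarrow> int) \<Rightarrow> nat \<Rightarrow> nat \<Rightarrow> real \<Rightarrow> nat \<Rightarrow> real" where
  "slice_point d N z l j t = (\<lambda>i\<in>{..<d}. if i = l then real j / real N else t * of_int (z i))"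

definition support_list :: "(int \<Rightarrow> complex) \<Rightarrow> int list" where
  "support_list v = sorted_list_of_set {\<omega>. v \<omega> \<noteq> 0}"

text \<open>
  The result \<open>F\<close> of \<open>slice_dft\<close> for coordinate \<open>l\<close> represents the transformed matrix:
  \<open>F \<omega>' h\<close> is its entry in row \<open>h\<close> and column \<open>\<omega>'\<close>; \<open>cols\<close> lists the nonzero columns of the
  untransformed matrix.
\<close>

definition slice_dft ::
  "(nat \<Rightarrow> (real, int \<Rightarrow> complex) prog) \<Rightarrow> nat \<Rightarrow> nat \<Rightarrow> (nat \<Rightarrow> int) \<Rightarrow> nat \<Rightarrow> nat
    \<Rightarrow> (sft_call \<times> (nat \<Rightarrow> real), int \<Rightarrow> int \<Rightarrow> complex) prog" where
  "slice_dft A d N z L l = do {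
     (V, cols) \<leftarrow> for_each [0..<N] ((\<lambda>_ _. 0), []) (\<lambda>j st. do {
       v \<leftarrow> map_prog (\<lambda>t. (Slice l j, slice_point d N z l j t)) id (A L);
       for_each (support_list v) st (\<lambda>\<omega> (V, cols). do {
         steps 3;
         Return (V(\<omega> := (V \<omega>)(j := v \<omega>)), if \<omega> \<in> set cols then cols else \<omega> # cols)
       })
     });
     for_each cols (\<lambda>_ _. 0) (\<lambda>\<omega> F. do {
       steps (3 * dft_length N + N);
       Return (F(\<omega> := dft N (V \<omega>)))
     })
   }"

text \<open>
  For a given \<open>h\<close>, the only column index \<open>\<omega>'\<close> with \<open>h z\<^sub>l + \<omega>' = \<omega>\<close> is \<open>\<omega> - h z\<^sub>l\<close>, if it is in range.
  The result is \<open>None\<close> if no admissible pair exists; such an \<open>\<omega>\<close> is discarded.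
\<close>

definition find_coord ::
  "nat \<Rightarrow> int \<Rightarrow> nat \<Rightarrow> (int \<Rightarrow> int \<Rightarrow> complex) \<Rightarrow> complex \<Rightarrow> int \<Rightarrow> ('x, int option) prog" where
  "find_coord N zl L F y \<omega> = do {
     best \<leftarrow> for_each (sorted_list_of_set (freqs N)) None (\<lambda>h best. do {
       steps 8;
       let \<omega>' = \<omega> - h * zl;
       let r = cmod (y - F \<omega>' h);
       Return (if \<omega>' \<in> freqs L \<and> (case best of None \<Rightarrow> True | Some (_, r0) \<Rightarrow> r < r0)
               then Some (h, r) else best)
     });
     Return (map_option fst best)
   }"

definition find_freq ::
  "nat \<Rightarrow> nat \<Rightarrow> (nat \<Rightarrow> int) \<Rightarrow> (nat \<Rightarrow> nat) \<Rightarrow> (nat \<Rightarrow> int \<Rightarrow> int \<Rightarrow> complex) \<Rightarrow> complex \<Rightarrow> int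
    \<Rightarrow> ('x, (nat \<Rightarrow> int) option) prog" where
  "find_freq d N z Ls F y \<omega> = for_each [0..<d] (Some (\<lambda>_. undefined)) (\<lambda>l ko. do {
     ho \<leftarrow> find_coord N (z l) (Ls l) (F l) y \<omega>;
     Return (case (ko, ho) of (Some k, Some h) \<Rightarrow> Some (k(l := h)) | _ \<Rightarrow> None)
   })"

text \<open>
  Frequencies of the univariate transforms are genuine integers here, and the final test is
  \<open>k \<cdot> z = \<omega>\<close> like the condition in the minimization.  It cannot be relaxed to congruence
  modulo the lattice size \<open>M\<close>: up to \<open>2s\<close> congruent but distinct \<open>\<omega>\<close> may then contribute to a
  single entry of \<open>b\<close>, with a total error of order \<open>s \<delta>\<close> instead of \<open>\<surd>s \<delta>\<close>.
\<close>

definition two_dim_dft ::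
  "(nat \<Rightarrow> (real, int \<Rightarrow> complex) prog) \<Rightarrow> nat \<Rightarrow> nat \<Rightarrow> (nat \<Rightarrow> int) \<Rightarrow> nat \<Rightarrow> (nat \<Rightarrow> nat)
    \<Rightarrow> (sft_call \<times> (nat \<Rightarrow> real), (nat \<Rightarrow> int) \<Rightarrow> complex) prog" where
  "two_dim_dft A d N z L Ls = do {
     v \<leftarrow> map_prog (\<lambda>t. (Line, line_point d z t)) id (A L);
     F \<leftarrow> for_each [0..<d] (\<lambda>_ _ _. 0) (\<lambda>l F. do {
       G \<leftarrow> slice_dft A d N z (Ls l) l;
       Return (F(l := G))
     });
     for_each (support_list v) (\<lambda>_. 0) (\<lambda>\<omega> b. do {
       ko \<leftarrow> find_freq d N z Ls F (v \<omega>) \<omega>;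
       steps (3 * d + 2);
       Return (case ko of None \<Rightarrow> b
               | Some k \<Rightarrow> if dot d k z = \<omega> then b(k := b k + v \<omega>) else b)
     })
   }"

definition noisy :: "((nat \<Rightarrow> real) \<Rightarrow> complex) \<Rightarrow> (sft_call \<Rightarrow> (nat \<Rightarrow> real) \<Rightarrow> complex)
    \<Rightarrow> sft_call \<times> (nat \<Rightarrow> real) \<Rightarrow> complex" where
  "noisy f \<eta> = (\<lambda>(c, x). f x + \<eta> c x)"

end

theory Submission
  imports Defs "HOL-Real_Asymp.Real_Asymp"
begin

text \<open>
  Let \<open>f\<^sub>I\<close> be the part of the Fourier series of \<open>f\<close> with frequencies in \<open>I\<close>.  A continuous function is
  bounded by the \<open>l\<^sup>1\<close> norm of its Fourier coefficients, so every univariate SFT may be regarded as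
  running on a restriction of \<open>f\<^sub>I\<close> with noise at most \<open>\<parallel>c - c\<^sub>I\<parallel>\<^sub>1 + e\<close>, and its accuracy parameter
  is at most \<open>\<Delta> = \<parallel>c\<^sub>I - (c\<^sub>I)\<^sub>s\<parallel>\<^sub>1 / s + \<parallel>c - c\<^sub>I\<parallel>\<^sub>1 + e\<close>.  The entries of the transformed matrices
  are then correct up to \<open>(4 + 2\<surd>2) \<Delta>\<close>, so a frequency \<open>k \<in> I\<close> with \<open>\<omega> = k \<cdot> z\<close> in the support of
  \<open>v\<close> can be misidentified only if \<open>|v\<^sub>\<omega>| \<le> (8 + 5\<surd>2) \<Delta>\<close>.  As every accepted frequency satisfies
  \<open>k \<cdot> z = \<omega>\<close>, at most \<open>2s\<close> coefficients get lost and at most \<open>2s\<close> spurious ones appear, all bounded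
  by \<open>(8 + 6\<surd>2) \<Delta>\<close>.  With the \<open>l\<^sup>2\<close> error of \<open>v\<close> this gives \<open>(23 + 20\<surd>2) \<surd>s \<Delta> \<le> 98 \<surd>s \<Delta>\<close>.
  The randomized version takes a union bound over the \<open>1 + dN\<close> SFTs, each with failure
  probability \<open>\<sigma> / (3dN)\<close>.
\<close>

section \<open>Linear complexity of the discrete Fourier transform\<close>

text \<open>Charging a DFT with its shortest linear straight-line program makes the N log N bound an
  existence claim for every length N, not only for powers of two. The constants of such a program
  are free, so whatever depends on N alone may be precomputed. Several elements of I can share a
  frequency within a slice, because k'_l . z'_l forgets k_l. These collisions are harmless: merging
  maps s entries to at most s and cannot enlarge the l1 norm of the rest. The DFT over the N slices
  undoes them, since row h and column \<omega>' determine k . z = h z_l + \<omega>', and k . z is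
  injective on I. Sparsity and cost must hold in every random outcome, accuracy only with high
  probability; so two separate calculi run over the same program text. The deterministic version is
  the case of failure probability 0.\<close>

inductive derives :: "(nat \<Rightarrow> complex) set \<Rightarrow> nat \<Rightarrow> (nat \<Rightarrow> complex) set \<Rightarrow> bool" for S where
  base: "derives S 0 {}"
| step: "derives S m T \<Longrightarrow> u \<in> S \<union> T \<Longrightarrow> v \<in> S \<union> T \<Longrightarrow>
    derives S (Suc m) (insert (\<lambda>j. \<alpha> * u j + \<beta> * v j) T)"

text \<open>\<open>derives\<close> keeps the given forms \<open>S\<close> apart from the computed
  ones, so a program can be moved to a larger \<open>S\<close> and started where another one ended.
  \<open>reaches\<close> adds slack in the number of instructions and in the computed forms; in this
  shape the costs of successive stages add up.\<close>

definition reaches :: "(nat \<Rightarrow> complex) set \<Rightarrow> nat \<Rightarrow> (nat \<Rightarrow> complex) set \<Rightarrow> bool" where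
  "reaches S n T \<longleftrightarrow> (\<exists>m T'. derives S m T' \<and> m \<le> n \<and> T \<subseteq> S \<union> T')"

text \<open>The second program is replayed after the first; its given forms need to be available
  only then.\<close>

lemma derives_trans:
  assumes "derives S' n U" "derives S m T" "S' \<subseteq> S \<union> T"
  shows "derives S (m + n) (T \<union> U)"
  using assms
proof (induction rule: derives.induct)
  case base
  then show ?case by simp
next
  case (step n U u v \<alpha> \<beta>)
  from step have "derives S (m + n) (T \<union> U)" by simp
  from derives.step[OF this, of u v \<alpha> \<beta>] step show ?case by (auto simp: Un_assoc)
qed

lemma reaches_trans:
  assumes "reaches S m T" "reaches (S \<union> T) n U"
  shows "reaches S (m + n) (T \<union> U)"
proof -
  obtain m' T' where 1: "derives S m' T'" "m' \<le> m" "T \<subseteq> S \<union> T'"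
    using assms(1) by (auto simp: reaches_def)
  obtain n' U' where 2: "derives (S \<union> T) n' U'" "n' \<le> n" "U \<subseteq> S \<union> T \<union> U'"
    using assms(2) by (auto simp: reaches_def)
  have "derives S (m' + n') (T' \<union> U')"
    using derives_trans[OF 2(1) 1(1)] 1 by auto
  then show ?thesis
    unfolding reaches_def using 1 2 by (intro exI[of _ "m' + n'"] exI[of _ "T' \<union> U'"]) auto
qed

lemma reaches_mono:
  assumes "reaches S m T" "S \<subseteq> S'" "m \<le> m'" "T' \<subseteq> T"
  shows "reaches S' m' T'"
proof -
  obtain n U where U: "derives S n U" "n \<le> m" "T \<subseteq> S \<union> U"
    using assms(1) by (auto simp: reaches_def)
  have "derives S' n U"
    using derives_trans[OF U(1) derives.base, of S'] assms by simp
  then show ?thesis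
    unfolding reaches_def using U assms by (intro exI[of _ n] exI[of _ U]) auto
qed

lemma reaches_instr:
  assumes "u \<in> S" "v \<in> S"
  shows "reaches S 1 {\<lambda>j. \<alpha> * u j + \<beta> * v j}"
  unfolding reaches_def using derives.step[OF derives.base, of u S v \<alpha> \<beta>] assms by auto

lemma reaches_subset: "T \<subseteq> S \<Longrightarrow> reaches S n T"
  unfolding reaches_def using derives.base[of S] by fastforce

lemma reaches_Un:
  assumes "reaches S m T" "reaches S n U"
  shows "reaches S (m + n) (T \<union> U)"
  using reaches_trans[OF assms(1) reaches_mono[OF assms(2)]] by auto

lemma reaches_image:
  assumes "finite A" "\<And>a. a \<in> A \<Longrightarrow> reaches S 1 {g a}"
  shows "reaches S (card A) (g ` A)"
  using assms
proof (induction A)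
  case empty
  then show ?case by (simp add: reaches_subset)
next
  case (insert a A)
  then show ?case using reaches_Un[of S 1 "{g a}" "card A" "g ` A"] by auto
qed

text \<open>The way back to the cost model: the instructions are replayed on top of a program that
  already has \<open>S\<close>.\<close>

lemma lin_slp_reaches:
  assumes "lin_slp N m S" "reaches S n T"
  shows "\<exists>m' S'. m' \<le> m + n \<and> lin_slp N m' S' \<and> T \<subseteq> S'"
proof -
  obtain n' U where U: "derives S n' U" "n' \<le> n" "T \<subseteq> S \<union> U"
    using assms(2) by (auto simp: reaches_def)
  from U(1) have "lin_slp N (m + n') (S \<union> U)"
  proof (induction rule: derives.induct)
    case base
    then show ?case using assms by simp
  next
    case (step k T u v \<alpha> \<beta>)
    then show ?case using lin_slp.instr[of N "m + k" "S \<union> T" u v \<alpha> \<beta>] by simp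
  qed
  then show ?thesis using U by (intro exI[of _ "m + n'"] exI[of _ "S \<union> U"]) auto
qed

section \<open>Radix-2 fast Fourier transform on linear forms\<close>

definition fourier_form :: "nat \<Rightarrow> complex \<Rightarrow> (nat \<Rightarrow> nat \<Rightarrow> complex) \<Rightarrow> nat \<Rightarrow> nat \<Rightarrow> complex" where
  "fourier_form P \<zeta> x h = (\<lambda>i. \<Sum>j<P. \<zeta> ^ (j * h) * x j i)"

lemma sum_double:
  fixes g :: "nat \<Rightarrow> 'a::comm_monoid_add"
  shows "(\<Sum>j<2 * P. g j) = (\<Sum>j<P. g (2 * j)) + (\<Sum>j<P. g (2 * j + 1))"
  by (induction P) (auto simp: algebra_simps)

text \<open>The butterfly step: even and odd inputs are transformed separately with the square of
  \<zeta>. The \<open>P\<close>-th power of this square is 1, so both half-length transforms have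
  period \<open>P\<close> in \<open>h\<close>, hence \<open>h mod P\<close>.\<close>

lemma fourier_form_double:
  assumes "\<zeta> ^ (2 * P) = 1" "P > 0"
  shows "fourier_form (2 * P) \<zeta> x h = (\<lambda>i.
    1 * fourier_form P (\<zeta>\<^sup>2) (\<lambda>j. x (2 * j)) (h mod P) i
    + \<zeta> ^ h * fourier_form P (\<zeta>\<^sup>2) (\<lambda>j. x (2 * j + 1)) (h mod P) i)"
proof -
  have *: "(\<zeta>\<^sup>2) ^ (j * (h mod P)) = \<zeta> ^ (2 * j * h)" for j
  proof -
    have "\<zeta> ^ (2 * j * h) = \<zeta> ^ (2 * j * (P * (h div P) + h mod P))" by simp
    also have "\<dots> = (\<zeta> ^ (2 * P)) ^ (j * (h div P)) * \<zeta> ^ (2 * j * (h mod P))"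
      by (simp only: power_mult[symmetric] power_add[symmetric] algebra_simps)
    finally have "\<zeta> ^ (2 * j * h) = \<zeta> ^ (2 * j * (h mod P))"
      using assms by (simp only: power_one mult_1_left)
    then show ?thesis by (simp only: power_mult)
  qed
  have **: "\<zeta> ^ ((2 * j + 1) * h) = \<zeta> ^ h * \<zeta> ^ (2 * j * h)" for j
    by (simp add: power_add[symmetric] algebra_simps)
  show ?thesis
    unfolding fourier_form_def sum_double * ** by (simp add: sum_distrib_left mult_ac fun_eq_iff)
qed

text \<open>The inputs \<open>x j\<close> are themselves linear forms, so a transform can be applied
  to the results of an earlier stage. Two half-length transforms are followed by one instruction per
  output, so the count satisfies T(k+1) = 2 T(k) + 2^(k+1), which k 2^k solves.\<close>

lemma reaches_fourier_form:
  assumes "\<zeta> ^ (2 ^ k) = 1" "x ` {..<2 ^ k} \<subseteq> S"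
  shows "reaches S (k * 2 ^ k) (fourier_form (2 ^ k) \<zeta> x ` {..<2 ^ k})"
  using assms
proof (induction k arbitrary: \<zeta> x)
  case 0
  then have "fourier_form 1 \<zeta> x 0 = x 0" by (simp add: fourier_form_def)
  with 0 show ?case by (auto intro!: reaches_subset simp: lessThan_Suc)
next
  case (Suc k)
  let ?P = "2 ^ k :: nat"
  define E where "E = fourier_form ?P (\<zeta>\<^sup>2) (\<lambda>j. x (2 * j))"
  define O' where "O' = fourier_form ?P (\<zeta>\<^sup>2) (\<lambda>j. x (2 * j + 1))"
  have \<zeta>: "(\<zeta>\<^sup>2) ^ ?P = 1" using Suc.prems by (simp add: power_mult[symmetric])
  have "x (2 * j) \<in> S" "x (2 * j + 1) \<in> S" if "j < ?P" for j
    using Suc.prems(2) that by (auto simp: image_subset_iff)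
  then have "reaches S (k * ?P) (E ` {..<?P})" "reaches S (k * ?P) (O' ` {..<?P})"
    unfolding E_def O'_def by (intro Suc.IH[OF \<zeta>]; force)+
  from reaches_Un[OF this] have *: "reaches S (k * ?P + k * ?P) (E ` {..<?P} \<union> O' ` {..<?P})" .
  have "reaches (S \<union> (E ` {..<?P} \<union> O' ` {..<?P})) (card {..<2 * ?P})
     (fourier_form (2 * ?P) \<zeta> x ` {..<2 * ?P})"
  proof (rule reaches_image)
    fix h assume "h \<in> {..<2 * ?P}"
    have "h mod ?P < ?P" by simp
    then have "reaches (S \<union> (E ` {..<?P} \<union> O' ` {..<?P})) 1
        {\<lambda>i. 1 * E (h mod ?P) i + \<zeta> ^ h * O' (h mod ?P) i}"
      by (intro reaches_instr) blast+
    then show "reaches (S \<union> (E ` {..<?P} \<union> O' ` {..<?P})) 1 {fourier_form (2 * ?P) \<zeta> x h}"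
      using fourier_form_double[of \<zeta> ?P x h] Suc.prems(1) by (simp add: E_def O'_def)
  qed simp
  from reaches_mono[OF reaches_trans[OF * this]] show ?case
    by (simp add: algebra_simps)
qed


section \<open>Roots of unity and transforms of arbitrary length\<close>

lemma choose_2_add: "(h + j) choose 2 = (h choose 2) + (j choose 2) + h * j"
  by (induction j) (auto simp: numeral_2_eq_2)

text \<open>The summands are the powers of one \<open>N\<close>-th root of unity \<open>w\<close>,
  and multiplication by \<open>w - 1\<close> telescopes the sum to w^N - 1 = 0. The integer
  \<open>n\<close> is a difference of frequencies in the applications.\<close>

lemma sum_cis_roots:
  assumes "N > 0"
  shows "(\<Sum>j<N. cis (2 * pi * of_int n * real j / real N)) = (if int N dvd n then of_nat N else 0)"
proof -
  define w where "w = cis (2 * pi * of_int n / real N)"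
  have pow: "cis (2 * pi * of_int n * real j / real N) = w ^ j" for j
    by (simp add: w_def Complex.DeMoivre field_simps)
  have wN: "w ^ N = 1"
    using assms by (simp add: w_def Complex.DeMoivre cis_multiple_2pi)
  have iff: "w = 1 \<longleftrightarrow> int N dvd n"
  proof
    assume "w = 1"
    then have "exp (\<i> * complex_of_real (2 * pi * of_int n / real N)) = 1"
      by (simp add: w_def cis_conv_exp)
    then obtain m :: int where "2 * pi * of_int n / real N = of_int (2 * m) * pi"
      unfolding exp_eq_1 by auto
    then have "real_of_int n = of_int (m * int N)"
      using assms by (simp add: field_simps)
    then have "n = m * int N" by linarith
    then show "int N dvd n" by simp
  next
    assume "int N dvd n"
    then obtain m where "n = int N * m" by (elim dvdE)
    then show "w = 1"
      using assms cis_multiple_2pi[of "of_int m"] by (simp add: w_def mult.assoc)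
  qed
  show ?thesis
  proof (cases "w = 1")
    case True
    then show ?thesis using iff by (simp add: pow)
  next
    case False
    have "(w - 1) * (\<Sum>j<N. w ^ j) = 0"
      using power_diff_1_eq[of w N] wN by simp
    then show ?thesis using False iff by (simp add: pow)
  qed
qed

text \<open>With \<open>g\<close> written as a combination of characters, a correlation with
  \<open>g\<close> becomes two transforms with a diagonal scaling in between. The coefficients
  \<open>G\<close> will be constants of a straight-line program, so only their existence
  matters.\<close>

lemma fourier_inversion:
  assumes "P > 0"
  shows "\<exists>G. \<forall>m<P. g m = (\<Sum>q<P. G q * cis (2 * pi / real P) ^ (q * m))"
proof -
  define G where "G = (\<lambda>q. (\<Sum>m<P. g m * cis (- (2 * pi * real q * real m / real P))) / of_nat P)"
  have "g m = (\<Sum>q<P. G q * cis (2 * pi / real P) ^ (q * m))" if "m < P" for m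
  proof -
    have term_eq: "g m' * cis (- (2 * pi * real q * real m' / real P)) / of_nat P * cis (2 * pi / real P) ^ (q * m)
        = g m' / of_nat P * cis (2 * pi * of_int (int m - int m') * real q / real P)" for q m'
    proof -
      have "2 * pi * of_int (int m - int m') * real q / real P
          = - (2 * pi * real q * real m' / real P) + real (q * m) * (2 * pi / real P)"
        by (simp add: diff_divide_distrib algebra_simps)
      then show ?thesis by (simp only: Complex.DeMoivre flip: cis_mult) simp
    qed
    have "(\<Sum>q<P. G q * cis (2 * pi / real P) ^ (q * m))
        = (\<Sum>q<P. \<Sum>m'<P. g m' / of_nat P * cis (2 * pi * of_int (int m - int m') * real q / real P))"
      unfolding G_def sum_divide_distrib sum_distrib_right term_eq ..
    also have "\<dots> = (\<Sum>m'<P. g m' / of_nat P *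
        (\<Sum>q<P. cis (2 * pi * of_int (int m - int m') * real q / real P)))"
      by (subst sum.swap) (simp only: sum_distrib_left)
    also have "\<dots> = (\<Sum>m'<P. if m' = m then g m else 0)"
    proof (rule sum.cong)
      fix m' assume m': "m' \<in> {..<P}"
      have "int P dvd int m - int m' \<longleftrightarrow> m' = m"
        using m' that dvd_imp_le_int[of "int m - int m'" "int P"] by fastforce
      then show "g m' / of_nat P * (\<Sum>q<P. cis (2 * pi * of_int (int m - int m') * real q / real P))
          = (if m' = m then g m else 0)"
        using assms by (simp only: sum_cis_roots) auto
    qed simp
    finally show ?thesis using that by simp
  qed
  then show ?thesis by blast
qed

text \<open>
  Bluestein's trick: \<open>h j = C(h+j, 2) - C(h, 2) - C(j, 2)\<close> turns a DFT of arbitrary length into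
  a correlation, which transforms of a length \<open>2\<^sup>k\<close> compute.
\<close>

definition chirp :: "nat \<Rightarrow> nat \<Rightarrow> complex" where
  "chirp N m = cis (- (2 * pi * real (m choose 2) / real N))"

lemma chirp_add:
  "cis (- (2 * pi * real h * real j / real N)) = cnj (chirp N h) * cnj (chirp N j) * chirp N (h + j)"
proof -
  have "- (2 * pi * real h * real j / real N) = 2 * pi * real (h choose 2) / real N
      + 2 * pi * real (j choose 2) / real N - 2 * pi * real ((h + j) choose 2) / real N"
    by (cases "N = 0") (simp_all add: choose_2_add field_simps)
  then show ?thesis by (simp add: chirp_def cis_cnj cis_mult)
qed

lemma reaches_scale:
  assumes "finite A" "x ` A \<subseteq> S"
  shows "reaches S (card A) ((\<lambda>a i. \<alpha> a * x a i) ` A)"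
proof (rule reaches_image[OF assms(1)])
  fix a assume "a \<in> A"
  then show "reaches S 1 {\<lambda>i. \<alpha> a * x a i}"
    using assms reaches_instr[of "x a" S "x a" "\<alpha> a" 0] by auto
qed

text \<open>For \<open>h\<close> and \<open>j\<close> below \<open>N\<close>, the index
  \<open>h + j\<close> stays below 2^k, so the expansion of the chirp in characters holds there
  without wrap-around. The count consists of three scalings, at most 2^k instructions each, and two
  transforms, k 2^k each.\<close>

lemma reaches_dft_rows:
  assumes "N > 0" "2 * N \<le> 2 ^ k"
  shows "reaches ((\<lambda>i j. if j = i then 1 else 0) ` {..<N}) (2 * k * 2 ^ k + 3 * 2 ^ k)
           (dft_row N ` {..<N})"
proof -
  define S :: "(nat \<Rightarrow> complex) set" where "S = (\<lambda>i j. if j = i then 1 else 0) ` {..<N}"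
  define P :: nat where "P = 2 ^ k"
  have P: "P > 0" "2 * N \<le> P" using assms by (auto simp: P_def)
  define \<zeta> where "\<zeta> = cis (2 * pi / real P)"
  have \<zeta>: "\<zeta> ^ (2 ^ k) = 1"
    using P by (simp add: \<zeta>_def Complex.DeMoivre flip: P_def)
  obtain G where G: "\<And>m. m < P \<Longrightarrow> chirp N m = (\<Sum>q<P. G q * \<zeta> ^ (q * m))"
    using fourier_inversion[OF P(1)] unfolding \<zeta>_def by blast
  \<comment> \<open>Zero-padding to length \<open>P\<close>: the zero form is not among the inputs,
    so the positions from \<open>N\<close> on borrow input 0, which \<open>u\<close> then scales by
    0.\<close>
  define \<delta> :: "nat \<Rightarrow> nat \<Rightarrow> complex" where
    "\<delta> j = (\<lambda>i. if i = (if j < N then j else 0) then 1 else 0)" for j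
  define u where "u j = (\<lambda>i. (if j < N then cnj (chirp N j) else 0) * \<delta> j i)" for j
  define U where "U = fourier_form P \<zeta> u"
  define y where "y q = (\<lambda>i. G q * U q i)" for q
  define Y where "Y = fourier_form P \<zeta> y"
  define X where "X h = (\<lambda>i. cnj (chirp N h) / of_nat N * Y h i)" for h
  have "\<delta> ` {..<P} \<subseteq> S" using assms by (auto simp: \<delta>_def S_def)
  then have "reaches S (card {..<P}) (u ` {..<P})"
    unfolding u_def by (intro reaches_scale) auto
  then have 1: "reaches S P (u ` {..<P})" by simp
  have "reaches (u ` {..<P}) (k * P) (U ` {..<P})"
    unfolding U_def P_def by (intro reaches_fourier_form \<zeta>) auto
  from reaches_trans[OF 1 reaches_mono[OF this]]
  have 2: "reaches S (P + k * P) (U ` {..<P})"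
    by (auto intro: reaches_mono)
  have "reaches (U ` {..<P}) (card {..<P}) (y ` {..<P})"
    unfolding y_def by (intro reaches_scale) auto
  from reaches_trans[OF 2 reaches_mono[OF this]]
  have 3: "reaches S (P + k * P + P) (y ` {..<P})"
    by (auto intro: reaches_mono)
  have "reaches (y ` {..<P}) (k * P) (Y ` {..<P})"
    unfolding Y_def P_def by (intro reaches_fourier_form \<zeta>) auto
  from reaches_trans[OF 3 reaches_mono[OF this]]
  have 4: "reaches S (P + k * P + P + k * P) (Y ` {..<P})"
    by (auto intro: reaches_mono)
  have "reaches (Y ` {..<P}) (card {..<N}) (X ` {..<N})"
    unfolding X_def using P by (intro reaches_scale) auto
  from reaches_trans[OF 4 reaches_mono[OF this]]
  have 5: "reaches S (P + k * P + P + k * P + N) (X ` {..<N})"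
    by (auto intro: reaches_mono)
  have X: "X h = dft_row N h" if "h < N" for h
  proof
    fix i
    have "Y h i = (\<Sum>q<P. \<Sum>j<P. G q * \<zeta> ^ (q * (h + j)) * u j i)"
      unfolding Y_def y_def U_def fourier_form_def
      by (simp add: sum_distrib_left power_add distrib_left mult_ac)
    \<comment> \<open>Summing over \<open>q\<close> first gives back the chirp at
      \<open>h + j\<close>, and among the forms \<open>u j\<close> only \<open>u i\<close> can have
      a nonzero coefficient at \<open>i\<close>.\<close>
    also have "\<dots> = (\<Sum>j<P. u j i * (\<Sum>q<P. G q * \<zeta> ^ (q * (h + j))))"
      by (subst sum.swap) (simp add: sum_distrib_left mult_ac)
    also have "\<dots> = (\<Sum>j<P. if j = i then (if i < N then cnj (chirp N i) * chirp N (h + i) else 0) else 0)"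
    proof (intro sum.cong refl)
      fix j assume "j \<in> {..<P}"
      show "u j i * (\<Sum>q<P. G q * \<zeta> ^ (q * (h + j)))
        = (if j = i then (if i < N then cnj (chirp N i) * chirp N (h + i) else 0) else 0)"
      proof (cases "j < N")
        case True
        then have "h + j < P" using that P by simp
        from G[OF this] show ?thesis using True by (cases "j = i") (simp_all add: u_def \<delta>_def)
      qed (simp add: u_def)
    qed
    also have "\<dots> = (if i < N then cnj (chirp N i) * chirp N (h + i) else 0)"
      using P by auto
    finally show "X h i = dft_row N h i"
      using chirp_add[of h i N] by (simp add: X_def dft_row_def)
  qed
  have "X ` {..<N} = dft_row N ` {..<N}" using X by auto
  with 5 have "reaches S (P + k * P + P + k * P + N) (dft_row N ` {..<N})" by simp
  then show ?thesis
    unfolding S_def by (rule reaches_mono) (use P in \<open>auto simp: P_def\<close>)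
qed

text \<open>If 2^n <= N < 2^(n+1), then k = n + 2 satisfies 2 N <= 2^k <= 4 N, and the count is at
  most (2 n + 7) 4 N. Finally n <= ln N / ln 2 <= 3/2 ln N.\<close>

lemma dft_length_le:
  assumes "N > 0"
  shows "real (dft_length N) \<le> 12 * real N * ln (real N) + 28 * real N"
proof -
  obtain n where n: "2 ^ n \<le> N" "N < 2 ^ (n + 1)"
    using ex_power_ivl1[of 2 N] assms by auto
  have "reaches ((\<lambda>i j. if j = i then 1 else 0) ` {..<N})
      (2 * (n + 2) * 2 ^ (n + 2) + 3 * 2 ^ (n + 2)) (dft_row N ` {..<N})"
    using n assms by (intro reaches_dft_rows) auto
  from lin_slp_reaches[OF lin_slp.inputs this] obtain m S where
    m: "m \<le> 2 * (n + 2) * 2 ^ (n + 2) + 3 * 2 ^ (n + 2)" "lin_slp N m S" "dft_row N ` {..<N} \<subseteq> S"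
    by auto
  have "dft_length N \<le> m"
    unfolding dft_length_def by (rule Least_le) (use m in blast)
  also have "m \<le> (2 * n + 7) * (4 * 2 ^ n)" using m(1) by (simp add: algebra_simps)
  also have "\<dots> \<le> (2 * n + 7) * (4 * N)" using n by (intro mult_mono) auto
  finally have 1: "real (dft_length N) \<le> (2 * real n + 7) * (4 * real N)"
    by (simp only: of_nat_mult of_nat_add of_nat_numeral flip: of_nat_le_iff[where 'a=real])
  have "real (2 ^ n) \<le> real N" using n by (simp only: of_nat_le_iff)
  then have "ln (real (2 ^ n)) \<le> ln (real N)" using assms by (intro ln_mono) auto
  then have "real n * ln 2 \<le> ln (real N)" by (simp add: ln_realpow)
  moreover have "real n * (2/3) \<le> real n * ln 2" using ln2_ge_two_thirds by (intro mult_left_mono) auto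
  ultimately have "2 * real n + 7 \<le> 3 * ln (real N) + 7" by simp
  then have "(2 * real n + 7) * (4 * real N) \<le> (3 * ln (real N) + 7) * (4 * real N)"
    by (intro mult_right_mono) auto
  with 1 show ?thesis by (simp add: algebra_simps)
qed

section \<open>Fourier coefficients on the torus\<close>

lemma prod_cis: "(\<Prod>i\<in>A. cis (f i)) = cis (\<Sum>i\<in>A. f i)"
  by (induction A rule: infinite_finite_induct) (auto simp: cis_mult)

lemma prob_space_unit_measure: "prob_space unit_measure"
  by (rule prob_spaceI) (simp add: unit_measure_def emeasure_restrict_space space_restrict_space)

lemma product_prob_space_unit_measure: "product_prob_space (\<lambda>_. unit_measure)"
proof -
  interpret prob_space unit_measure by (rule prob_space_unit_measure)
  show ?thesis by unfold_locales
qed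

lemma prob_space_torus: "prob_space (torus d)"
proof -
  interpret product_prob_space "\<lambda>_. unit_measure" "{..<d}" by (rule product_prob_space_unit_measure)
  show ?thesis unfolding torus_def by (rule P.prob_space_axioms)
qed

lemma integrable_unit_measure:
  fixes a :: "real \<Rightarrow> 'a::euclidean_space"
  assumes "continuous_on UNIV a"
  shows "integrable unit_measure a"
  unfolding unit_measure_def
  by (subst integrable_restrict_space)
    (auto intro!: borel_integrable_compact continuous_on_subset[OF assms])

lemma integral_unit_measure_cis:
  "(LINT t | unit_measure. cis (2 * pi * of_int n * t)) = (if n = 0 then 1 else 0)"
proof (cases "n = 0")
  case True
  interpret prob_space unit_measure by (rule prob_space_unit_measure)
  show ?thesis using True by (simp add: prob_space)
next
  case False
  define F where "F = (\<lambda>t. cis (2 * pi * of_int n * t) / (\<i> * of_real (2 * pi * of_int n)))"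
  have "(LINT t | unit_measure. cis (2 * pi * of_int n * t)) =
      (LINT t | lborel. indicator {0..1} t *\<^sub>R cis (2 * pi * of_int n * t))"
    unfolding unit_measure_def by (subst integral_restrict_space) auto
  also have "\<dots> = F 1 - F 0"
  proof (rule integral_FTC_atLeastAtMost)
    fix t :: real
    have "((\<lambda>t. cis (2 * pi * of_int n * t)) has_vector_derivative
        (2 * pi * of_int n) *\<^sub>R (\<i> * cis (2 * pi * of_int n * t))) (at t within {0..1})"
      unfolding has_vector_derivative_def
      by (auto intro!: derivative_eq_intros simp: scaleR_conv_of_real)
    from has_vector_derivative_divide[OF this, of "\<i> * of_real (2 * pi * of_int n)"]
    show "(F has_vector_derivative cis (2 * pi * of_int n * t)) (at t within {0..1})"
      using False unfolding F_def by (simp add: scaleR_conv_of_real field_simps)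
  qed (auto intro!: continuous_intros)
  also have "F 1 = F 0"
    using cis_multiple_2pi[of "of_int n"] by (simp add: F_def)
  finally show ?thesis using False by simp
qed

lemma borel_measurable_component:
  assumes "i < d"
  shows "(\<lambda>x. x i) \<in> borel_measurable (torus d)"
proof -
  have "(\<lambda>x. x i) \<in> measurable (torus d) unit_measure"
    unfolding torus_def using assms by (intro measurable_component_singleton) simp
  moreover have "(\<lambda>t. t) \<in> measurable unit_measure borel"
    unfolding unit_measure_def by (intro measurable_restrict_space1) simp
  ultimately show ?thesis by (rule measurable_compose)
qed

lemma borel_measurable_cis: "f \<in> borel_measurable M \<Longrightarrow> (\<lambda>x. cis (f x)) \<in> borel_measurable M"
  by (rule borel_measurable_continuous_on[where f = cis]) (auto intro!: continuous_intros)

lemma integrable_times_unit: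
  fixes g :: "'a \<Rightarrow> 'b::{banach, second_countable_topology}"
  assumes "integrable M g" "K \<in> borel_measurable M" "\<And>y. 0 \<le> K y" "\<And>y. K y \<le> 1"
  shows "integrable M (\<lambda>y. K y *\<^sub>R g y)"
proof (rule Bochner_Integration.integrable_bound[OF assms(1)])
  show "(\<lambda>y. K y *\<^sub>R g y) \<in> borel_measurable M"
    using assms(2) borel_measurable_integrable[OF assms(1)] by (rule borel_measurable_scaleR)
  show "AE y in M. norm (K y *\<^sub>R g y) \<le> norm (g y)"
    using assms(3,4) by (auto intro!: mult_left_le_one_le)
qed

definition phase :: "nat \<Rightarrow> (nat \<Rightarrow> int) \<Rightarrow> (nat \<Rightarrow> real) \<Rightarrow> real" where
  "phase d k x = 2 * pi * (\<Sum>i<d. of_int (k i) * x i)"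

lemma fourier_phase: "fourier d f k = (LINT x | torus d. f x * cis (- phase d k x))"
  by (simp add: fourier_def phase_def)

lemma borel_measurable_phase: "phase d k \<in> borel_measurable (torus d)"
  unfolding phase_def by (intro borel_measurable_times borel_measurable_sum borel_measurable_const
      borel_measurable_component) simp

lemma integrable_times_cis:
  fixes g :: "'a \<Rightarrow> complex"
  assumes "integrable M g" "p \<in> borel_measurable M"
  shows "integrable M (\<lambda>x. g x * cis (p x))"
  by (rule Bochner_Integration.integrable_bound[OF assms(1)])
    (use assms in \<open>auto intro!: borel_measurable_times borel_measurable_cis simp: norm_mult\<close>)

lemma fourier_phase_monomial:
  assumes "k \<in> freq_lattice d" "k' \<in> freq_lattice d"
  shows "fourier d (\<lambda>x. cis (phase d k x)) k' = (if k = k' then 1 else 0)"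
proof -
  interpret product_prob_space "\<lambda>_. unit_measure" "{..<d}" by (rule product_prob_space_unit_measure)
  have "fourier d (\<lambda>x. cis (phase d k x)) k' =
      (LINT x | torus d. (\<Prod>i<d. cis (2 * pi * of_int (k i - k' i) * x i)))"
    unfolding fourier_phase prod_cis cis_mult
    by (simp add: phase_def sum_distrib_left sum_subtractf algebra_simps)
  also have "\<dots> = (\<Prod>i<d. LINT t | unit_measure. cis (2 * pi * of_int (k i - k' i) * t))"
    unfolding torus_def
    by (rule product_integral_prod) (auto intro!: integrable_unit_measure continuous_intros)
  also have "\<dots> = (\<Prod>i<d. if k i = k' i then 1 else 0)"
    unfolding integral_unit_measure_cis by simp
  also have "\<dots> = (if k = k' then 1 else 0)"
  proof (cases "k = k'")
    case False
    then obtain i where "i < d" "k i \<noteq> k' i" using PiE_ext[OF assms] by auto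
    then show ?thesis using False by (auto intro!: prod_zero)
  qed simp
  finally show ?thesis .
qed

section \<open>Trigonometric polynomials\<close>

definition trig_poly :: "nat \<Rightarrow> (nat \<Rightarrow> int) set \<Rightarrow> ((nat \<Rightarrow> int) \<Rightarrow> complex) \<Rightarrow> (nat \<Rightarrow> real) \<Rightarrow> complex" where
  "trig_poly d I c x = (\<Sum>k\<in>I. c k * cis (phase d k x))"

lemma integrable_cis_phase: "integrable (torus d) (\<lambda>x. cis (phase d k x))"
proof -
  interpret prob_space "torus d" by (rule prob_space_torus)
  have "integrable (torus d) (\<lambda>x. 1 * cis (phase d k x))"
    by (rule integrable_times_cis[OF _ borel_measurable_phase]) simp
  then show ?thesis by simp
qed

lemma integrable_trig_poly: "integrable (torus d) (trig_poly d I c)"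
  unfolding trig_poly_def
  by (intro Bochner_Integration.integrable_sum integrable_mult_right integrable_cis_phase)

lemma fourier_trig_poly:
  assumes "finite I" "I \<subseteq> freq_lattice d" "k \<in> freq_lattice d"
  shows "fourier d (trig_poly d I c) k = (if k \<in> I then c k else 0)"
proof -
  have "fourier d (trig_poly d I c) k =
      (LINT x | torus d. (\<Sum>k'\<in>I. c k' * (cis (phase d k' x) * cis (- phase d k x))))"
    by (simp add: fourier_phase trig_poly_def sum_distrib_right mult.assoc)
  also have "\<dots> = (\<Sum>k'\<in>I. c k' * fourier d (\<lambda>x. cis (phase d k' x)) k)"
    unfolding fourier_phase
    by (subst Bochner_Integration.integral_sum)
      (auto intro!: integrable_mult_right integrable_times_cis integrable_cis_phase
        borel_measurable_uminus borel_measurable_phase)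
  also have "\<dots> = (\<Sum>k'\<in>I. if k' = k then c k else 0)"
    using assms by (intro sum.cong) (auto simp: fourier_phase_monomial subset_iff)
  finally show ?thesis using assms by simp
qed

lemma fourier_diff:
  assumes "integrable (torus d) f" "integrable (torus d) g"
  shows "fourier d (\<lambda>x. f x - g x) k = fourier d f k - fourier d g k"
  unfolding fourier_phase left_diff_distrib
  by (intro Bochner_Integration.integral_diff integrable_times_cis assms borel_measurable_uminus
      borel_measurable_phase)

section \<open>Powers of (1 + cos) / 2 as trigonometric kernels\<close>

lemma cos_kernel_power:
  "complex_of_real (((1 + cos \<theta>) / 2) ^ n) =
    (\<Sum>m\<le>2 * n. of_real (real (2 * n choose m) / 4 ^ n) * cis (of_int (int m - int n) * \<theta>))"
proof -
  \<comment> \<open>Up to a shift by one frequency, 1 + cos \<theta> is the square of 1 + cis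
    \<theta>; its powers therefore have binomial coefficients, shifted by \<open>n\<close>.\<close>
  have "cis (- \<theta>) * (1 + cis \<theta>)\<^sup>2 = cis (- \<theta>) + 2 + cis \<theta>"
    by (simp add: power2_eq_square algebra_simps cis_mult)
  also have "\<dots> = complex_of_real (2 * (1 + cos \<theta>))"
    by (simp add: complex_eq_iff)
  finally have "complex_of_real ((1 + cos \<theta>) / 2) = cis (- \<theta>) * (1 + cis \<theta>)\<^sup>2 / 4"
    by simp
  then have "complex_of_real (((1 + cos \<theta>) / 2) ^ n) = (cis (- \<theta>) * (1 + cis \<theta>)\<^sup>2 / 4) ^ n"
    by (simp only: of_real_power)
  also have "\<dots> = cis (- (real n * \<theta>)) * (cis \<theta> + 1) ^ (2 * n) / 4 ^ n"
    by (simp only: power_divide power_mult_distrib Complex.DeMoivre power_mult add.commute mult_minus_right)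
  also have "(cis \<theta> + 1) ^ (2 * n) = (\<Sum>m\<le>2 * n. of_nat (2 * n choose m) * cis (real m * \<theta>))"
    by (simp add: binomial_ring Complex.DeMoivre)
  also have "cis (- (real n * \<theta>)) * \<dots> / 4 ^ n =
      (\<Sum>m\<le>2 * n. of_real (real (2 * n choose m) / 4 ^ n) * (cis (- (real n * \<theta>)) * cis (real m * \<theta>)))"
    by (simp add: sum_distrib_left sum_divide_distrib mult_ac)
  also have "\<dots> = (\<Sum>m\<le>2 * n. of_real (real (2 * n choose m) / 4 ^ n) * cis (of_int (int m - int n) * \<theta>))"
    unfolding cis_mult by (simp add: algebra_simps)
  finally show ?thesis .
qed

text \<open>As (1 + cos \<theta>) / 2 is the square of cos (\<theta> / 2), the powers of this
  product are unnormalized de la Vallee-Poussin kernels. They are nonnegative, and so are their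
  Fourier coefficients, of which the constant one is the largest.\<close>

definition torus_kernel :: "nat \<Rightarrow> (nat \<Rightarrow> real) \<Rightarrow> (nat \<Rightarrow> real) \<Rightarrow> real" where
  "torus_kernel d x y = (\<Prod>i<d. (1 + cos (2 * pi * (x i - y i))) / 2)"

definition central_weight :: "nat \<Rightarrow> real" where
  "central_weight n = real (2 * n choose n) / 4 ^ n"

lemma integral_cos_kernel_power:
  "(LINT t | unit_measure. ((1 + cos (2 * pi * (x - t))) / 2) ^ n) = central_weight n"
proof -
  let ?w = "\<lambda>m. complex_of_real (real (2 * n choose m) / 4 ^ n)"
  have eq: "complex_of_real (((1 + cos (2 * pi * (x - t))) / 2) ^ n) =
      (\<Sum>m\<le>2 * n. (?w m * cis (of_int (int m - int n) * (2 * pi * x))) *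
        cis (2 * pi * of_int (int n - int m) * t))" for t
    unfolding cos_kernel_power mult.assoc cis_mult by (simp add: algebra_simps)
  have "complex_of_real (LINT t | unit_measure. ((1 + cos (2 * pi * (x - t))) / 2) ^ n) =
      (LINT t | unit_measure. (\<Sum>m\<le>2 * n. (?w m * cis (of_int (int m - int n) * (2 * pi * x))) *
        cis (2 * pi * of_int (int n - int m) * t)))"
    unfolding eq[symmetric] by (rule integral_complex_of_real[symmetric])
  also have "\<dots> = (\<Sum>m\<le>2 * n. (?w m * cis (of_int (int m - int n) * (2 * pi * x))) *
        (LINT t | unit_measure. cis (2 * pi * of_int (int n - int m) * t)))"
    by (subst Bochner_Integration.integral_sum)
      (auto intro!: integrable_mult_right integrable_unit_measure continuous_intros)
  also have "\<dots> = (\<Sum>m\<le>2 * n. if m = n then ?w n else 0)"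
    unfolding integral_unit_measure_cis by (intro sum.cong) auto
  also have "\<dots> = complex_of_real (central_weight n)"
    by (simp add: central_weight_def)
  finally show ?thesis by (simp only: of_real_eq_iff)
qed

lemma kernel_power: "torus_kernel d x y ^ n = (\<Prod>i<d. ((1 + cos (2 * pi * (x i - y i))) / 2) ^ n)"
  by (simp add: torus_kernel_def prod_power_distrib)

lemma integral_kernel_power:
  "integrable (torus d) (\<lambda>y. torus_kernel d x y ^ n)"
  "(LINT y | torus d. torus_kernel d x y ^ n) = central_weight n ^ d"
proof -
  interpret product_prob_space "\<lambda>_. unit_measure" "{..<d}" by (rule product_prob_space_unit_measure)
  let ?f = "\<lambda>i t. ((1 + cos (2 * pi * (x i - t))) / 2) ^ n"
  have int: "integrable unit_measure (?f i)" for i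
    by (intro integrable_unit_measure continuous_intros) simp
  show "integrable (torus d) (\<lambda>y. torus_kernel d x y ^ n)"
    unfolding kernel_power torus_def
    using product_integrable_prod[of "{..<d}" ?f] int by simp
  show "(LINT y | torus d. torus_kernel d x y ^ n) = central_weight n ^ d"
    unfolding kernel_power torus_def
    using product_integral_prod[of "{..<d}" ?f] int by (simp add: integral_cos_kernel_power)
qed

text \<open>The dependence on \<open>x\<close> and on \<open>y\<close> is kept apart in each term,
  so that integration over \<open>y\<close> against a function produces its Fourier
  coefficients.\<close>

lemma kernel_power_expansion:
  "complex_of_real (torus_kernel d x y ^ n) = (\<Sum>p\<in>{..<d} \<rightarrow>\<^sub>E {..2 * n}.
     (of_real (\<Prod>i<d. real (2 * n choose p i) / 4 ^ n) * cis (phase d (\<lambda>i\<in>{..<d}. int (p i) - int n) x))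
     * cis (- phase d (\<lambda>i\<in>{..<d}. int (p i) - int n) y))"
proof -
  have "complex_of_real (torus_kernel d x y ^ n) = (\<Prod>i<d. \<Sum>m\<le>2 * n.
      of_real (real (2 * n choose m) / 4 ^ n) * cis (of_int (int m - int n) * (2 * pi * (x i - y i))))"
    unfolding kernel_power of_real_prod cos_kernel_power ..
  also have "\<dots> = (\<Sum>p\<in>{..<d} \<rightarrow>\<^sub>E {..2 * n}. \<Prod>i<d.
      of_real (real (2 * n choose p i) / 4 ^ n) * cis (of_int (int (p i) - int n) * (2 * pi * (x i - y i))))"
    by (rule prod_sum_PiE) auto
  also have "\<dots> = (\<Sum>p\<in>{..<d} \<rightarrow>\<^sub>E {..2 * n}.
     (of_real (\<Prod>i<d. real (2 * n choose p i) / 4 ^ n) * cis (phase d (\<lambda>i\<in>{..<d}. int (p i) - int n) x))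
     * cis (- phase d (\<lambda>i\<in>{..<d}. int (p i) - int n) y))"
  proof (rule sum.cong[OF refl])
    fix p
    have "(\<Sum>i<d. of_int (int (p i) - int n) * (2 * pi * (x i - y i))) =
        phase d (\<lambda>i\<in>{..<d}. int (p i) - int n) x + - phase d (\<lambda>i\<in>{..<d}. int (p i) - int n) y"
      unfolding phase_def sum_distrib_left sum_negf[symmetric] sum.distrib[symmetric]
      by (intro sum.cong refl) (simp add: algebra_simps)
    then show "(\<Prod>i<d. of_real (real (2 * n choose p i) / 4 ^ n) * cis (of_int (int (p i) - int n) * (2 * pi * (x i - y i))))
      = (of_real (\<Prod>i<d. real (2 * n choose p i) / 4 ^ n) * cis (phase d (\<lambda>i\<in>{..<d}. int (p i) - int n) x))
     * cis (- phase d (\<lambda>i\<in>{..<d}. int (p i) - int n) y)"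
      unfolding prod.distrib prod_cis mult.assoc cis_mult of_real_prod by simp
  qed
  finally show ?thesis .
qed

text \<open>The integral is a weighted sum of Fourier coefficients of \<open>g\<close>, at
  frequencies that differ for different \<open>p\<close>. A product of \<open>d\<close> binomial
  weights is at most the \<open>d\<close>-th power of the central one, since the middle binomial
  coefficient is the largest.\<close>

lemma norm_integral_kernel_power_le:
  assumes "integrable (torus d) g" "(\<lambda>k. cmod (fourier d g k)) summable_on freq_lattice d"
  shows "cmod (LINT y | torus d. g y * of_real (torus_kernel d x y ^ n)) \<le>
    l1_norm (freq_lattice d) (fourier d g) * central_weight n ^ d"
proof -
  let ?P = "{..<d} \<rightarrow>\<^sub>E {..2 * n}"
  let ?k = "\<lambda>p. \<lambda>i\<in>{..<d}. int (p i) - int n"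
  let ?w = "\<lambda>p. \<Prod>i<d. real (2 * n choose p i) / 4 ^ n"
  have eq: "(LINT y | torus d. g y * of_real (torus_kernel d x y ^ n)) =
      (\<Sum>p\<in>?P. (of_real (?w p) * cis (phase d (?k p) x)) * fourier d g (?k p))"
  proof -
    have "(LINT y | torus d. g y * of_real (torus_kernel d x y ^ n)) =
      (LINT y | torus d. (\<Sum>p\<in>?P. (of_real (?w p) * cis (phase d (?k p) x)) * (g y * cis (- phase d (?k p) y))))"
    unfolding kernel_power_expansion by (simp add: sum_distrib_left mult_ac)
  also have "\<dots> = (\<Sum>p\<in>?P. (of_real (?w p) * cis (phase d (?k p) x)) * fourier d g (?k p))"
    unfolding fourier_phase
    by (subst Bochner_Integration.integral_sum)
      (auto intro!: integrable_mult_right integrable_times_cis assms borel_measurable_uminus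
        borel_measurable_phase)
    finally show ?thesis .
  qed
  have "cmod (LINT y | torus d. g y * of_real (torus_kernel d x y ^ n)) \<le>
      (\<Sum>p\<in>?P. cmod ((of_real (?w p) * cis (phase d (?k p) x)) * fourier d g (?k p)))"
    unfolding eq by (rule norm_sum)
  also have "\<dots> \<le> (\<Sum>p\<in>?P. central_weight n ^ d * cmod (fourier d g (?k p)))"
  proof (rule sum_mono)
    fix p :: "nat \<Rightarrow> nat"
    have norm_aux: "0 \<le> r \<Longrightarrow> cmod (of_real r * cis t * w) = r * cmod w" for r t w
      by (simp add: norm_mult)
    have w: "0 \<le> real (2 * n choose p i) / 4 ^ n \<and> real (2 * n choose p i) / 4 ^ n \<le> central_weight n" for i
    proof
      have "real (2 * n choose p i) \<le> real (2 * n choose n)"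
        by (rule of_nat_mono[OF binomial_maximum'])
      then show "real (2 * n choose p i) / 4 ^ n \<le> central_weight n"
        unfolding central_weight_def by (rule divide_right_mono) simp
    qed simp
    have le: "?w p \<le> central_weight n ^ d"
      using prod_mono[of "{..<d}" "\<lambda>i. real (2 * n choose p i) / 4 ^ n" "\<lambda>_. central_weight n"] w
      by simp
    have nonneg: "0 \<le> ?w p" by (rule prod_nonneg) simp
    have "cmod ((of_real (?w p) * cis (phase d (?k p) x)) * fourier d g (?k p))
        = ?w p * cmod (fourier d g (?k p))"
      by (rule norm_aux[OF nonneg])
    also have "\<dots> \<le> central_weight n ^ d * cmod (fourier d g (?k p))"
      by (rule mult_right_mono[OF le norm_ge_zero])
    finally show "cmod ((of_real (?w p) * cis (phase d (?k p) x)) * fourier d g (?k p)) \<le>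
        central_weight n ^ d * cmod (fourier d g (?k p))" .
  qed
  also have "\<dots> = central_weight n ^ d * (\<Sum>k\<in>?k ` ?P. cmod (fourier d g k))"
  proof -
    have "inj_on ?k ?P"
    proof (rule inj_onI)
      fix p q assume "p \<in> ?P" "q \<in> ?P" and eq: "?k p = ?k q"
      show "p = q"
      proof (rule PiE_ext[OF \<open>p \<in> ?P\<close> \<open>q \<in> ?P\<close>])
        fix i assume "i \<in> {..<d}"
        with fun_cong[OF eq, of i] show "p i = q i" by simp
      qed
    qed
    then show ?thesis by (subst sum.reindex) (auto simp: sum_distrib_left)
  qed
  also have "\<dots> \<le> central_weight n ^ d * l1_norm (freq_lattice d) (fourier d g)"
    unfolding l1_norm_def
    by (intro mult_left_mono finite_sum_le_infsum assms zero_le_power finite_imageI finite_PiE)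
      (auto simp: central_weight_def)
  finally show ?thesis by (simp add: mult.commute)
qed

section \<open>Pointwise bound by the l1 norm of the Fourier coefficients\<close>

lemma periodic_shift:
  assumes "periodic d g" "y \<in> points d"
  shows "g (\<lambda>i\<in>{..<d}. y i + of_int (k i)) = g y"
proof -
  have nat: "g (y(i := y i + real n)) = g y" if "y \<in> points d" "i < d" for y i n
  proof (induction n)
    case 0
    then show ?case by simp
  next
    case (Suc n)
    have "y(i := y i + real n) \<in> points d" using that by (auto simp: PiE_def extensional_def)
    then have "g ((y(i := y i + real n))(i := (y(i := y i + real n)) i + 1)) = g (y(i := y i + real n))"
      using assms(1) that unfolding periodic_def by blast
    moreover have "(y(i := y i + real n))(i := (y(i := y i + real n)) i + 1) = y(i := y i + real (Suc n))"
      by (simp add: fun_eq_iff)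
    ultimately show ?case using Suc by (simp only:)
  qed
  have int: "g (y(i := y i + of_int n)) = g y" if "y \<in> points d" "i < d" for y i n
  proof (cases "0 \<le> n")
    case True
    then show ?thesis using nat[OF that, of "nat n"] by simp
  next
    case False
    \<comment> \<open>For negative \<open>n\<close>, the result for natural numbers is applied at
      the shifted point, from which -n steps lead back to \<open>y\<close>.\<close>
    have "y(i := y i + of_int n) \<in> points d" using that by (auto simp: PiE_def extensional_def)
    from nat[OF this that(2), of "nat (- n)"] show ?thesis using False by simp
  qed
  have "g (\<lambda>i\<in>{..<d}. if i < j then y i + of_int (k i) else y i) = g y" if "j \<le> d" for j
    using that
  proof (induction j)
    case 0
    have "(\<lambda>i\<in>{..<d}. y i) = y" using assms(2) by (auto simp: PiE_def extensional_def)
    then show ?case by simp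
  next
    case (Suc j)
    let ?y = "\<lambda>i\<in>{..<d}. if i < j then y i + of_int (k i) else y i"
    have "(\<lambda>i\<in>{..<d}. if i < Suc j then y i + of_int (k i) else y i) = ?y(j := ?y j + of_int (k j))"
      using Suc.prems by (auto simp: fun_eq_iff less_Suc_eq)
    moreover have "?y \<in> points d" by auto
    ultimately have "g (\<lambda>i\<in>{..<d}. if i < Suc j then y i + of_int (k i) else y i) = g ?y"
      using int[of ?y j "k j"] Suc.prems by (simp only: Suc_le_eq)
    also have "\<dots> = g y" using Suc by (simp only: Suc_leD)
    finally show ?case .
  qed
  moreover have "(\<lambda>i\<in>{..<d}. if i < d then y i + of_int (k i) else y i) = (\<lambda>i\<in>{..<d}. y i + of_int (k i))"
    by (auto simp: fun_eq_iff)
  ultimately show ?thesis by (metis order_refl)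
qed

lemma tendsto_power_times_geometric_zero:
  fixes q :: real
  assumes "0 < q" "q < 1"
  shows "(\<lambda>n. (2 * real n) ^ d * q ^ n) \<longlonglongrightarrow> 0"
  using assms by real_asymp

lemma cos_01: "0 \<le> (1 + cos t) / 2 \<and> (1 + cos t) / 2 \<le> (1::real)"
proof -
  have "0 \<le> (1 + c) / 2 \<and> (1 + c) / 2 \<le> 1" if "- 1 \<le> c" "c \<le> 1" for c :: real
    using that by simp
  from this[OF cos_ge_minus_one cos_le_one] show ?thesis .
qed

text \<open>All factors lie in [0, 1], so each of them is at least the product.\<close>

lemma kernel_factor:
  assumes "torus_kernel d x y > 1 - \<delta>" "i < d"
  shows "(1 + cos (2 * pi * (x i - y i))) / 2 > 1 - \<delta>"
proof -
  let ?f = "\<lambda>i. (1 + cos (2 * pi * (x i - y i))) / 2"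
  have f: "0 \<le> ?f i \<and> ?f i \<le> 1" for i
    using cos_01 .
  have "torus_kernel d x y = ?f i * (\<Prod>i\<in>{..<d} - {i}. ?f i)"
    unfolding torus_kernel_def using assms(2) by (simp only: prod.remove[of "{..<d}" i] finite_lessThan lessThan_iff)
  also have "\<dots> \<le> ?f i * 1"
    using f by (intro mult_left_mono prod_le_1) auto
  finally show ?thesis using assms(1) by simp
qed

lemma kernel_bounds: "0 \<le> torus_kernel d x y" "torus_kernel d x y \<le> 1"
  unfolding torus_kernel_def using cos_01 by (auto intro!: prod_nonneg prod_le_1)

text \<open>Rounding selects the translate of \<open>y i\<close> nearest to \<open>x i\<close>. Its
  distance \<open>t\<close> is at most 1/2, so 2 \<pi> t lies where cos decreases, and a kernel
  value above the threshold forces t < \<rho>.\<close>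

lemma kernel_concentrated:
  assumes "0 < \<rho>" "\<rho> \<le> 1 / 4" "torus_kernel d x y > (1 + cos (2 * pi * \<rho>)) / 2" "i < d"
  shows "\<bar>y i + of_int (round (x i - y i)) - x i\<bar> < \<rho>"
proof (rule ccontr)
  define t where "t = \<bar>y i + of_int (round (x i - y i)) - x i\<bar>"
  assume "\<not> ?thesis"
  then have "\<rho> \<le> t" by (simp add: t_def)
  have "t \<le> 1 / 2" using of_int_round_abs_le[of "x i - y i"] by (simp add: t_def algebra_simps)
  have "cos (2 * pi * (x i - y i)) = cos (2 * pi * (x i - y i - of_int (round (x i - y i))))"
  proof -
    have "2 * pi * (x i - y i - of_int (round (x i - y i)))
        = 2 * pi * (x i - y i) - of_int (round (x i - y i)) * (2 * of_real pi)"
      by (simp add: algebra_simps)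
    then show ?thesis by (simp only: cos.minus_of_int)
  qed
  also have "\<dots> = cos (2 * pi * t)"
    by (simp add: t_def abs_if algebra_simps) (metis cos_minus minus_diff_eq)
  also have "\<dots> \<le> cos (2 * pi * \<rho>)"
    using \<open>\<rho> \<le> t\<close> \<open>t \<le> 1 / 2\<close> assms(1) by (intro cos_monotone_0_pi_le) auto
  finally have "cos (2 * pi * (x i - y i)) \<le> cos (2 * pi * \<rho>)" .
  moreover have "(1 + cos (2 * pi * (x i - y i))) / 2 > 1 - (1 - (1 + cos (2 * pi * \<rho>)) / 2)"
    using assms(3,4) by (intro kernel_factor) auto
  ultimately show False by simp
qed

text \<open>
  If \<open>|g x| > S\<close> with \<open>S\<close> the \<open>l\<^sup>1\<close> norm of the coefficients, rotate \<open>g\<close> so that \<open>g x > S\<close>.  The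
  powers of the kernel concentrate at \<open>x\<close>, and their mass decays only polynomially, so
  \<open>Re g - S\<close> has a positive integral against some power; but the coefficients of that power are
  at most its mass, so the integral is nonpositive.
\<close>

lemma norm_le_l1_norm_fourier:
  assumes per: "periodic d g" and x: "x \<in> points d"
    and cont: "\<And>\<epsilon>. 0 < \<epsilon> \<Longrightarrow> \<exists>\<rho>>0. \<forall>y\<in>points d. (\<forall>i<d. \<bar>y i - x i\<bar> < \<rho>) \<longrightarrow> cmod (g y - g x) < \<epsilon>"
    and int: "integrable (torus d) g"
    and sum: "(\<lambda>k. cmod (fourier d g k)) summable_on freq_lattice d"
  shows "cmod (g x) \<le> l1_norm (freq_lattice d) (fourier d g)"
proof (rule ccontr)
  define S where "S = l1_norm (freq_lattice d) (fourier d g)"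
  assume "\<not> ?thesis"
  then have gt: "cmod (g x) > S" by (simp add: S_def)
  have S0: "0 \<le> S" unfolding S_def l1_norm_def by (rule infsum_nonneg) simp
  interpret prob_space "torus d" by (rule prob_space_torus)
  define u where "u = cnj (g x) / cmod (g x)"
  define h where "h y = Re (u * g y) - S" for y
  \<comment> \<open>Half the gap: near \<open>x\<close>, \<open>h\<close> is at least the gap 2
    \<epsilon> minus a variation of \<open>g\<close> below \<epsilon>.\<close>
  define \<epsilon> where "\<epsilon> = (cmod (g x) - S) / 2"
  have \<epsilon>: "\<epsilon> > 0" using gt by (simp add: \<epsilon>_def)
  have gx: "g x \<noteq> 0" using gt S0 by auto
  then have u: "cmod u = 1" by (simp add: u_def norm_divide)
  have ug: "u * g x = cmod (g x)"
    using gx complex_norm_square[of "g x"] by (simp add: u_def field_simps power2_eq_square)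
  obtain \<rho>0 where \<rho>0: "\<rho>0 > 0"
    "\<And>y. y \<in> points d \<Longrightarrow> (\<And>i. i < d \<Longrightarrow> \<bar>y i - x i\<bar> < \<rho>0) \<Longrightarrow> cmod (g y - g x) < \<epsilon>"
    using cont[OF \<epsilon>] by blast
  \<comment> \<open>The cap 1/4 makes cos (2 \<pi> \<rho>) nonnegative, so that the threshold
    \<open>q\<close> lies strictly between 0 and 1.\<close>
  define \<rho> where "\<rho> = min \<rho>0 (1 / 4)"
  have \<rho>: "0 < \<rho>" "\<rho> \<le> 1 / 4" "\<rho> \<le> \<rho>0" using \<rho>0 by (auto simp: \<rho>_def)
  define q where "q = (1 + cos (2 * pi * \<rho>)) / 2"
  have "cos (2 * pi * \<rho>) < cos 0" using \<rho> by (intro cos_monotone_0_pi) auto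
  then have "q < 1" by (simp add: q_def)
  have "0 \<le> 2 * pi * \<rho>" "2 * pi * \<rho> \<le> pi / 2" using \<rho> by auto
  then have "0 \<le> cos (2 * pi * \<rho>)" using pi_ge_zero by (intro cos_ge_zero) linarith+
  then have "0 < q" by (simp add: q_def)
  have near: "\<epsilon> \<le> h y" if y: "y \<in> points d" and "torus_kernel d x y > q" for y
  proof -
    define y' where "y' = (\<lambda>i\<in>{..<d}. y i + of_int (round (x i - y i)))"
    have "y' \<in> points d" by (simp add: y'_def)
    moreover have "\<bar>y' i - x i\<bar> < \<rho>0" if "i < d" for i
      using kernel_concentrated[OF \<rho>(1,2) _ that, of x y] \<open>torus_kernel d x y > q\<close> that \<rho>(3)
      by (simp add: y'_def q_def)
    ultimately have "cmod (g y' - g x) < \<epsilon>" by (rule \<rho>0(2))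
    moreover have "g y' = g y" unfolding y'_def by (rule periodic_shift[OF per y])
    moreover have "\<bar>Re (u * (g y - g x))\<bar> \<le> cmod (g y - g x)"
      using abs_Re_le_cmod[of "u * (g y - g x)"] u by (simp add: norm_mult)
    ultimately have "Re (u * g x) - \<epsilon> \<le> Re (u * g y)"
      by (simp add: right_diff_distrib)
    then show ?thesis unfolding ug h_def by (simp add: \<epsilon>_def field_simps)
  qed
  have h_int: "integrable (torus d) h"
    unfolding h_def using int by (intro Bochner_Integration.integrable_diff integrable_Re integrable_mult_right) simp_all
  define B where "B = (LINT y | torus d. \<bar>h y\<bar> + \<epsilon>)"
  have bound: "\<epsilon> * central_weight n ^ d \<le> B * q ^ n" for n
  proof -
    let ?K = "\<lambda>y. torus_kernel d x y ^ n"
    note K = integral_kernel_power[of d x n]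
    have K01: "0 \<le> ?K y" "?K y \<le> 1" for y
      using kernel_bounds[of d x y] by (auto intro: power_le_one)
    have gK: "integrable (torus d) (\<lambda>y. g y * of_real (?K y))"
      using integrable_times_unit[OF int borel_measurable_integrable[OF K(1)] K01]
      by (simp add: scaleR_conv_of_real mult.commute)
    have hK: "integrable (torus d) (\<lambda>y. h y * ?K y)"
      using integrable_times_unit[OF h_int borel_measurable_integrable[OF K(1)] K01]
      by (simp add: mult.commute)
    have "(LINT y | torus d. h y * ?K y) = (LINT y | torus d. Re (u * (g y * of_real (?K y))) - S * ?K y)"
      unfolding h_def by (simp add: algebra_simps)
    also have "\<dots> = Re (u * (LINT y | torus d. g y * of_real (?K y))) - S * central_weight n ^ d"
    proof -
      have ugK: "integrable (torus d) (\<lambda>y. u * (g y * of_real (?K y)))"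
        using gK by (intro integrable_mult_right)
      have SK: "integrable (torus d) (\<lambda>y. S * ?K y)" using K(1) by (intro integrable_mult_right)
      have "(LINT y | torus d. Re (u * (g y * of_real (?K y))) - S * ?K y) =
          (LINT y | torus d. Re (u * (g y * of_real (?K y)))) - (LINT y | torus d. S * ?K y)"
        by (rule Bochner_Integration.integral_diff[OF integrable_Re[OF ugK] SK])
      also have "(LINT y | torus d. Re (u * (g y * of_real (?K y)))) =
          Re (LINT y | torus d. u * (g y * of_real (?K y)))"
        by (rule integral_Re[OF ugK])
      finally show ?thesis by (simp only: integral_mult_right_zero K(2))
    qed
    also have "\<dots> \<le> 0"
    proof -
      have "Re (u * (LINT y | torus d. g y * of_real (?K y))) \<le>
          cmod (u * (LINT y | torus d. g y * of_real (?K y)))" by (rule complex_Re_le_cmod)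
      also have "\<dots> \<le> S * central_weight n ^ d"
        using norm_integral_kernel_power_le[OF int sum] u by (simp add: norm_mult S_def)
      finally show ?thesis by simp
    qed
    finally have "(LINT y | torus d. h y * ?K y) \<le> 0" .
    \<comment> \<open>The left integrand is a minorant: where the kernel exceeds \<open>q\<close>,
      because \<open>h\<close> is at least \<epsilon> there; elsewhere \<open>?K\<close> is at most
      \<open>q ^ n\<close>, and the subtracted term outweighs both \<epsilon> \<open>?K\<close> and
      |h| \<open>?K\<close>.\<close>
    moreover have "(LINT y | torus d. \<epsilon> * ?K y - (\<bar>h y\<bar> + \<epsilon>) * q ^ n) \<le> (LINT y | torus d. h y * ?K y)"
    proof (rule integral_mono)
      show "integrable (torus d) (\<lambda>y. \<epsilon> * ?K y - (\<bar>h y\<bar> + \<epsilon>) * q ^ n)"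
        using K h_int by (intro Bochner_Integration.integrable_diff integrable_mult_right
          integrable_mult_left Bochner_Integration.integrable_add) auto
      show "integrable (torus d) (\<lambda>y. h y * ?K y)" by (rule hK)
      fix y assume "y \<in> space (torus d)"
      then have y: "y \<in> points d"
        unfolding torus_def space_PiM by auto
      show "\<epsilon> * ?K y - (\<bar>h y\<bar> + \<epsilon>) * q ^ n \<le> h y * ?K y"
      proof (cases "torus_kernel d x y > q")
        case True
        from near[OF y this] have "\<epsilon> * ?K y \<le> h y * ?K y" using K01 by (intro mult_right_mono)
        moreover have "0 \<le> (\<bar>h y\<bar> + \<epsilon>) * q ^ n" using \<epsilon> \<open>0 < q\<close> by simp
        ultimately show ?thesis by linarith
      next
        case False
        then have "?K y \<le> q ^ n" using kernel_bounds by (intro power_mono) auto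
        then have "(\<bar>h y\<bar> + \<epsilon>) * ?K y \<le> (\<bar>h y\<bar> + \<epsilon>) * q ^ n"
          using \<epsilon> by (intro mult_left_mono) auto
        moreover have "- \<bar>h y\<bar> * ?K y \<le> h y * ?K y" using K01 by (intro mult_right_mono) auto
        ultimately show ?thesis by (simp add: algebra_simps)
      qed
    qed
    moreover have "(LINT y | torus d. \<epsilon> * ?K y - (\<bar>h y\<bar> + \<epsilon>) * q ^ n) = \<epsilon> * central_weight n ^ d - B * q ^ n"
      unfolding B_def using K h_int by (subst Bochner_Integration.integral_diff)
        (auto intro!: integrable_mult_right integrable_mult_left Bochner_Integration.integrable_add)
    ultimately show ?thesis by simp
  qed
  have "\<epsilon> \<le> B * ((2 * real n) ^ d * q ^ n)" if "n > 0" for n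
  proof -
    have "1 / (2 * real n) \<le> central_weight n"
      using central_binomial_lower_bound[OF that] that by (simp add: central_weight_def field_simps)
    then have "(1 / (2 * real n)) ^ d \<le> central_weight n ^ d" by (intro power_mono) auto
    then have "\<epsilon> * (1 / (2 * real n)) ^ d \<le> B * q ^ n"
      using bound[of n] \<epsilon> by (meson mult_left_mono less_imp_le order_trans)
    then have "(2 * real n) ^ d * (\<epsilon> * (1 / (2 * real n)) ^ d) \<le> (2 * real n) ^ d * (B * q ^ n)"
      by (intro mult_left_mono) auto
    then show ?thesis using that by (simp add: power_divide mult_ac)
  qed
  then have "\<forall>\<^sub>F n in sequentially. \<epsilon> \<le> B * ((2 * real n) ^ d * q ^ n)"
    by (intro eventually_sequentiallyI[of 1]) auto
  moreover have "(\<lambda>n. B * ((2 * real n) ^ d * q ^ n)) \<longlonglongrightarrow> B * 0"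
    by (intro tendsto_mult_left tendsto_power_times_geometric_zero) fact+
  ultimately have "\<epsilon> \<le> B * 0" by (intro tendsto_lowerbound) auto
  then show False using \<epsilon> by simp
qed

section \<open>Difference between a function and a partial sum of its Fourier series\<close>

lemma continuous_map_trig_poly:
  assumes "finite I"
  shows "continuous_map (product_topology (\<lambda>_. euclideanreal) {..<d}) euclidean (trig_poly d I c)"
proof -
  let ?X = "product_topology (\<lambda>_. euclideanreal) {..<d}"
  have "continuous_map ?X euclidean (phase d k)" for k
    unfolding phase_def
    by (intro continuous_map_real_mult continuous_map_sum continuous_map_product_projection
        continuous_map_canonical_const) auto
  moreover have "continuous_map euclideanreal euclidean (\<lambda>t. c k * cis t)" for k
    by (simp add: continuous_intros)
  ultimately have "continuous_map ?X euclidean ((\<lambda>t. c k * cis t) \<circ> phase d k)" for k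
    by (rule continuous_map_compose)
  then have "continuous_map ?X euclidean (\<lambda>x. c k * cis (phase d k x))" for k
    by (simp only: o_def)
  then show ?thesis
    unfolding trig_poly_def using assms by (intro continuous_map_sum) auto
qed

lemma continuous_map_product_eps:
  fixes g :: "(nat \<Rightarrow> real) \<Rightarrow> complex"
  assumes "continuous_map (product_topology (\<lambda>_. euclideanreal) {..<d}) euclidean g"
    and x: "x \<in> points d" and "0 < \<epsilon>"
  shows "\<exists>\<rho>>0. \<forall>y\<in>points d. (\<forall>i<d. \<bar>y i - x i\<bar> < \<rho>) \<longrightarrow> cmod (g y - g x) < \<epsilon>"
proof -
  let ?X = "product_topology (\<lambda>_. euclideanreal) {..<d}"
  have "openin ?X {y \<in> topspace ?X. g y \<in> ball (g x) \<epsilon>}"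
    by (rule openin_continuous_map_preimage[OF assms(1)]) simp
  moreover have "x \<in> {y \<in> topspace ?X. g y \<in> ball (g x) \<epsilon>}" using x \<open>0 < \<epsilon>\<close> by simp
  ultimately have "\<exists>U. finite {i \<in> {..<d}. U i \<noteq> topspace euclideanreal} \<and>
      (\<forall>i\<in>{..<d}. openin euclideanreal (U i)) \<and> x \<in> PiE {..<d} U \<and>
      PiE {..<d} U \<subseteq> {y \<in> topspace ?X. g y \<in> ball (g x) \<epsilon>}"
    unfolding openin_product_topology_alt by (rule bspec)
  then obtain U where U: "\<And>i. i < d \<Longrightarrow> open (U i)" "x \<in> PiE {..<d} U"
    "PiE {..<d} U \<subseteq> {y \<in> topspace ?X. g y \<in> ball (g x) \<epsilon>}"
    by auto
  have "\<exists>r>0. \<forall>t. \<bar>t - x i\<bar> < r \<longrightarrow> t \<in> U i" if "i < d" for i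
  proof -
    have "x i \<in> U i" using U(2) that by auto
    with U(1)[OF that] obtain r where "r > 0" "ball (x i) r \<subseteq> U i" by (meson open_contains_ball)
    then show ?thesis by (auto simp: subset_iff dist_real_def abs_minus_commute)
  qed
  then obtain r where r: "\<And>i. i < d \<Longrightarrow> r i > 0" "\<And>i t. i < d \<Longrightarrow> \<bar>t - x i\<bar> < r i \<Longrightarrow> t \<in> U i"
    by metis
  \<comment> \<open>The 1 keeps the set nonempty for \<open>d = 0\<close>.\<close>
  define \<rho> where "\<rho> = Min (insert 1 (r ` {..<d}))"
  have \<rho>: "\<rho> > 0" "\<And>i. i < d \<Longrightarrow> \<rho> \<le> r i"
    using r(1) by (auto simp: \<rho>_def)
  show ?thesis
  proof (intro exI[of _ \<rho>] conjI ballI impI)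
    fix y assume y: "y \<in> points d" "\<forall>i<d. \<bar>y i - x i\<bar> < \<rho>"
    then have "y i \<in> U i" if "i < d" for i
      using r(2)[OF that] \<rho>(2)[OF that] that by (meson less_le_trans)
    then have "y \<in> PiE {..<d} U" using y(1) by auto
    then have "g y \<in> ball (g x) \<epsilon>" using U(3) by blast
    then show "cmod (g y - g x) < \<epsilon>" by (simp add: dist_norm norm_minus_commute)
  qed (rule \<rho>)
qed

lemma phase_shift:
  assumes "i < d"
  shows "phase d k (x(i := x i + 1)) = phase d k x + 2 * pi * of_int (k i)"
proof -
  have "(\<Sum>j<d. of_int (k j) * (x(i := x i + 1)) j) = (\<Sum>j<d. of_int (k j) * x j + (if j = i then of_int (k i) else 0))"
    by (intro sum.cong) (auto simp: algebra_simps)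
  then show ?thesis using assms by (simp add: phase_def sum.distrib algebra_simps)
qed

lemma cis_add_2pi_int: "cis (t + 2 * pi * of_int n) = cis t"
  using cis_multiple_2pi[of "of_int n"] by (simp flip: cis_mult)

lemma periodic_trig_poly: "periodic d (trig_poly d I c)"
  by (simp add: periodic_def trig_poly_def phase_shift cis_add_2pi_int)

text \<open>The difference has the coefficients of \<open>f\<close> off \<open>I\<close> and 0 on
  \<open>I\<close>, and it inherits continuity and periodicity, so the pointwise bound applies to
  it. This is what turns truncation into bounded noise.\<close>

lemma norm_diff_trig_poly_le:
  assumes f: "wiener_cont d f" and I: "finite I" "I \<subseteq> freq_lattice d" and x: "x \<in> points d"
  shows "cmod (f x - trig_poly d I (fourier d f) x) \<le>
    l1_norm (freq_lattice d) (\<lambda>k. fourier d f k - restr I (fourier d f) k)"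
proof -
  let ?p = "trig_poly d I (fourier d f)"
  define g where "g = (\<lambda>x. f x - ?p x)"
  have f': "periodic d f" "continuous_map (product_topology (\<lambda>_. euclideanreal) {..<d}) euclidean f"
    "integrable (torus d) f" "(\<lambda>k. cmod (fourier d f k)) summable_on freq_lattice d"
    using f by (auto simp: wiener_cont_def)
  have c: "fourier d g k = fourier d f k - restr I (fourier d f) k" if "k \<in> freq_lattice d" for k
    using that I unfolding g_def
    by (simp add: fourier_diff[OF f'(3) integrable_trig_poly] fourier_trig_poly restr_def)
  have "cmod (g x) \<le> l1_norm (freq_lattice d) (fourier d g)"
  proof (rule norm_le_l1_norm_fourier[OF _ x])
    show "periodic d g"
      using f'(1) periodic_trig_poly[of d I] unfolding periodic_def g_def by simp
    show "integrable (torus d) g"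
      unfolding g_def using f'(3) integrable_trig_poly by (rule Bochner_Integration.integrable_diff)
    have "(\<lambda>k. cmod (restr I (fourier d f) k)) summable_on freq_lattice d"
      by (rule summable_on_cong_neutral[THEN iffD1, OF _ _ _ summable_on_finite[OF I(1)]])
        (use I in \<open>auto simp: restr_def\<close>)
    then have "(\<lambda>k. cmod (fourier d f k) + cmod (restr I (fourier d f) k)) summable_on freq_lattice d"
      by (rule summable_on_add[OF f'(4)])
    then show "(\<lambda>k. cmod (fourier d g k)) summable_on freq_lattice d"
      by (rule summable_on_comparison_test) (auto simp: c norm_triangle_ineq4)
    show "\<exists>\<rho>>0. \<forall>y\<in>points d. (\<forall>i<d. \<bar>y i - x i\<bar> < \<rho>) \<longrightarrow> cmod (g y - g x) < \<epsilon>" if "0 < \<epsilon>" for \<epsilon>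
      unfolding g_def
      by (rule continuous_map_product_eps[OF continuous_map_diff[OF f'(2) continuous_map_trig_poly[OF I(1)]] x that])
  qed
  also have "\<dots> = l1_norm (freq_lattice d) (\<lambda>k. fourier d f k - restr I (fourier d f) k)"
    unfolding l1_norm_def by (intro infsum_cong) (simp add: c)
  finally show ?thesis by (simp add: g_def)
qed

section \<open>Cost and failure probability of programs\<close>

lemma run_bind_prog:
  "run g (bind_prog p f) =
    bind_pmf (run g p) (\<lambda>(a, m, n). map_pmf (\<lambda>(b, m', n'). (b, m + m', n + n')) (run g (f a)))"
proof (induction p)
  case (Return a)
  then show ?case by (simp add: bind_return_pmf case_prod_unfold)
qed (simp_all add: bind_map_pmf map_bind_pmf pmf.map_comp bind_assoc_pmf
      case_prod_unfold comp_def)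

lemma run_map_prog: "run g (map_prog h id p) = run (\<lambda>x. g (h x)) p"
  by (induction p) simp_all

text \<open>Stages without samples and random draws have a single outcome with an exact operation
  count, whatever the oracle. Replacing them by ordinary functions confines probabilistic reasoning
  to the SFT calls.\<close>

definition pure :: "('x, 'a) prog \<Rightarrow> 'a \<Rightarrow> nat \<Rightarrow> bool" where
  "pure p a n \<longleftrightarrow> (\<forall>g. run g p = return_pmf (a, 0, n))"

lemma pure_Return: "pure (Return a) a 0"
  by (simp add: pure_def)

lemma pure_bind: "pure p a m \<Longrightarrow> pure (f a) b n \<Longrightarrow> pure (bind_prog p f) b (m + n)"
  by (simp add: pure_def run_bind_prog bind_return_pmf)

lemma pure_steps: "pure (steps n) () n"
proof -
  have "run g ((Step ^^ n) (Return ())) = return_pmf ((), 0, n)" for g :: "'x \<Rightarrow> complex"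
    by (induction n) simp_all
  then show ?thesis unfolding pure_def steps_def by blast
qed

lemma pure_for_each:
  assumes "\<And>b s. pure (body b s) (h b s) c"
  shows "pure (for_each bs s body) (fold h bs s) (length bs * (c + 1))"
proof (induction bs arbitrary: s)
  case Nil
  then show ?case by (simp add: pure_def)
next
  case (Cons b bs)
  show ?case
    using pure_bind[OF assms Cons, of b s] by (simp add: pure_def)
qed

text \<open>A Hoare-style judgement about every possible outcome, including those in which some SFT
  was inaccurate: sparsity and cost have to survive there.\<close>

definition sure :: "('x \<Rightarrow> complex) \<Rightarrow> ('x, 'a) prog \<Rightarrow> ('a \<Rightarrow> nat \<Rightarrow> nat \<Rightarrow> bool) \<Rightarrow> bool" where
  "sure g p Q \<longleftrightarrow> (\<forall>(a, m, n) \<in> set_pmf (run g p). Q a m n)"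

lemma sure_pure: "pure p a n \<Longrightarrow> Q a 0 n \<Longrightarrow> sure g p Q"
  by (simp add: sure_def pure_def)

lemma sure_bind:
  assumes "sure g p Q" "\<And>a m n. Q a m n \<Longrightarrow> sure g (f a) (\<lambda>b m' n'. R b (m + m') (n + n'))"
  shows "sure g (bind_prog p f) R"
  using assms unfolding sure_def run_bind_prog by fastforce

text \<open>The invariant speaks of the cost since the start of the loop, so the induction over the
  remaining list carries the offsets \<open>m\<close> and \<open>n\<close>. The additional 1 is the
  \<open>Step\<close> that \<open>for_each\<close> charges per iteration.\<close>

lemma sure_for_each:
  assumes "Inv 0 s 0 0"
    and "\<And>i s m n. i < length bs \<Longrightarrow> Inv i s m n \<Longrightarrow>
      sure g (body (bs ! i) s) (\<lambda>s' m' n'. Inv (Suc i) s' (m + m') (n + n' + 1))"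
  shows "sure g (for_each bs s body) (Inv (length bs))"
proof -
  have "sure g (for_each (drop i bs) s body) (\<lambda>s' m' n'. Inv (length bs) s' (m + m') (n + n'))"
    if "i \<le> length bs" "Inv i s m n" for i s m n
    using that
  proof (induction "length bs - i" arbitrary: i s m n)
    case 0
    then show ?case by (simp add: sure_def)
  next
    case (Suc k)
    then have i: "i < length bs" by simp
    have "sure g (bind_prog (body (bs ! i) s) (\<lambda>s'. for_each (drop (Suc i) bs) s' body))
        (\<lambda>s' m' n'. Inv (length bs) s' (m + m') (n + (n' + 1)))"
    proof (rule sure_bind[OF assms(2)[OF i Suc.prems(2)]])
      fix s' m' n' assume "Inv (Suc i) s' (m + m') (n + n' + 1)"
      from Suc.hyps(1)[OF _ _ this] Suc.hyps(2) i
      show "sure g (for_each (drop (Suc i) bs) s' body)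
          (\<lambda>s'' m'' n''. Inv (length bs) s'' (m + (m' + m'')) (n + (n' + n'' + 1)))"
        by (simp add: algebra_simps)
    qed
    then show ?case
      using i by (auto simp: sure_def Cons_nth_drop_Suc[symmetric])
  qed
  from this[of 0 s 0 0] assms(1) show ?thesis by simp
qed

definition fail_prob :: "('x \<Rightarrow> complex) \<Rightarrow> ('x, 'a) prog \<Rightarrow> ('a \<Rightarrow> bool) \<Rightarrow> real" where
  "fail_prob g p Q = measure_pmf.prob (run g p) {(a, m, n). \<not> Q a}"

lemma fail_prob_nonneg: "0 \<le> fail_prob g p Q"
  by (simp add: fail_prob_def)

lemma fail_prob_mono: "(\<And>a. Q a \<Longrightarrow> Q' a) \<Longrightarrow> fail_prob g p Q' \<le> fail_prob g p Q"
  unfolding fail_prob_def by (rule measure_pmf.finite_measure_mono) auto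

lemma fail_prob_pure: "pure p a n \<Longrightarrow> Q a \<Longrightarrow> fail_prob g p Q = 0"
  by (simp add: fail_prob_def pure_def measure_return)

text \<open>A union bound: either the first part misses \<open>Q\<close>, or it meets
  \<open>Q\<close> and the second part fails. No independence is involved, as the second bound holds
  for every intermediate result with \<open>Q\<close>.\<close>

lemma fail_prob_bind:
  fixes p :: "('x, 'b) prog"
  assumes "fail_prob g p Q \<le> \<epsilon>" "\<And>a. Q a \<Longrightarrow> fail_prob g (f a) R \<le> \<epsilon>'" "0 \<le> \<epsilon>'"
  shows "fail_prob g (bind_prog p f) R \<le> \<epsilon> + \<epsilon>'"
proof -
  let ?X = "{(a, m, n). \<not> Q a} :: ('b \<times> nat \<times> nat) set"
  have "ennreal (fail_prob g (bind_prog p f) R) =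
      (\<integral>\<^sup>+ x. ennreal (fail_prob g (f (fst x)) R) \<partial>measure_pmf (run g p))"
    unfolding fail_prob_def run_bind_prog measure_pmf.emeasure_eq_measure[symmetric] emeasure_bind_pmf
    by (intro nn_integral_cong) (simp add: case_prod_unfold vimage_def)
  also have "\<dots> \<le> (\<integral>\<^sup>+ x. indicator ?X x + ennreal \<epsilon>' \<partial>measure_pmf (run g p))"
  proof (rule nn_integral_mono)
    fix x :: "'b \<times> nat \<times> nat"
    have "fail_prob g (f (fst x)) R \<le> 1" by (simp add: fail_prob_def)
    then show "ennreal (fail_prob g (f (fst x)) R) \<le> indicator ?X x + ennreal \<epsilon>'"
      using assms(2)[of "fst x"] assms(3)
      by (cases "Q (fst x)") (auto simp: indicator_def ennreal_leI intro: order_trans[OF ennreal_leI[of _ 1]])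
  qed
  also have "\<dots> = ennreal (fail_prob g p Q + \<epsilon>')"
    using assms(3) by (subst nn_integral_add)
      (auto simp: fail_prob_def measure_pmf.emeasure_eq_measure ennreal_plus)
  finally have "fail_prob g (bind_prog p f) R \<le> fail_prob g p Q + \<epsilon>'"
    using assms(3) fail_prob_nonneg[of g p Q] by (subst (asm) ennreal_le_iff) auto
  then show ?thesis using assms(1) by simp
qed

lemma fail_prob_for_each:
  assumes "Inv 0 s" "0 \<le> \<epsilon>"
    and "\<And>i s. i < length bs \<Longrightarrow> Inv i s \<Longrightarrow> fail_prob g (body (bs ! i) s) (Inv (Suc i)) \<le> \<epsilon>"
  shows "fail_prob g (for_each bs s body) (Inv (length bs)) \<le> real (length bs) * \<epsilon>"
proof -
  have "fail_prob g (for_each (drop i bs) s body) (Inv (length bs)) \<le> real (length bs - i) * \<epsilon>"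
    if "i \<le> length bs" "Inv i s" for i s
    using that
  proof (induction "length bs - i" arbitrary: i s)
    case 0
    then show ?case by (simp add: fail_prob_def measure_return)
  next
    case (Suc k)
    then have i: "i < length bs" by simp
    have "fail_prob g (for_each (drop i bs) s body) (Inv (length bs))
        = fail_prob g (bind_prog (body (bs ! i) s) (\<lambda>s'. for_each (drop (Suc i) bs) s' body))
            (Inv (length bs))"
      using i by (auto simp: fail_prob_def Cons_nth_drop_Suc[symmetric] vimage_def
          intro!: arg_cong[where f = "measure_pmf.prob _"])
    also have "\<dots> \<le> \<epsilon> + real k * \<epsilon>"
    proof (rule fail_prob_bind[OF assms(3)[OF i Suc.prems(2)]])
      fix s' assume "Inv (Suc i) s'"
      from Suc.hyps(1)[OF _ _ this] Suc.hyps(2) i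
      have "fail_prob g (for_each (drop (Suc i) bs) s' body) (Inv (length bs))
          \<le> real (length bs - Suc i) * \<epsilon>" by auto
      also have "length bs - Suc i = k" using Suc.hyps(2) by simp
      finally show "fail_prob g (for_each (drop (Suc i) bs) s' body) (Inv (length bs)) \<le> real k * \<epsilon>" .
    qed (use assms in simp)
    finally show ?case using Suc.hyps(2) by (simp add: algebra_simps flip: Suc.hyps(2))
  qed
  from this[of 0 s] assms show ?thesis by simp
qed

section \<open>Identification of a frequency and assembly of the output\<close>

lemma freqs_card: "card (freqs N) = N"
  by (simp add: freqs_def) linarith

lemma finite_freqs: "finite (freqs N)"
  by (simp add: freqs_def)

definition coord_step :: "int \<Rightarrow> nat \<Rightarrow> (int \<Rightarrow> int \<Rightarrow> complex) \<Rightarrow> complex \<Rightarrow> int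
    \<Rightarrow> int \<Rightarrow> (int \<times> real) option \<Rightarrow> (int \<times> real) option" where
  "coord_step zl L F y \<omega> h best =
    (let r = cmod (y - F (\<omega> - h * zl) h)
     in if \<omega> - h * zl \<in> freqs L \<and> (case best of None \<Rightarrow> True | Some (_, r0) \<Rightarrow> r < r0)
        then Some (h, r) else best)"

definition coord :: "nat \<Rightarrow> int \<Rightarrow> nat \<Rightarrow> (int \<Rightarrow> int \<Rightarrow> complex) \<Rightarrow> complex \<Rightarrow> int \<Rightarrow> int option" where
  "coord N zl L F y \<omega> =
    map_option fst (fold (coord_step zl L F y \<omega>) (sorted_list_of_set (freqs N)) None)"

lemma pure_find_coord: "pure (find_coord N zl L F y \<omega>) (coord N zl L F y \<omega>) (9 * N)"
proof -
  let ?body = "\<lambda>h best. steps 8 \<bind> (\<lambda>_. Return (coord_step zl L F y \<omega> h best))"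
  have "pure (?body h best) (coord_step zl L F y \<omega> h best) 8" for h best
    using pure_bind[OF pure_steps pure_Return] by simp
  from pure_bind[where f = "\<lambda>best. Return (map_option fst best)",
      OF pure_for_each[where body = ?body and h = "coord_step zl L F y \<omega>", OF this] pure_Return]
  have "pure (for_each (sorted_list_of_set (freqs N)) None ?body \<bind> (\<lambda>best. Return (map_option fst best)))
    (coord N zl L F y \<omega>) (length (sorted_list_of_set (freqs N)) * (8 + 1) + 0)"
    unfolding coord_def .
  then show ?thesis
    by (simp add: find_coord_def coord_step_def Let_def freqs_card mult.commute)
qed

text \<open>A candidate replaces the current one only if it is strictly better, so the loop holds a
  minimizer over the admissible entries seen so far, and \<open>None\<close> as long as there was
  none.\<close>

lemma fold_coord_step:
  "case fold (coord_step zl L F y \<omega>) hs None of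
     None \<Rightarrow> \<forall>h\<in>set hs. \<omega> - h * zl \<notin> freqs L
   | Some (h, r) \<Rightarrow> h \<in> set hs \<and> r = cmod (y - F (\<omega> - h * zl) h) \<and>
       (\<forall>h'\<in>set hs. \<omega> - h' * zl \<in> freqs L \<longrightarrow> r \<le> cmod (y - F (\<omega> - h' * zl) h'))"
proof (induction hs rule: rev_induct)
  case Nil
  then show ?case by simp
next
  case (snoc h hs)
  then show ?case
    by (auto simp: coord_step_def Let_def split: option.splits if_splits)
qed

lemma coord_SomeD:
  assumes "coord N zl L F y \<omega> = Some h"
  shows "h \<in> freqs N"
    and "h' \<in> freqs N \<Longrightarrow> \<omega> - h' * zl \<in> freqs L \<Longrightarrow>
      cmod (y - F (\<omega> - h * zl) h) \<le> cmod (y - F (\<omega> - h' * zl) h')"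
  using fold_coord_step[where zl=zl and L=L and F=F and y=y and \<omega>=\<omega> and hs="sorted_list_of_set (freqs N)"] assms finite_freqs[of N]
  by (auto simp: coord_def)

lemma coord_NoneD:
  assumes "coord N zl L F y \<omega> = None" "h \<in> freqs N"
  shows "\<omega> - h * zl \<notin> freqs L"
  using fold_coord_step[where zl=zl and L=L and F=F and y=y and \<omega>=\<omega> and hs="sorted_list_of_set (freqs N)"] assms finite_freqs[of N]
  by (auto simp: coord_def)

text \<open>The value \<open>undefined\<close> from \<open>d\<close> on makes the result
  extensional, as the members of \<open>freq_box\<close> are.\<close>

definition found_freq :: "nat \<Rightarrow> nat \<Rightarrow> (nat \<Rightarrow> int) \<Rightarrow> (nat \<Rightarrow> nat) \<Rightarrow> (nat \<Rightarrow> int \<Rightarrow> int \<Rightarrow> complex)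
    \<Rightarrow> complex \<Rightarrow> int \<Rightarrow> (nat \<Rightarrow> int) option" where
  "found_freq d N z Ls F y \<omega> =
    (if \<forall>l<d. coord N (z l) (Ls l) (F l) y \<omega> \<noteq> None
     then Some (\<lambda>l. if l < d then the (coord N (z l) (Ls l) (F l) y \<omega>) else undefined) else None)"

lemma pure_find_freq:
  "pure (find_freq d N z Ls F y \<omega>) (found_freq d N z Ls F y \<omega>) (d * (9 * N + 1))"
proof -
  let ?c = "\<lambda>l. coord N (z l) (Ls l) (F l) y \<omega>"
  let ?h = "\<lambda>l ko. case (ko, ?c l) of (Some k, Some h) \<Rightarrow> Some (k(l := h)) | _ \<Rightarrow> None"
  have "fold ?h [0..<d] (Some (\<lambda>_. undefined)) = found_freq d N z Ls F y \<omega>"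
  proof (induction d)
    case 0
    then show ?case by (simp add: found_freq_def)
  next
    case (Suc d)
    have "fold ?h [0..<Suc d] (Some (\<lambda>_. undefined)) = ?h d (found_freq d N z Ls F y \<omega>)"
      by (simp only: upt_Suc_append[OF le0] fold_append comp_apply Suc fold_simps)
    also have "\<dots> = found_freq (Suc d) N z Ls F y \<omega>"
      by (auto simp: found_freq_def less_Suc_eq fun_eq_iff split: option.splits)
    finally show ?case .
  qed
  moreover
  let ?body = "\<lambda>l ko. find_coord N (z l) (Ls l) (F l) y \<omega> \<bind> (\<lambda>ho.
      Return (case (ko, ho) of (Some k, Some h) \<Rightarrow> Some (k(l := h)) | _ \<Rightarrow> None))"
  have "pure (?body l ko) (?h l ko) (9 * N)" for l ko
    using pure_bind[where f = "\<lambda>ho. Return (case (ko, ho) of (Some k, Some h) \<Rightarrow> Some (k(l := h))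
        | _ \<Rightarrow> None)", OF pure_find_coord pure_Return] by simp
  from pure_for_each[where body = ?body and h = ?h, OF this]
  have "pure (for_each [0..<d] (Some (\<lambda>_. undefined)) ?body)
      (fold ?h [0..<d] (Some (\<lambda>_. undefined))) (length [0..<d] * (9 * N + 1))" .
  ultimately show ?thesis unfolding find_freq_def by simp
qed

lemma found_freq_SomeD:
  assumes "found_freq d N z Ls F y \<omega> = Some k"
  shows "k \<in> freq_box d N" and "l < d \<Longrightarrow> coord N (z l) (Ls l) (F l) y \<omega> = Some (k l)"
  using assms coord_SomeD(1)
  by (fastforce simp: found_freq_def freq_box_def PiE_def extensional_def split: if_splits)+

text \<open>Closed form of the final loop: an accepted \<open>k\<close> satisfies k . z = \<omega>,
  so only \<omega> = \<open>dot d k z\<close> can write to entry \<open>k\<close>, and it does so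
  once. The accumulated sum is a single value.\<close>

definition assemble :: "nat \<Rightarrow> nat \<Rightarrow> (nat \<Rightarrow> int) \<Rightarrow> (nat \<Rightarrow> nat) \<Rightarrow> (nat \<Rightarrow> int \<Rightarrow> int \<Rightarrow> complex)
    \<Rightarrow> (int \<Rightarrow> complex) \<Rightarrow> (nat \<Rightarrow> int) \<Rightarrow> complex" where
  "assemble d N z Ls F v k =
    (let \<omega> = dot d k z in if found_freq d N z Ls F (v \<omega>) \<omega> = Some k then v \<omega> else 0)"

lemma fold_assemble:
  fixes kf :: "int \<Rightarrow> 'k option" and v :: "int \<Rightarrow> complex"
  assumes "distinct ws"
  shows "fold (\<lambda>\<omega> b. case kf \<omega> of None \<Rightarrow> b
      | Some k \<Rightarrow> if D k = \<omega> then b(k := b k + v \<omega>) else b) ws (\<lambda>_. 0)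
    = (\<lambda>k. if D k \<in> set ws \<and> kf (D k) = Some k then v (D k) else 0)"
  using assms
proof (induction ws rule: rev_induct)
  case Nil
  then show ?case by simp
next
  case (snoc w ws)
  then show ?case
    by (auto simp: fun_eq_iff split: option.splits)
qed

lemma support_list:
  assumes "finite {\<omega>. v \<omega> \<noteq> 0}"
  shows "set (support_list v) = {\<omega>. v \<omega> \<noteq> 0}" "distinct (support_list v)"
    "length (support_list v) = card {\<omega>. v \<omega> \<noteq> 0}"
  using assms by (simp_all add: support_list_def)

lemma pure_assemble:
  assumes "finite {\<omega>. v \<omega> \<noteq> 0}"
  shows "pure (for_each (support_list v) (\<lambda>_. 0) (\<lambda>\<omega> b. do {
       ko \<leftarrow> find_freq d N z Ls F (v \<omega>) \<omega>;
       steps (3 * d + 2);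
       Return (case ko of None \<Rightarrow> b
               | Some k \<Rightarrow> if dot d k z = \<omega> then b(k := b k + v \<omega>) else b)
     })) (assemble d N z Ls F v) (card {\<omega>. v \<omega> \<noteq> 0} * (d * (9 * N + 1) + 3 * d + 3))"
    (is "pure (for_each _ _ ?body) _ _")
proof -
  let ?kf = "\<lambda>\<omega>. found_freq d N z Ls F (v \<omega>) \<omega>"
  let ?h = "\<lambda>\<omega> b. case ?kf \<omega> of None \<Rightarrow> b
    | Some k \<Rightarrow> if dot d k z = \<omega> then b(k := b k + v \<omega>) else b"
  have "pure (?body \<omega> b) (?h \<omega> b) (d * (9 * N + 1) + (3 * d + 2 + 0))" for \<omega> b
    by (rule pure_bind[OF pure_find_freq pure_bind[OF pure_steps pure_Return]])
  from pure_for_each[where body = ?body and h = ?h, OF this]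
  have "pure (for_each (support_list v) (\<lambda>_. 0) ?body) (fold ?h (support_list v) (\<lambda>_. 0))
      (length (support_list v) * (d * (9 * N + 1) + (3 * d + 2 + 0) + 1))" .
  moreover have "fold ?h (support_list v) (\<lambda>_. 0) = assemble d N z Ls F v"
    using support_list[OF assms] by (subst fold_assemble) (auto simp: assemble_def Let_def)
  ultimately show ?thesis
    using support_list[OF assms] by (simp only: add_0_right add.assoc) (simp add: algebra_simps)
qed

lemma assemble_nonzeroD:
  assumes "assemble d N z Ls F v k \<noteq> 0"
  shows "found_freq d N z Ls F (v (dot d k z)) (dot d k z) = Some k" "v (dot d k z) \<noteq> 0"
  using assms unfolding assemble_def Let_def by (metis (full_types))+

text \<open>Each \<omega> leads to at most one frequency. Hence the nonzero entries of the output
  inject into the support of \<open>v\<close> and inherit its sparsity.\<close>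

lemma inj_on_assemble: "inj_on (\<lambda>k. dot d k z) {k. assemble d N z Ls F v k \<noteq> 0}"
proof (rule inj_onI)
  fix k k'
  assume "k \<in> {k. assemble d N z Ls F v k \<noteq> 0}" "k' \<in> {k. assemble d N z Ls F v k \<noteq> 0}"
    and eq: "dot d k z = dot d k' z"
  then have "found_freq d N z Ls F (v (dot d k z)) (dot d k z) = Some k"
    "found_freq d N z Ls F (v (dot d k' z)) (dot d k' z) = Some k'"
    using assemble_nonzeroD(1) by blast+
  then show "k = k'" unfolding eq by simp
qed

lemma sparse_on_assemble:
  assumes "finite {\<omega>. v \<omega> \<noteq> 0}" "card {\<omega>. v \<omega> \<noteq> 0} \<le> m"
  shows "sparse_on (freq_box d N) m (assemble d N z Ls F v)"
proof -
  let ?B = "{k. assemble d N z Ls F v k \<noteq> 0}"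
  have sub: "(\<lambda>k. dot d k z) ` ?B \<subseteq> {\<omega>. v \<omega> \<noteq> 0}"
    using assemble_nonzeroD(2) by blast
  have "finite ?B" using finite_imageD[OF finite_subset[OF sub assms(1)] inj_on_assemble] .
  moreover have "card ?B \<le> m"
    using card_mono[OF assms(1) sub] card_image[OF inj_on_assemble] assms(2) by simp
  moreover have "?B \<subseteq> freq_box d N"
    using found_freq_SomeD(1) assemble_nonzeroD(1) by blast
  ultimately show ?thesis by (simp add: sparse_on_def)
qed

section \<open>Matrices of the slices and their transforms\<close>

definition store :: "nat \<Rightarrow> (int \<Rightarrow> complex) \<Rightarrow> int
    \<Rightarrow> (int \<Rightarrow> nat \<Rightarrow> complex) \<times> int list \<Rightarrow> (int \<Rightarrow> nat \<Rightarrow> complex) \<times> int list" where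
  "store j v = (\<lambda>\<omega> (V, cols).
     (V(\<omega> := (V \<omega>)(j := v \<omega>)), if \<omega> \<in> set cols then cols else \<omega> # cols))"

lemma fold_store:
  "fst (fold (store j v) ws st) = (\<lambda>\<omega>. if \<omega> \<in> set ws then (fst st \<omega>)(j := v \<omega>) else fst st \<omega>)"
  "set (snd (fold (store j v) ws st)) = set (snd st) \<union> set ws"
  "length (snd (fold (store j v) ws st)) \<le> length (snd st) + length ws"
proof (induction ws rule: rev_induct)
  case (snoc w ws)
  {
    case 1
    then show ?case using snoc(1) by (auto simp: store_def case_prod_unfold fun_eq_iff)
  next
    case 2
    then show ?case using snoc(2) by (auto simp: store_def case_prod_unfold)
  next
    case 3
    then show ?case using snoc(3) by (auto simp: store_def case_prod_unfold)
  }
qed simp_all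

lemma pure_store:
  "pure (for_each ws st (\<lambda>\<omega> (V, cols). do {
         steps 3;
         Return (V(\<omega> := (V \<omega>)(j := v \<omega>)), if \<omega> \<in> set cols then cols else \<omega> # cols)
       })) (fold (store j v) ws st) (length ws * 4)"
proof -
  let ?body = "\<lambda>\<omega> (V, cols). steps 3 \<bind> (\<lambda>_.
         Return (V(\<omega> := (V \<omega>)(j := v \<omega>)), if \<omega> \<in> set cols then cols else \<omega> # cols))"
  have "pure (?body \<omega> st) (store j v \<omega> st) 3" for \<omega> st
    using pure_bind[OF pure_steps pure_Return, of 3 "\<lambda>_. store j v \<omega> st"]
    by (cases st) (simp add: store_def)
  from pure_for_each[where body = ?body and h = "store j v", OF this]
  have "pure (for_each ws st ?body) (fold (store j v) ws st) (length ws * (3 + 1))" .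
  then show ?thesis by simp
qed

lemma pure_transform:
  "pure (for_each cols (\<lambda>_ _. 0) (\<lambda>\<omega> F. do {
       steps c;
       Return (F(\<omega> := dft N (V \<omega>)))
     })) (\<lambda>\<omega>. if \<omega> \<in> set cols then dft N (V \<omega>) else (\<lambda>_. 0)) (length cols * (c + 1))"
proof -
  let ?body = "\<lambda>\<omega> F. steps c \<bind> (\<lambda>_. Return (F(\<omega> := dft N (V \<omega>))))"
  let ?h = "\<lambda>\<omega> F. F(\<omega> := dft N (V \<omega>))"
  have "pure (?body \<omega> F) (?h \<omega> F) c" for \<omega> F
    using pure_bind[OF pure_steps pure_Return] by simp
  from pure_for_each[where body = ?body and h = ?h, OF this]
  have "pure (for_each cols (\<lambda>_ _. 0) ?body) (fold ?h cols (\<lambda>_ _. 0)) (length cols * (c + 1))" .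
  moreover have "fold ?h cols (\<lambda>_ _. 0) = (\<lambda>\<omega>. if \<omega> \<in> set cols then dft N (V \<omega>) else (\<lambda>_. 0))"
    by (induction cols rule: rev_induct) (auto simp: fun_eq_iff)
  ultimately show ?thesis by simp
qed

lemma dft_zero: "dft N (\<lambda>_. 0) = (\<lambda>_. 0)"
  by (simp add: dft_def fun_eq_iff)

lemma dft_cong: "(\<And>j. j < N \<Longrightarrow> y j = y' j) \<Longrightarrow> dft N y = dft N y'"
  by (simp add: dft_def fun_eq_iff)

lemma sure_map_prog: "sure g (map_prog h id p) Q \<longleftrightarrow> sure (\<lambda>x. g (h x)) p Q"
  by (simp add: sure_def run_map_prog)

lemma fail_prob_map_prog: "fail_prob g (map_prog h id p) Q = fail_prob (\<lambda>x. g (h x)) p Q"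
  by (simp add: fail_prob_def run_map_prog)

section \<open>Bounds for the stages and for the whole algorithm\<close>

definition sft_cost :: "bool \<Rightarrow> nat \<Rightarrow> nat \<Rightarrow> real \<Rightarrow> (int \<Rightarrow> complex) \<Rightarrow> nat \<Rightarrow> nat \<Rightarrow> bool" where
  "sft_cost metered L s T v m n \<longleftrightarrow> sparse_on (freqs L) (2 * s) v
     \<and> (metered \<longrightarrow> real m \<le> T \<and> real n \<le> T)"

text \<open>Each of the \<open>N\<close> SFTs costs at most \<open>T\<close>, plus 4 operations for
  each of at most 2s stored entries and 1 for the loop. Together they touch at most 2sN columns;
  this number of DFTs is the source of the term with N log N in the complexity.\<close>

lemma sure_slice_dft:
  assumes "\<And>j. j < N \<Longrightarrow>
    sure (\<lambda>t. g (Slice l j, slice_point d N z l j t)) (A L) (sft_cost metered L s T)"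
  shows "sure g (slice_dft A d N z L l) (\<lambda>_ m n. metered \<longrightarrow> real m \<le> real N * T \<and>
    real n \<le> real N * (T + 8 * real s + 1) + 2 * real s * real N * (3 * real (dft_length N) + real N + 1))"
proof -
  define Inv :: "nat \<Rightarrow> (int \<Rightarrow> nat \<Rightarrow> complex) \<times> int list \<Rightarrow> nat \<Rightarrow> nat \<Rightarrow> bool" where
    "Inv = (\<lambda>i (V, cols) m n. length cols \<le> 2 * s * i \<and>
      (metered \<longrightarrow> real m \<le> real i * T \<and> real n \<le> real i * (T + 8 * real s + 1)))"
  have "Inv 0 (\<lambda>_ _. 0, []) 0 0" by (simp add: Inv_def)
  note loop = sure_for_each[where Inv = Inv, OF this]
  show ?thesis
    unfolding slice_dft_def
  proof (rule sure_bind[OF loop])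
    fix i st m n
    assume i: "i < length [0..<N]" and inv: "Inv i st m n"
    then have j: "[0..<N] ! i < N" by simp
    show "sure g (map_prog (\<lambda>t. (Slice l ([0..<N] ! i), slice_point d N z l ([0..<N] ! i) t)) id (A L) \<bind>
        (\<lambda>v. for_each (support_list v) st (\<lambda>\<omega> (V, cols). do {
           steps 3;
           Return (V(\<omega> := (V \<omega>)([0..<N] ! i := v \<omega>)), if \<omega> \<in> set cols then cols else \<omega> # cols)
         }))) (\<lambda>s' m' n'. Inv (Suc i) s' (m + m') (n + n' + 1))"
    proof (rule sure_bind[where Q = "sft_cost metered L s T"], unfold sure_map_prog, rule assms[OF j],
        rule sure_pure[OF pure_store])
      fix v m' n'
      assume "sft_cost metered L s T v m' n'"
      then have v: "finite {\<omega>. v \<omega> \<noteq> 0}" "card {\<omega>. v \<omega> \<noteq> 0} \<le> 2 * s"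
        and cost: "metered \<longrightarrow> real m' \<le> T \<and> real n' \<le> T"
        by (auto simp: sft_cost_def sparse_on_def)
      have len: "length (support_list v) \<le> 2 * s" using support_list(3) v by metis
      show "Inv (Suc i) (fold (store ([0..<N] ! i) v) (support_list v) st) (m + (m' + 0))
          (n + (n' + length (support_list v) * 4) + 1)"
        using inv cost len fold_store(3)[of "[0..<N] ! i" v "support_list v" st]
        by (auto simp: Inv_def case_prod_unfold algebra_simps)
    qed
  next
    fix st m n
    assume "Inv (length [0..<N]) st m n"
    then have len: "length (snd st) \<le> 2 * s * N" and
      cost: "metered \<longrightarrow> real m \<le> real N * T \<and> real n \<le> real N * (T + 8 * real s + 1)"
      by (auto simp: Inv_def case_prod_unfold)
    have "real (length (snd st) * (3 * dft_length N + N + 1))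
        \<le> real (2 * s * N * (3 * dft_length N + N + 1))"
      using len by (intro of_nat_mono mult_right_mono) auto
    then show "sure g (case st of (V, cols) \<Rightarrow> for_each cols (\<lambda>_ _. 0) (\<lambda>\<omega> F. do {
         steps (3 * dft_length N + N);
         Return (F(\<omega> := dft N (V \<omega>)))
       })) (\<lambda>_ m' n'. metered \<longrightarrow> real (m + m') \<le> real N * T \<and> real (n + n')
         \<le> real N * (T + 8 * real s + 1) + 2 * real s * real N * (3 * real (dft_length N) + real N + 1))"
      unfolding case_prod_unfold
      by (intro sure_pure[OF pure_transform]) (use cost in \<open>auto simp: algebra_simps\<close>)
  qed
qed

text \<open>On success the sparse bookkeeping is invisible: the result is the DFT of the full matrix
  with the good vectors as rows. For this the invariant records that columns missing from the list
  are zero.\<close>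

lemma fail_prob_slice_dft:
  assumes "\<And>j. j < N \<Longrightarrow>
    fail_prob (\<lambda>t. g (Slice l j, slice_point d N z l j t)) (A L) (good j) \<le> \<epsilon>"
    and fin: "\<And>j v. good j v \<Longrightarrow> finite {\<omega>. v \<omega> \<noteq> 0}" and "0 \<le> \<epsilon>"
  shows "fail_prob g (slice_dft A d N z L l)
    (\<lambda>F. \<exists>vs. (\<forall>j<N. good j (vs j)) \<and> F = (\<lambda>\<omega>. dft N (\<lambda>j. vs j \<omega>))) \<le> real N * \<epsilon>"
proof -
  define Inv :: "nat \<Rightarrow> (int \<Rightarrow> nat \<Rightarrow> complex) \<times> int list \<Rightarrow> bool" where
    "Inv = (\<lambda>i st. \<exists>vs. (\<forall>j<i. good j (vs j))
      \<and> (\<forall>\<omega>. fst st \<omega> = (\<lambda>j. if j < i then vs j \<omega> else 0))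
      \<and> (\<forall>\<omega>. \<omega> \<notin> set (snd st) \<longrightarrow> fst st \<omega> = (\<lambda>_. 0)))"
  have inv0: "Inv 0 (\<lambda>_ _. 0, [])" by (simp add: Inv_def)
  note loop = fail_prob_for_each[where Inv = Inv, OF inv0 assms(3)]
  have "fail_prob g (slice_dft A d N z L l)
    (\<lambda>F. \<exists>vs. (\<forall>j<N. good j (vs j)) \<and> F = (\<lambda>\<omega>. dft N (\<lambda>j. vs j \<omega>))) \<le> real (length [0..<N]) * \<epsilon> + 0"
    unfolding slice_dft_def
  proof (rule fail_prob_bind[OF loop])
    fix i st
    assume i: "i < length [0..<N]" and inv: "Inv i st"
    then have j: "[0..<N] ! i = i" "i < N" by simp_all
    have "fail_prob g (map_prog (\<lambda>t. (Slice l i, slice_point d N z l i t)) id (A L) \<bind>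
        (\<lambda>v. for_each (support_list v) st (\<lambda>\<omega> (V, cols). do {
           steps 3;
           Return (V(\<omega> := (V \<omega>)(i := v \<omega>)), if \<omega> \<in> set cols then cols else \<omega> # cols)
         }))) (Inv (Suc i)) \<le> \<epsilon> + 0"
    proof (rule fail_prob_bind[where Q = "good i"], unfold fail_prob_map_prog, rule assms(1)[OF j(2)])
      fix v
      assume v: "good i v"
      obtain vs where vs: "\<And>j. j < i \<Longrightarrow> good j (vs j)"
        "\<And>\<omega>. fst st \<omega> = (\<lambda>j. if j < i then vs j \<omega> else 0)"
        "\<And>\<omega>. \<omega> \<notin> set (snd st) \<Longrightarrow> fst st \<omega> = (\<lambda>_. 0)"
        using inv unfolding Inv_def by blast
      have supp: "set (support_list v) = {\<omega>. v \<omega> \<noteq> 0}"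
        using support_list(1)[OF fin[OF v]] .
      have "Inv (Suc i) (fold (store i v) (support_list v) st)"
        unfolding Inv_def fold_store supp
      proof (intro exI[of _ "vs(i := v)"] conjI allI impI)
        fix j assume "j < Suc i"
        then show "good j ((vs(i := v)) j)" using v vs(1) by (auto simp: less_Suc_eq)
      next
        fix \<omega>
        show "(if \<omega> \<in> {\<omega>. v \<omega> \<noteq> 0} then (fst st \<omega>)(i := v \<omega>) else fst st \<omega>)
            = (\<lambda>j. if j < Suc i then (vs(i := v)) j \<omega> else 0)"
          by (auto simp: vs(2) fun_eq_iff less_Suc_eq)
      next
        fix \<omega> assume "\<omega> \<notin> set (snd st) \<union> {\<omega>. v \<omega> \<noteq> 0}"
        then show "(if \<omega> \<in> {\<omega>. v \<omega> \<noteq> 0} then (fst st \<omega>)(i := v \<omega>) else fst st \<omega>) = (\<lambda>_. 0)"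
          using vs(3) by simp
      qed
      from fail_prob_pure[where Q = "Inv (Suc i)", OF pure_store this]
      show "fail_prob g (for_each (support_list v) st (\<lambda>\<omega> (V, cols). do {
           steps 3;
           Return (V(\<omega> := (V \<omega>)(i := v \<omega>)), if \<omega> \<in> set cols then cols else \<omega> # cols)
         })) (Inv (Suc i)) \<le> 0" by (rule order_eq_refl)
    qed simp
    then show "fail_prob g (map_prog (\<lambda>t. (Slice l ([0..<N] ! i), slice_point d N z l ([0..<N] ! i) t)) id (A L) \<bind>
        (\<lambda>v. for_each (support_list v) st (\<lambda>\<omega> (V, cols). do {
           steps 3;
           Return (V(\<omega> := (V \<omega>)([0..<N] ! i := v \<omega>)), if \<omega> \<in> set cols then cols else \<omega> # cols)
         }))) (Inv (Suc i)) \<le> \<epsilon>" unfolding j by simp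
  next
    fix st
    assume "Inv (length [0..<N]) st"
    then obtain vs where vs: "\<And>j. j < N \<Longrightarrow> good j (vs j)"
        "\<And>\<omega>. fst st \<omega> = (\<lambda>j. if j < N then vs j \<omega> else 0)"
        "\<And>\<omega>. \<omega> \<notin> set (snd st) \<Longrightarrow> fst st \<omega> = (\<lambda>_. 0)"
      unfolding Inv_def length_upt diff_zero by blast
    have "(if \<omega> \<in> set (snd st) then dft N (fst st \<omega>) else (\<lambda>_. 0)) = dft N (\<lambda>j. vs j \<omega>)" for \<omega>
    proof -
      \<comment> \<open>An unlisted column is zero, and so is its DFT; leaving it out changes
        nothing.\<close>
      have "(if \<omega> \<in> set (snd st) then dft N (fst st \<omega>) else (\<lambda>_. 0)) = dft N (fst st \<omega>)"
        using vs(3) by (simp add: dft_zero)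
      also have "\<dots> = dft N (\<lambda>j. vs j \<omega>)"
        unfolding vs(2) by (rule dft_cong) simp
      finally show ?thesis .
    qed
    then have "\<exists>vs. (\<forall>j<N. good j (vs j))
      \<and> (\<lambda>\<omega>. if \<omega> \<in> set (snd st) then dft N (fst st \<omega>) else (\<lambda>_. 0)) = (\<lambda>\<omega>. dft N (\<lambda>j. vs j \<omega>))"
      using vs(1) by blast
    from fail_prob_pure[where Q = "\<lambda>F. \<exists>vs. (\<forall>j<N. good j (vs j)) \<and> F = (\<lambda>\<omega>. dft N (\<lambda>j. vs j \<omega>))",
        OF pure_transform this]
    show "fail_prob g (case st of (V, cols) \<Rightarrow> for_each cols (\<lambda>_ _. 0) (\<lambda>\<omega> F. do {
         steps (3 * dft_length N + N);
         Return (F(\<omega> := dft N (V \<omega>)))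
       })) (\<lambda>F. \<exists>vs. (\<forall>j<N. good j (vs j)) \<and> F = (\<lambda>\<omega>. dft N (\<lambda>j. vs j \<omega>))) \<le> 0"
      unfolding case_prod_unfold by (rule order_eq_refl)
  qed simp
  then show ?thesis by simp
qed

text \<open>The final loop runs at most 2s times and tries \<open>N\<close> candidates per
  coordinate at 9 operations each.\<close>

lemma sure_two_dim_dft:
  assumes line: "sure (\<lambda>t. g (Line, line_point d z t)) (A L) (sft_cost metered L s T)"
    and slice: "\<And>l j. l < d \<Longrightarrow> j < N \<Longrightarrow>
      sure (\<lambda>t. g (Slice l j, slice_point d N z l j t)) (A (Ls l)) (sft_cost metered (Ls l) s T)"
  shows "sure g (two_dim_dft A d N z L Ls) (\<lambda>b m n. sparse_on (freq_box d N) (2 * s) b \<and>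
    (metered \<longrightarrow> real m \<le> T + real d * real N * T \<and>
     real n \<le> T + real d * (real N * (T + 8 * real s + 1)
         + 2 * real s * real N * (3 * real (dft_length N) + real N + 1) + 1)
       + 2 * real s * (real d * (9 * real N + 1) + 3 * real d + 3)))"
proof -
  define C where "C = real N * (T + 8 * real s + 1)
    + 2 * real s * real N * (3 * real (dft_length N) + real N + 1)"
  define Inv :: "nat \<Rightarrow> (nat \<Rightarrow> int \<Rightarrow> int \<Rightarrow> complex) \<Rightarrow> nat \<Rightarrow> nat \<Rightarrow> bool" where
    "Inv = (\<lambda>i _ m n. metered \<longrightarrow> real m \<le> real i * (real N * T) \<and> real n \<le> real i * (C + 1))"
  have "Inv 0 (\<lambda>_ _ _. 0) 0 0" by (simp add: Inv_def)
  note loop = sure_for_each[where Inv = Inv, OF this]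
  show ?thesis
    unfolding two_dim_dft_def C_def[symmetric]
  proof (rule sure_bind[where Q = "sft_cost metered L s T"], unfold sure_map_prog, rule line,
      rule sure_bind[OF loop])
    fix i F m n
    assume i: "i < length [0..<d]" and inv: "Inv i F m n"
    then have l: "[0..<d] ! i < d" by simp
    show "sure g (slice_dft A d N z (Ls ([0..<d] ! i)) ([0..<d] ! i) \<bind> (\<lambda>G. Return (F([0..<d] ! i := G))))
      (\<lambda>s' m' n'. Inv (Suc i) s' (m + m') (n + n' + 1))"
      by (rule sure_bind[OF sure_slice_dft], rule slice[OF l], assumption,
          rule sure_pure[OF pure_Return])
        (use inv in \<open>auto simp: Inv_def C_def algebra_simps\<close>)
  next
    fix v m n F m' n'
    assume "sft_cost metered L s T v m n" and inv: "Inv (length [0..<d]) F m' n'"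
    then have v: "finite {\<omega>. v \<omega> \<noteq> 0}" "card {\<omega>. v \<omega> \<noteq> 0} \<le> 2 * s"
      and cost: "metered \<longrightarrow> real m \<le> T \<and> real n \<le> T"
      by (auto simp: sft_cost_def sparse_on_def)
    have "real (card {\<omega>. v \<omega> \<noteq> 0} * (d * (9 * N + 1) + 3 * d + 3))
        \<le> real (2 * s * (d * (9 * N + 1) + 3 * d + 3))"
      using v by (intro of_nat_mono mult_right_mono) auto
    then show "sure g (for_each (support_list v) (\<lambda>_. 0) (\<lambda>\<omega> b. do {
         ko \<leftarrow> find_freq d N z Ls F (v \<omega>) \<omega>;
         steps (3 * d + 2);
         Return (case ko of None \<Rightarrow> b
                 | Some k \<Rightarrow> if dot d k z = \<omega> then b(k := b k + v \<omega>) else b)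
       })) (\<lambda>b m'' n''. sparse_on (freq_box d N) (2 * s) b \<and>
         (metered \<longrightarrow> real (m + (m' + m'')) \<le> T + real d * real N * T \<and>
         real (n + (n' + n'')) \<le> T + real d * (C + 1)
         + 2 * real s * (real d * (9 * real N + 1) + 3 * real d + 3)))"
      by (intro sure_pure[OF pure_assemble[OF v(1)]] conjI sparse_on_assemble[OF v])
        (use cost inv in \<open>auto simp: Inv_def algebra_simps\<close>)
  qed
qed

text \<open>Success is phrased as the existence of good intermediate vectors, so that the accuracy
  analysis is free of programs and probabilities.\<close>

lemma fail_prob_two_dim_dft:
  assumes line: "fail_prob (\<lambda>t. g (Line, line_point d z t)) (A L) good \<le> \<epsilon>"
    and slice: "\<And>l j. l < d \<Longrightarrow> j < N \<Longrightarrow>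
      fail_prob (\<lambda>t. g (Slice l j, slice_point d N z l j t)) (A (Ls l)) (good_slice l j) \<le> \<epsilon>"
    and fin: "\<And>v. good v \<Longrightarrow> finite {\<omega>. v \<omega> \<noteq> 0}"
      "\<And>l j v. good_slice l j v \<Longrightarrow> finite {\<omega>. v \<omega> \<noteq> 0}"
    and "0 \<le> \<epsilon>"
  shows "fail_prob g (two_dim_dft A d N z L Ls) (\<lambda>b. \<exists>v F vs. good v
      \<and> (\<forall>l<d. (\<forall>j<N. good_slice l j (vs l j)) \<and> F l = (\<lambda>\<omega>. dft N (\<lambda>j. vs l j \<omega>)))
      \<and> b = assemble d N z Ls F v) \<le> (1 + real d * real N) * \<epsilon>"
    (is "fail_prob g _ ?R \<le> _")
proof -
  define S where "S = (\<lambda>l G. \<exists>vs. (\<forall>j<N. good_slice l j (vs j)) \<and> G = (\<lambda>\<omega>. dft N (\<lambda>j. vs j \<omega>)))"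
  define Inv :: "nat \<Rightarrow> (nat \<Rightarrow> int \<Rightarrow> int \<Rightarrow> complex) \<Rightarrow> bool" where
    "Inv = (\<lambda>i F. \<forall>l<i. S l (F l))"
  have inv0: "Inv 0 (\<lambda>_ _ _. 0)" by (simp add: Inv_def)
  have N\<epsilon>: "0 \<le> real N * \<epsilon>" using assms by simp
  note loop = fail_prob_for_each[where Inv = Inv, OF inv0 N\<epsilon>]
  have "fail_prob g (two_dim_dft A d N z L Ls) ?R \<le> \<epsilon> + (real (length [0..<d]) * (real N * \<epsilon>) + 0)"
    unfolding two_dim_dft_def
  proof (rule fail_prob_bind[where Q = good], unfold fail_prob_map_prog, rule line,
      rule fail_prob_bind[OF loop])
    fix i F
    assume "i < length [0..<d]" and inv: "Inv i F"
    then have i: "[0..<d] ! i = i" "i < d" by simp_all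
    have "fail_prob g (slice_dft A d N z (Ls i) i \<bind> (\<lambda>G. Return (F(i := G)))) (Inv (Suc i))
        \<le> real N * \<epsilon> + 0"
    proof (rule fail_prob_bind)
      show "fail_prob g (slice_dft A d N z (Ls i) i) (S i) \<le> real N * \<epsilon>"
        unfolding S_def
        by (rule fail_prob_slice_dft, rule slice[OF i(2)], assumption, rule fin(2), assumption,
            rule assms(5))
    next
      fix G assume "S i G"
      then have "Inv (Suc i) (F(i := G))" using inv by (simp add: Inv_def less_Suc_eq)
      from fail_prob_pure[where Q = "Inv (Suc i)", OF pure_Return this]
      show "fail_prob g (Return (F(i := G))) (Inv (Suc i)) \<le> 0" by (rule order_eq_refl)
    qed simp
    then show "fail_prob g (slice_dft A d N z (Ls ([0..<d] ! i)) ([0..<d] ! i) \<bind>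
        (\<lambda>G. Return (F([0..<d] ! i := G)))) (Inv (Suc i)) \<le> real N * \<epsilon>"
      unfolding i by simp
  next
    fix v F
    assume v: "good v" and "Inv (length [0..<d]) F"
    then have "\<forall>l. \<exists>vs. l < d \<longrightarrow> (\<forall>j<N. good_slice l j (vs j)) \<and> F l = (\<lambda>\<omega>. dft N (\<lambda>j. vs j \<omega>))"
      by (auto simp: Inv_def S_def)
    from choice[OF this] have "?R (assemble d N z Ls F v)" using v by blast
    from fail_prob_pure[where Q = ?R, OF pure_assemble[OF fin(1)[OF v]] this]
    show "fail_prob g (for_each (support_list v) (\<lambda>_. 0) (\<lambda>\<omega> b. do {
         ko \<leftarrow> find_freq d N z Ls F (v \<omega>) \<omega>;
         steps (3 * d + 2);
         Return (case ko of None \<Rightarrow> b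
                 | Some k \<Rightarrow> if dot d k z = \<omega> then b(k := b k + v \<omega>) else b)
       })) ?R \<le> 0" by (rule order_eq_refl)
  qed (use N\<epsilon> in auto)
  then show ?thesis by (simp add: algebra_simps)
qed

section \<open>Best sparse approximations\<close>

text \<open>Greedy choice: a largest remaining entry is added until \<open>J\<close> is exhausted.
  This makes the \<open>SOME\<close> in \<open>best_approx\<close> meaningful.\<close>

lemma best_set_exists:
  fixes x :: "'i \<Rightarrow> complex"
  assumes "finite J"
  shows "\<exists>S\<subseteq>J. card S = min s (card J) \<and> (\<forall>i\<in>S. \<forall>j\<in>J - S. cmod (x j) \<le> cmod (x i))"
proof (induction s)
  case 0
  show ?case by (intro exI[of _ "{}"]) auto
next
  case (Suc s)
  then obtain S where S: "S \<subseteq> J" "card S = min s (card J)" "\<And>i j. i \<in> S \<Longrightarrow> j \<in> J - S \<Longrightarrow> cmod (x j) \<le> cmod (x i)"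
    by blast
  have finS: "finite S" using S(1) assms finite_subset by blast
  show ?case
  proof (cases "S = J")
    case True
    then show ?thesis using S by (intro exI[of _ S]) auto
  next
    case False
    then have ne: "J - S \<noteq> {}" using S(1) by blast
    have fin: "finite ((\<lambda>j. cmod (x j)) ` (J - S))" using assms by simp
    from ne have "Max ((\<lambda>j. cmod (x j)) ` (J - S)) \<in> (\<lambda>j. cmod (x j)) ` (J - S)"
      by (intro Max_in fin) blast
    then obtain m where m0: "m \<in> J - S" "Max ((\<lambda>j. cmod (x j)) ` (J - S)) = cmod (x m)"
      by (elim imageE)
    then have m: "m \<in> J - S" "\<And>j. j \<in> J - S \<Longrightarrow> cmod (x j) \<le> cmod (x m)"
      using Max_ge[OF fin] by simp_all
    have "card S < card J" using False S(1) assms by (meson psubset_card_mono psubsetI)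
    then have "card (insert m S) = min (Suc s) (card J)"
      using S(2) m(1) finS by simp
    moreover have "\<forall>i\<in>insert m S. \<forall>j\<in>J - insert m S. cmod (x j) \<le> cmod (x i)"
      using S(3) m by auto
    ultimately show ?thesis using S(1) m(1) by (intro exI[of _ "insert m S"]) auto
  qed
qed

lemma best_approx_obtain:
  fixes x :: "'i \<Rightarrow> complex"
  assumes "finite J"
  obtains S where "S \<subseteq> J" "card S = min s (card J)"
    "\<And>i j. i \<in> S \<Longrightarrow> j \<in> J - S \<Longrightarrow> cmod (x j) \<le> cmod (x i)"
    "best_approx s J x = restr S x"
  using someI_ex[OF best_set_exists[OF assms, where s = s and x = x]]
  unfolding best_approx_def by blast

text \<open>Exchange argument: the part of \<open>R\<close> that lies in \<open>J\<close> but not in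
  \<open>S\<close> injects into \<open>S - R\<close>, where the entries are at least as
  large.\<close>

lemma sum_tail_le:
  fixes x :: "'i \<Rightarrow> complex"
  assumes "finite J" "S \<subseteq> J" "card S = min s (card J)"
    and S: "\<And>i j. i \<in> S \<Longrightarrow> j \<in> J - S \<Longrightarrow> cmod (x j) \<le> cmod (x i)"
    and "finite R" "card R \<le> s"
  shows "(\<Sum>j\<in>J - S. cmod (x j)) \<le> (\<Sum>j\<in>J - R. cmod (x j))"
proof (cases "S = J")
  case True
  then show ?thesis by (simp add: sum_nonneg)
next
  case False
  have finS: "finite S" using assms finite_subset by blast
  \<comment> \<open>As \<open>S\<close> is a proper subset, the minimum in \<open>card S\<close> is
    \<open>s\<close>, which bounds \<open>card R\<close>.\<close>
  have "card S < card J" using False assms by (meson psubset_card_mono psubsetI)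
  then have "card R \<le> card S" using assms by simp
  then have "card (R - S) \<le> card (S - R)"
    using finS assms(5) by (simp add: card_Diff_subset_Int Int_commute diff_le_mono)
  moreover have "card ((R - S) \<inter> J) \<le> card (R - S)" using assms(5) by (intro card_mono) auto
  ultimately have "card ((R - S) \<inter> J) \<le> card (S - R)" by simp
  then obtain h where h: "h ` ((R - S) \<inter> J) \<subseteq> S - R" "inj_on h ((R - S) \<inter> J)"
    using card_le_inj[of "(R - S) \<inter> J" "S - R"] finS assms(5) by auto
  have "(\<Sum>j\<in>(R - S) \<inter> J. cmod (x j)) \<le> (\<Sum>j\<in>(R - S) \<inter> J. cmod (x (h j)))"
    using h(1) by (intro sum_mono S) auto
  also have "\<dots> = (\<Sum>j\<in>h ` ((R - S) \<inter> J). cmod (x j))"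
    using h(2) by (simp add: sum.reindex)
  also have "\<dots> \<le> (\<Sum>j\<in>S - R. cmod (x j))"
    using h(1) finS by (intro sum_mono2) auto
  finally have le: "(\<Sum>j\<in>(R - S) \<inter> J. cmod (x j)) \<le> (\<Sum>j\<in>S - R. cmod (x j))" .
  have "(\<Sum>j\<in>J - S. cmod (x j)) = (\<Sum>j\<in>J - (S \<union> R). cmod (x j)) + (\<Sum>j\<in>(R - S) \<inter> J. cmod (x j))"
    using assms by (subst sum.union_disjoint[symmetric]) (auto intro!: sum.cong)
  also have "\<dots> \<le> (\<Sum>j\<in>J - (S \<union> R). cmod (x j)) + (\<Sum>j\<in>S - R. cmod (x j))" using le by simp
  also have "\<dots> = (\<Sum>j\<in>J - R. cmod (x j))"
    using assms finS by (subst sum.union_disjoint[symmetric]) (auto intro!: sum.cong)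
  finally show ?thesis .
qed

lemma infsum_finite_support:
  assumes "finite J" "J \<subseteq> K" "\<And>k. k \<in> K \<Longrightarrow> k \<notin> J \<Longrightarrow> y k = (0::real)"
  shows "(\<Sum>\<^sub>\<infinity>k\<in>K. y k) = (\<Sum>k\<in>J. y k)"
proof -
  have "(\<Sum>\<^sub>\<infinity>k\<in>K. y k) = (\<Sum>\<^sub>\<infinity>k\<in>J. y k)"
    using assms by (intro infsum_cong_neutral) auto
  then show ?thesis using assms(1) by simp
qed

lemma l1_norm_best_approx:
  assumes "finite J" "J \<subseteq> K" "S \<subseteq> J" "best_approx s J x = restr S x" "\<And>k. k \<notin> J \<Longrightarrow> x k = 0"
  shows "l1_norm K (\<lambda>k. x k - best_approx s J x k) = (\<Sum>k\<in>J - S. cmod (x k))"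
  unfolding l1_norm_def
  by (subst infsum_finite_support[of "J - S"]) (use assms in \<open>auto simp: restr_def intro!: sum.cong\<close>)

lemma l1_norm_best_approx_le:
  assumes "finite J" "J \<subseteq> K" "finite R" "card R \<le> s" "\<And>k. k \<notin> J \<Longrightarrow> x k = 0"
  shows "l1_norm K (\<lambda>k. x k - best_approx s J x k) \<le> (\<Sum>k\<in>J - R. cmod (x k))"
proof -
  obtain S where S: "S \<subseteq> J" "card S = min s (card J)"
    "\<And>i j. i \<in> S \<Longrightarrow> j \<in> J - S \<Longrightarrow> cmod (x j) \<le> cmod (x i)" "best_approx s J x = restr S x"
    by (rule best_approx_obtain[OF assms(1), of s x]) (rule that)
  show ?thesis
    using l1_norm_best_approx[OF assms(1,2) S(1,4) assms(5)] sum_tail_le[OF assms(1) S(1,2,3) assms(3,4)]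
    by simp
qed

text \<open>Let \<tau> be the l1 tail after the \<open>s\<close> largest entries. An entry outside
  the 2s largest is at most \<tau> / s, because \<open>T - S\<close> holds at least \<open>s\<close>
  entries that are no smaller and belong to that tail. The sum of squares is then at most (\<tau> /
  s) \<tau>.\<close>

lemma l2_norm_best_approx_le:
  assumes "finite J" "J \<subseteq> K" "1 \<le> s" "\<And>k. k \<notin> J \<Longrightarrow> x k = 0"
  shows "l2_norm K (\<lambda>k. x k - best_approx (2 * s) J x k) \<le>
    l1_norm K (\<lambda>k. x k - best_approx s J x k) / sqrt s"
proof -
  obtain S where S: "S \<subseteq> J" "card S = min s (card J)"
    "\<And>i j. i \<in> S \<Longrightarrow> j \<in> J - S \<Longrightarrow> cmod (x j) \<le> cmod (x i)" "best_approx s J x = restr S x"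
    by (rule best_approx_obtain[OF assms(1), of s x]) (rule that)
  obtain T where T: "T \<subseteq> J" "card T = min (2 * s) (card J)"
    "\<And>i j. i \<in> T \<Longrightarrow> j \<in> J - T \<Longrightarrow> cmod (x j) \<le> cmod (x i)" "best_approx (2 * s) J x = restr T x"
    by (rule best_approx_obtain[OF assms(1), of "2 * s" x]) (rule that)
  have fin: "finite S" "finite T" using S T assms finite_subset by blast+
  define \<tau> where "\<tau> = (\<Sum>k\<in>J - S. cmod (x k))"
  have \<tau>0: "0 \<le> \<tau>" by (simp add: \<tau>_def sum_nonneg)
  have \<tau>: "l1_norm K (\<lambda>k. x k - best_approx s J x k) = \<tau>"
    unfolding \<tau>_def by (rule l1_norm_best_approx[OF assms(1,2) S(1,4) assms(4)])
  have small: "real s * cmod (x j) \<le> \<tau>" if j: "j \<in> J - T" for j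
  proof -
    have "card T < card J" using j T(1) psubset_card_mono[OF assms(1), of T] by blast
    then have "card T = 2 * s" using T(2) by simp
    moreover have "card T - card S \<le> card (T - S)" using fin by (intro diff_card_le_card_Diff) auto
    ultimately have "s \<le> card (T - S)" using S(2) by simp
    then have "real s * cmod (x j) \<le> real (card (T - S)) * cmod (x j)" by (intro mult_right_mono) auto
    also have "\<dots> = (\<Sum>i\<in>T - S. cmod (x j))" by simp
    also have "\<dots> \<le> (\<Sum>i\<in>T - S. cmod (x i))" using T(3) j by (intro sum_mono) auto
    also have "\<dots> \<le> \<tau>" unfolding \<tau>_def using T(1) assms(1) by (intro sum_mono2) auto
    finally show ?thesis .
  qed
  have "(\<Sum>j\<in>J - T. (cmod (x j))\<^sup>2) \<le> (\<Sum>j\<in>J - T. \<tau> / real s * cmod (x j))"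
  proof (rule sum_mono)
    fix j assume j: "j \<in> J - T"
    have "cmod (x j) \<le> \<tau> / real s" using small[OF j] assms(3) by (simp add: field_simps)
    then show "(cmod (x j))\<^sup>2 \<le> \<tau> / real s * cmod (x j)"
      unfolding power2_eq_square by (rule mult_right_mono) simp
  qed
  also have "\<dots> = \<tau> / real s * (\<Sum>j\<in>J - T. cmod (x j))" by (simp add: sum_distrib_left)
  also have "\<dots> \<le> \<tau> / real s * \<tau>"
  proof (rule mult_left_mono)
    show "(\<Sum>j\<in>J - T. cmod (x j)) \<le> \<tau>"
      unfolding \<tau>_def using S(2) fin by (intro sum_tail_le[OF assms(1) T(1,2,3)]) auto
  qed (use \<tau>0 in simp)
  also have "\<dots> = (\<tau> / sqrt s)\<^sup>2"
    by (simp add: power2_eq_square)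
  finally have *: "(\<Sum>j\<in>J - T. (cmod (x j))\<^sup>2) \<le> (\<tau> / sqrt s)\<^sup>2" .
  have "l2_norm K (\<lambda>k. x k - best_approx (2 * s) J x k) = sqrt (\<Sum>j\<in>J - T. (cmod (x j))\<^sup>2)"
    unfolding l2_norm_def T(4)
    by (subst infsum_finite_support[of "J - T"])
      (use assms in \<open>auto simp: restr_def intro!: arg_cong[where f = sqrt] sum.cong\<close>)
  also have "\<dots> \<le> \<tau> / sqrt s"
    using * \<tau>0 by (intro real_le_lsqrt) (auto simp: sum_nonneg)
  finally show ?thesis unfolding \<tau> .
qed

section \<open>Square-summable sequences\<close>

lemma L2_set_le_l2_norm:
  assumes "finite F" "F \<subseteq> K" "(\<lambda>k. (cmod (x k))\<^sup>2) summable_on K"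
  shows "L2_set (\<lambda>k. cmod (x k)) F \<le> l2_norm K x"
  unfolding L2_set_def l2_norm_def
  using assms by (intro real_sqrt_le_mono finite_sum_le_infsum) auto

lemma l2_norm_le:
  assumes "\<And>F. finite F \<Longrightarrow> F \<subseteq> K \<Longrightarrow> L2_set (\<lambda>k. cmod (x k)) F \<le> B" "0 \<le> B"
  shows "l2_norm K x \<le> B"
proof -
  have "(\<Sum>\<^sub>\<infinity>k\<in>K. (cmod (x k))\<^sup>2) \<le> B\<^sup>2"
  \<comment> \<open>Without summability the infinite sum is 0 by convention, and the bound is
    trivial.\<close>
  proof (cases "(\<lambda>k. (cmod (x k))\<^sup>2) summable_on K")
    case True
    show ?thesis
    proof (rule infsum_le_finite_sums[OF True])
      fix F assume "finite F" "F \<subseteq> K"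
      from assms(1)[OF this] have "(L2_set (\<lambda>k. cmod (x k)) F)\<^sup>2 \<le> B\<^sup>2"
        by (intro power_mono) auto
      then show "(\<Sum>k\<in>F. (cmod (x k))\<^sup>2) \<le> B\<^sup>2" by (simp add: L2_set_def sum_nonneg)
    qed
  qed (simp add: infsum_not_exists)
  then show ?thesis unfolding l2_norm_def using assms(2) by (intro real_le_lsqrt infsum_nonneg) auto
qed

lemma l2_norm_triangle:
  assumes "(\<lambda>k. (cmod (x k))\<^sup>2) summable_on K" "(\<lambda>k. (cmod (y k))\<^sup>2) summable_on K"
  shows "l2_norm K (\<lambda>k. x k - y k) \<le> l2_norm K x + l2_norm K y"
proof (rule l2_norm_le)
  fix F assume F: "finite F" "F \<subseteq> K"
  have "L2_set (\<lambda>k. cmod (x k - y k)) F \<le> L2_set (\<lambda>k. cmod (x k) + cmod (y k)) F"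
    by (intro L2_set_mono norm_triangle_ineq4) auto
  also have "\<dots> \<le> L2_set (\<lambda>k. cmod (x k)) F + L2_set (\<lambda>k. cmod (y k)) F"
    by (rule L2_set_triangle_ineq)
  also have "\<dots> \<le> l2_norm K x + l2_norm K y"
    using F assms by (intro add_mono L2_set_le_l2_norm)
  finally show "L2_set (\<lambda>k. cmod (x k - y k)) F \<le> l2_norm K x + l2_norm K y" .
next
  show "0 \<le> l2_norm K x + l2_norm K y"
    by (simp add: l2_norm_def infsum_nonneg)
qed

lemma summable_on_square:
  assumes "(\<lambda>k. cmod (x k)) summable_on K"
  shows "(\<lambda>k. (cmod (x k))\<^sup>2) summable_on K"
proof -
  define S where "S = (\<Sum>\<^sub>\<infinity>k\<in>K. cmod (x k))"
  have "(\<lambda>k. S * cmod (x k)) summable_on K" using assms by (rule summable_on_cmult_right)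
  then show ?thesis
  proof (rule summable_on_comparison_test)
    fix k assume k: "k \<in> K"
    have "(\<Sum>k\<in>{k}. cmod (x k)) \<le> S"
      unfolding S_def using assms k by (intro finite_sum_le_infsum) auto
    then show "(cmod (x k))\<^sup>2 \<le> S * cmod (x k)"
      by (simp add: power2_eq_square mult_right_mono)
  qed simp
qed

section \<open>Accuracy of the reconstruction\<close>

text \<open>The terms are indexed by \<open>I\<close> rather than by frequency, since the integers
  \<open>n k\<close> may coincide; the weights of such terms add up in one Fourier
  coefficient.\<close>

definition trig_poly1 :: "'k set \<Rightarrow> ('k \<Rightarrow> complex) \<Rightarrow> ('k \<Rightarrow> int) \<Rightarrow> real \<Rightarrow> complex" where
  "trig_poly1 I w n t = (\<Sum>k\<in>I. w k * cis (2 * pi * of_int (n k) * t))"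

lemma continuous_on_trig_poly1: "continuous_on A (trig_poly1 I w n)"
  unfolding trig_poly1_def by (intro continuous_intros)

lemma fourier1_trig_poly1:
  "fourier1 (trig_poly1 I w n) \<omega> = (\<Sum>k\<in>I. if n k = \<omega> then w k else 0)"
proof -
  have "fourier1 (trig_poly1 I w n) \<omega> =
      (LINT t | unit_measure. (\<Sum>k\<in>I. w k * cis (2 * pi * of_int (n k - \<omega>) * t)))"
    unfolding fourier1_def trig_poly1_def sum_distrib_right mult.assoc cis_mult
    by (simp add: algebra_simps)
  also have "\<dots> = (\<Sum>k\<in>I. w k * (LINT t | unit_measure. cis (2 * pi * of_int (n k - \<omega>) * t)))"
    by (subst Bochner_Integration.integral_sum)
      (auto intro!: integrable_mult_right integrable_unit_measure continuous_intros)
  also have "\<dots> = (\<Sum>k\<in>I. if n k = \<omega> then w k else 0)"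
    unfolding integral_unit_measure_cis by (intro sum.cong) auto
  finally show ?thesis .
qed

lemma sft_input_trig_poly1:
  assumes "finite I" "periodic1 \<mu>" "\<And>t. cmod (\<mu> t) \<le> B"
  shows "sft_input (trig_poly1 I w n) \<mu>"
proof -
  have "trig_poly1 I w n (t + 1) = trig_poly1 I w n t" for t
  proof -
    have "2 * pi * of_int (n k) * (t + 1) = 2 * pi * of_int (n k) * t + 2 * pi * of_int (n k)" for k
      by (simp add: algebra_simps)
    then show ?thesis by (simp only: trig_poly1_def cis_add_2pi_int)
  qed
  moreover have "(\<lambda>\<omega>. cmod (fourier1 (trig_poly1 I w n) \<omega>)) summable_on UNIV"
  proof (rule summable_on_cong_neutral[THEN iffD1, OF _ _ _ summable_on_finite])
    show "finite (n ` I)" using assms by simp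
    fix \<omega> assume "\<omega> \<in> UNIV - n ` I"
    then show "cmod (fourier1 (trig_poly1 I w n) \<omega>) = 0"
      unfolding fourier1_trig_poly1 by (subst sum.neutral) auto
  qed auto
  moreover have "bounded (range \<mu>)"
    using assms(3) by (auto simp: bounded_iff)
  ultimately show ?thesis
    using assms(2) continuous_on_trig_poly1[of UNIV I w n]
      integrable_unit_measure[OF continuous_on_trig_poly1[of UNIV I w n]]
    by (simp add: sft_input_def wiener_cont1_def periodic1_def)
qed

text \<open>All frequencies lie within the bandwidth, so the out-of-band part of
  \<open>sft_delta\<close> vanishes. The image of \<open>S\<close> under \<open>n\<close> has at
  most \<open>s\<close> elements, and merging terms cannot increase the l1 norm of the rest; so the
  accuracy parameter is at most \<Delta>. The weights \<open>w\<close> agree with \<open>c\<close>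
  only in modulus because a slice multiplies the coefficients by phases.\<close>

lemma sft_accurate_trig_poly1:
  assumes I: "finite I" and n: "\<And>k. k \<in> I \<Longrightarrow> n k \<in> freqs L"
    and w: "\<And>k. k \<in> I \<Longrightarrow> cmod (w k) = cmod (c k)"
    and S: "S \<subseteq> I" "card S \<le> s" and s: "1 \<le> s"
    and \<mu>: "\<And>t. cmod (\<mu> t) \<le> B"
    and \<Delta>: "\<Delta> = (\<Sum>k\<in>I - S. cmod (c k)) / real s + B"
    and acc: "sft_accurate s L (trig_poly1 I w n) \<mu> v" and sparse: "sparse_on (freqs L) (2 * s) v"
  defines "a \<equiv> fourier1 (trig_poly1 I w n)"
  shows "v \<omega> \<noteq> 0 \<Longrightarrow> cmod (a \<omega> - v \<omega>) \<le> sqrt 2 * \<Delta>"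
    and "cmod (a \<omega> - v \<omega>) \<le> (4 + 2 * sqrt 2) * \<Delta>"
    and "l2_norm UNIV (\<lambda>\<omega>. a \<omega> - v \<omega>) \<le> (8 * sqrt 2 + 7) * sqrt s * \<Delta>"
proof -
  have outside: "a \<omega> = 0" if "\<omega> \<notin> freqs L" for \<omega>
    unfolding a_def fourier1_trig_poly1 using n that by (intro sum.neutral) auto
  then have restr: "restr (freqs L) a = a" by (auto simp: restr_def fun_eq_iff)
  define \<tau> where "\<tau> = l1_norm UNIV (\<lambda>\<omega>. a \<omega> - best_approx s (freqs L) a \<omega>)"
  have finS: "finite S" using S(1) I finite_subset by blast
  have "\<tau> \<le> (\<Sum>\<omega>\<in>freqs L - n ` S. cmod (a \<omega>))"
    unfolding \<tau>_def using finS S(2) outside card_image_le[OF finS, of n]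
    by (intro l1_norm_best_approx_le finite_freqs) auto
  also have "\<dots> \<le> (\<Sum>\<omega>\<in>freqs L - n ` S. \<Sum>k\<in>I - S. if n k = \<omega> then cmod (c k) else 0)"
  proof (rule sum_mono)
    fix \<omega> assume \<omega>: "\<omega> \<in> freqs L - n ` S"
    have "cmod (a \<omega>) \<le> (\<Sum>k\<in>I. cmod (if n k = \<omega> then w k else 0))"
      unfolding a_def fourier1_trig_poly1 by (rule norm_sum)
    also have "\<dots> = (\<Sum>k\<in>I. if n k = \<omega> then cmod (c k) else 0)"
      using w by (intro sum.cong) auto
    also have "\<dots> = (\<Sum>k\<in>I - S. if n k = \<omega> then cmod (c k) else 0)"
      using \<omega> I by (intro sum.mono_neutral_right) auto
    finally show "cmod (a \<omega>) \<le> (\<Sum>k\<in>I - S. if n k = \<omega> then cmod (c k) else 0)" .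
  qed
  also have "\<dots> = (\<Sum>k\<in>I - S. \<Sum>\<omega>\<in>freqs L - n ` S. if n k = \<omega> then cmod (c k) else 0)"
    by (rule sum.swap)
  also have "\<dots> \<le> (\<Sum>k\<in>I - S. cmod (c k))"
    by (rule sum_mono) (auto simp: finite_freqs)
  finally have \<tau>_le: "\<tau> \<le> (\<Sum>k\<in>I - S. cmod (c k))" .
  have B: "0 \<le> B" using \<mu>[of 0] norm_ge_zero order_trans by blast
  have \<tau>s: "\<tau> / real s \<le> (\<Sum>k\<in>I - S. cmod (c k)) / real s"
    using \<tau>_le by (intro divide_right_mono) auto
  have \<Delta>0: "0 \<le> \<Delta>" unfolding \<Delta> using B by (intro add_nonneg_nonneg divide_nonneg_nonneg sum_nonneg) auto
  have zero: "l1_norm UNIV (\<lambda>\<omega> :: int. 0) = 0"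
    by (simp add: l1_norm_def)
  define \<delta> where "\<delta> = sft_delta s L (trig_poly1 I w n) \<mu>"
  have "(SUP t. cmod (\<mu> t)) \<le> B" using \<mu> by (intro cSUP_least) auto
  then have \<delta>: "\<delta> \<le> \<Delta>"
    using \<tau>s by (simp add: \<delta>_def sft_delta_def Let_def a_def[symmetric] zero restr \<tau>_def[symmetric] \<Delta>)
  have acc1: "\<And>\<omega>. \<omega> \<in> freqs L \<Longrightarrow> cmod (a \<omega>) > (4 + 2 * sqrt 2) * \<delta> \<Longrightarrow> v \<omega> \<noteq> 0"
    and acc2: "\<And>\<omega>. v \<omega> \<noteq> 0 \<Longrightarrow> cmod (a \<omega> - v \<omega>) \<le> sqrt 2 * \<delta>"
    and acc3: "l2_norm UNIV (\<lambda>\<omega>. a \<omega> - v \<omega>)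
      \<le> l2_norm UNIV (\<lambda>\<omega>. a \<omega> - best_approx (2 * s) (freqs L) a \<omega>) + (8 * sqrt 2 + 6) * sqrt s * \<delta>"
    using acc unfolding sft_accurate_def Let_def a_def[symmetric] restr \<delta>_def[symmetric] by auto
  show 1: "cmod (a \<omega> - v \<omega>) \<le> sqrt 2 * \<Delta>" if "v \<omega> \<noteq> 0" for \<omega>
    using acc2[OF that] \<delta> by (meson mult_left_mono order_trans real_sqrt_ge_zero zero_le_numeral)
  show "cmod (a \<omega> - v \<omega>) \<le> (4 + 2 * sqrt 2) * \<Delta>"
  \<comment> \<open>By contraposition of the detection property, a coefficient missing from the
    support is itself small.\<close>
  proof (cases "v \<omega> = 0")
    case True
    have "cmod (a \<omega>) \<le> (4 + 2 * sqrt 2) * \<Delta>"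
    proof (cases "\<omega> \<in> freqs L")
      case True
      with acc1 \<open>v \<omega> = 0\<close> have "cmod (a \<omega>) \<le> (4 + 2 * sqrt 2) * \<delta>" by force
      also have "\<dots> \<le> (4 + 2 * sqrt 2) * \<Delta>" using \<delta> by (intro mult_left_mono) auto
      finally show ?thesis .
    qed (use outside \<Delta>0 in auto)
    then show ?thesis using True by simp
  next
    case False
    have "sqrt 2 * \<Delta> \<le> (4 + 2 * sqrt 2) * \<Delta>" using \<Delta>0 by (intro mult_right_mono) auto
    with 1[OF False] show ?thesis by simp
  qed
  \<comment> \<open>The best 2s-term error costs one more sqrt s \<Delta>, which turns the 6 of the
    SFT guarantee into 7.\<close>
  have "l2_norm UNIV (\<lambda>\<omega>. a \<omega> - best_approx (2 * s) (freqs L) a \<omega>) \<le> \<tau> / sqrt s"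
    unfolding \<tau>_def using outside s by (intro l2_norm_best_approx_le finite_freqs) auto
  also have "\<dots> = sqrt s * (\<tau> / real s)"
    using s by (simp add: field_simps)
  also have "\<dots> \<le> sqrt s * \<Delta>"
    using \<tau>s B by (intro mult_left_mono) (auto simp: \<Delta>)
  finally have "l2_norm UNIV (\<lambda>\<omega>. a \<omega> - best_approx (2 * s) (freqs L) a \<omega>) \<le> sqrt s * \<Delta>" .
  moreover have "(8 * sqrt 2 + 6) * sqrt s * \<delta> \<le> (8 * sqrt 2 + 6) * sqrt s * \<Delta>"
    using \<delta> by (intro mult_left_mono) auto
  ultimately show "l2_norm UNIV (\<lambda>\<omega>. a \<omega> - v \<omega>) \<le> (8 * sqrt 2 + 7) * sqrt s * \<Delta>"
    using acc3 by (simp add: algebra_simps)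
qed

section \<open>The DFT across the slices\<close>

lemma freqs_eqI:
  assumes "a \<in> freqs N" "b \<in> freqs N" "int N dvd a - b"
  shows "a = b"
proof (rule ccontr)
  assume "a \<noteq> b"
  then have "int N \<le> \<bar>a - b\<bar>" using dvd_imp_le_int[of "a - b" "int N"] assms(3) by simp
  moreover have "\<lfloor>real N / 2\<rfloor> + \<lceil>real N / 2\<rceil> = int N" by linarith
  ultimately show False using assms(1,2) unfolding freqs_def by auto
qed

text \<open>In slice \<open>j\<close> the term \<open>k\<close> carries the phase of k_l j / N. By
  orthogonality the DFT over \<open>j\<close> keeps the terms whose k_l is congruent to
  \<open>h\<close> modulo \<open>N\<close>, and within \<open>freqs N\<close> congruent means
  equal.\<close>

lemma dft_fourier1:
  assumes "N > 0" "h \<in> freqs N" "\<And>k. k \<in> I \<Longrightarrow> p k \<in> freqs N"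
  shows "dft N (\<lambda>j. \<Sum>k\<in>I. if n k = \<omega> then c k * cis (2 * pi * of_int (p k) * real j / real N) else 0) h
    = (\<Sum>k\<in>I. if n k = \<omega> \<and> p k = h then c k else 0)"
proof -
  have term_eq: "(if n k = \<omega> then c k * cis (2 * pi * of_int (p k) * real j / real N) else 0)
      * cis (- (2 * pi * of_int h * real j / real N))
    = (if n k = \<omega> then c k else 0) * cis (2 * pi * of_int (p k - h) * real j / real N)" for j k
    by (simp add: cis_mult diff_divide_distrib algebra_simps)
  have "(\<Sum>j<N. (\<Sum>k\<in>I. if n k = \<omega> then c k * cis (2 * pi * of_int (p k) * real j / real N) else 0)
      * cis (- (2 * pi * of_int h * real j / real N)))
    = (\<Sum>k\<in>I. (if n k = \<omega> then c k else 0) * (\<Sum>j<N. cis (2 * pi * of_int (p k - h) * real j / real N)))"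
    unfolding sum_distrib_right term_eq by (subst sum.swap) (simp only: sum_distrib_left)
  also have "\<dots> = (\<Sum>k\<in>I. of_nat N * (if n k = \<omega> \<and> p k = h then c k else 0))"
  proof (rule sum.cong[OF refl])
    fix k assume "k \<in> I"
    have "int N dvd p k - h \<longleftrightarrow> p k = h"
      using freqs_eqI[OF assms(3)[OF \<open>k \<in> I\<close>] assms(2)] by auto
    then show "(if n k = \<omega> then c k else 0) * (\<Sum>j<N. cis (2 * pi * of_int (p k - h) * real j / real N))
        = of_nat N * (if n k = \<omega> \<and> p k = h then c k else 0)"
      unfolding sum_cis_roots[OF assms(1)] by simp
  qed
  finally show ?thesis
    unfolding dft_def using assms(1) by (simp add: sum_distrib_left[symmetric])
qed

text \<open>The factor 1 / N makes the DFT nonexpansive in the maximum norm, so the errors of the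
  rows are not amplified.\<close>

lemma dft_diff_le:
  assumes "N > 0" "\<And>j. j < N \<Longrightarrow> cmod (y j - y' j) \<le> E"
  shows "cmod (dft N y h - dft N y' h) \<le> E"
proof -
  have "dft N y h - dft N y' h =
      (\<Sum>j<N. (y j - y' j) * cis (- (2 * pi * of_int h * real j / real N))) / of_nat N"
    by (simp add: dft_def diff_divide_distrib[symmetric] sum_subtractf[symmetric] left_diff_distrib)
  also have "cmod \<dots> \<le> (\<Sum>j<N. E) / real N"
    unfolding norm_divide norm_of_nat
    by (intro divide_right_mono sum_norm_le) (use assms in \<open>auto simp: norm_mult\<close>)
  finally show ?thesis using assms by simp
qed

lemma dot_split: "l < d \<Longrightarrow> dot d k z = k l * z l + dot_except d l k z"
  unfolding dot_def dot_except_def by (simp add: sum.remove)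

section \<open>Reconstruction from approximate line and slice coefficients\<close>

context
  fixes d N s :: nat and z :: "nat \<Rightarrow> int" and Ls :: "nat \<Rightarrow> nat" and I :: "(nat \<Rightarrow> int) set"
    and c :: "(nat \<Rightarrow> int) \<Rightarrow> complex" and v :: "int \<Rightarrow> complex" and F :: "nat \<Rightarrow> int \<Rightarrow> int \<Rightarrow> complex"
    and \<Delta> :: real
  assumes I: "finite I" "I \<subseteq> freq_box d N" and inj: "inj_on (\<lambda>k. dot d k z) I" and s: "1 \<le> s"
    and range: "\<And>k l. k \<in> I \<Longrightarrow> l < d \<Longrightarrow> dot_except d l k z \<in> freqs (Ls l)"
    and sparse: "finite {\<omega>. v \<omega> \<noteq> 0}" "card {\<omega>. v \<omega> \<noteq> 0} \<le> 2 * s"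
    and line: "\<And>\<omega>. v \<omega> \<noteq> 0 \<Longrightarrow> cmod ((\<Sum>k\<in>I. if dot d k z = \<omega> then c k else 0) - v \<omega>) \<le> sqrt 2 * \<Delta>"
      "l2_norm UNIV (\<lambda>\<omega>. (\<Sum>k\<in>I. if dot d k z = \<omega> then c k else 0) - v \<omega>) \<le> (8 * sqrt 2 + 7) * sqrt s * \<Delta>"
    and slice: "\<And>l \<omega> h. l < d \<Longrightarrow> h \<in> freqs N \<Longrightarrow>
      cmod (F l \<omega> h - (\<Sum>k\<in>I. if dot_except d l k z = \<omega> \<and> k l = h then c k else 0)) \<le> (4 + 2 * sqrt 2) * \<Delta>"
begin

lemma line_coeff: "k \<in> I \<Longrightarrow> (\<Sum>k'\<in>I. if dot d k' z = dot d k z then c k' else 0) = c k"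
proof -
  assume k: "k \<in> I"
  then have "(\<Sum>k'\<in>I. if dot d k' z = dot d k z then c k' else 0) = (\<Sum>k'\<in>I. if k' = k then c k else 0)"
    using inj by (intro sum.cong) (auto simp: inj_on_def)
  then show ?thesis using k I(1) by simp
qed

text \<open>Row \<open>h\<close> and column k . z - h z_l collect only frequencies with the same
  product with \<open>z\<close> as \<open>k\<close>, and injectivity on \<open>I\<close> leaves
  nothing but \<open>k\<close>.\<close>

lemma slice_coeff:
  assumes "k \<in> I" "l < d"
  shows "(\<Sum>k'\<in>I. if dot_except d l k' z = dot d k z - h * z l \<and> k' l = h then c k' else 0)
    = (if k l = h then c k else 0)"
proof -
  have "dot_except d l k' z = dot d k z - h * z l \<and> k' l = h \<longleftrightarrow> k' = k \<and> k l = h"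
    if "k' \<in> I" for k'
    using inj_onD[OF inj _ that assms(1)] dot_split[OF assms(2), of k' z] dot_split[OF assms(2), of k z]
    by auto
  then have "(\<Sum>k'\<in>I. if dot_except d l k' z = dot d k z - h * z l \<and> k' l = h then c k' else 0)
      = (\<Sum>k'\<in>I. if k' = k then (if k l = h then c k else 0) else 0)"
    by (intro sum.cong) auto
  then show ?thesis using assms I(1) by simp
qed

text \<open>
  A wrong \<open>k\<^sub>l\<close> beats the right one only if \<open>v\<^sub>\<omega>\<close> is as close to an entry whose exact value is \<open>0\<close>
  as to the entry whose exact value is \<open>c\<^sub>k\<close>.
\<close>

lemma misidentified_small:
  assumes k: "k \<in> I" and v: "v (dot d k z) \<noteq> 0"
    and found: "found_freq d N z Ls F (v (dot d k z)) (dot d k z) \<noteq> Some k"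
  shows "cmod (v (dot d k z)) \<le> (8 + 5 * sqrt 2) * \<Delta>"
proof -
  let ?\<omega> = "dot d k z"
  have kN: "k l \<in> freqs N" if "l < d" for l
    using k I(2) that by (auto simp: freq_box_def)
  have rng: "?\<omega> - k l * z l \<in> freqs (Ls l)" if "l < d" for l
    using range[OF k that] dot_split[OF that, of k z] by simp
  \<comment> \<open>The correct pair is admissible in every coordinate, so the search always returns
    something.\<close>
  have "coord N (z l) (Ls l) (F l) (v ?\<omega>) ?\<omega> \<noteq> None" if "l < d" for l
    using coord_NoneD[OF _ kN[OF that]] rng[OF that] by blast
  then obtain k' where k': "found_freq d N z Ls F (v ?\<omega>) ?\<omega> = Some k'"
    unfolding found_freq_def by (metis (no_types, lifting))
  with found have "k' \<noteq> k" by simp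
  have "k' \<in> freq_box d N" "k \<in> freq_box d N"
    using found_freq_SomeD(1)[OF k'] k I(2) by auto
  then obtain l where l: "l < d" "k' l \<noteq> k l"
    using \<open>k' \<noteq> k\<close> unfolding freq_box_def by (metis PiE_ext lessThan_iff)
  have coord: "coord N (z l) (Ls l) (F l) (v ?\<omega>) ?\<omega> = Some (k' l)"
    by (rule found_freq_SomeD(2)[OF k' l(1)])
  \<comment> \<open>The chain to be assembled: |v| is at most the distance to the chosen entry plus
    the size of that entry; the distance is at most that to the correct entry. This gives sqrt 2 + 2
    (4 + 2 sqrt 2) = 8 + 5 sqrt 2.\<close>
  have "cmod (v ?\<omega> - F l (?\<omega> - k' l * z l) (k' l)) \<le> cmod (v ?\<omega> - F l (?\<omega> - k l * z l) (k l))"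
    by (rule coord_SomeD(2)[OF coord kN[OF l(1)] rng[OF l(1)]])
  moreover have "cmod (F l (?\<omega> - k' l * z l) (k' l)) \<le> (4 + 2 * sqrt 2) * \<Delta>"
    using slice[OF l(1) coord_SomeD(1)[OF coord], of "?\<omega> - k' l * z l"] slice_coeff[OF k l(1)] l(2)
    by simp
  moreover have "cmod (F l (?\<omega> - k l * z l) (k l) - c k) \<le> (4 + 2 * sqrt 2) * \<Delta>"
    using slice[OF l(1) kN[OF l(1)], of "?\<omega> - k l * z l"] slice_coeff[OF k l(1)] by simp
  moreover have "cmod (c k - v ?\<omega>) \<le> sqrt 2 * \<Delta>"
    using line(1)[OF v] line_coeff[OF k] by simp
  moreover have "cmod (v ?\<omega>) \<le> cmod (v ?\<omega> - F l (?\<omega> - k' l * z l) (k' l)) + cmod (F l (?\<omega> - k' l * z l) (k' l))"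
    using norm_triangle_ineq[of "v ?\<omega> - F l (?\<omega> - k' l * z l) (k' l)" "F l (?\<omega> - k' l * z l) (k' l)"] by simp
  moreover have "cmod (v ?\<omega> - F l (?\<omega> - k l * z l) (k l)) \<le>
      cmod (c k - v ?\<omega>) + cmod (F l (?\<omega> - k l * z l) (k l) - c k)"
    using norm_triangle_ineq[of "v ?\<omega> - c k" "c k - F l (?\<omega> - k l * z l) (k l)"]
    by (simp add: norm_minus_commute)
  ultimately show ?thesis by (simp add: algebra_simps)
qed

lemma l2_norm_assemble_le:
  assumes \<Delta>0: "0 \<le> \<Delta>"
  shows "l2_norm (freq_lattice d) (\<lambda>k. assemble d N z Ls F v k - restr I c k) \<le> 98 * (sqrt s * \<Delta>)"
proof (rule l2_norm_le)
  let ?b = "assemble d N z Ls F v"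
  let ?a = "\<lambda>\<omega>. \<Sum>k\<in>I. if dot d k z = \<omega> then c k else 0"
  let ?e = "\<lambda>k. cmod (?b k - restr I c k)"
  define A where "A = (8 * sqrt 2 + 7) * sqrt s * \<Delta>"
  \<comment> \<open>One sqrt 2 more than the bound for a misidentified value of \<open>v\<close>, to
    pass from \<open>v\<close> to \<open>c\<close>.\<close>
  define B where "B = (8 + 6 * sqrt 2) * \<Delta>"
  define bad where "bad = {k \<in> I. v (dot d k z) \<noteq> 0 \<and> found_freq d N z Ls F (v (dot d k z)) (dot d k z) \<noteq> Some k}"
  define ghost where "ghost = {k. k \<notin> I \<and> ?b k \<noteq> 0}"
  have AB: "0 \<le> A" "0 \<le> B" using \<Delta>0 by (simp_all add: A_def B_def)
  have card_supp: "card K \<le> 2 * s \<and> finite K" if "inj_on (\<lambda>k. dot d k z) K" "\<And>k. k \<in> K \<Longrightarrow> v (dot d k z) \<noteq> 0" for K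
  proof -
    have sub: "(\<lambda>k. dot d k z) ` K \<subseteq> {\<omega>. v \<omega> \<noteq> 0}" using that(2) by blast
    then show ?thesis
      using card_mono[OF sparse(1) sub] card_image[OF that(1)] sparse(2)
        finite_imageD[OF finite_subset[OF sub sparse(1)] that(1)] by simp
  qed
  have "card bad \<le> 2 * s \<and> finite bad"
    by (rule card_supp) (use inj in \<open>auto simp: bad_def inj_on_def\<close>)
  moreover have "card ghost \<le> 2 * s \<and> finite ghost"
  proof (rule card_supp)
    show "inj_on (\<lambda>k. dot d k z) ghost"
      by (rule inj_on_subset[OF inj_on_assemble[of d z N Ls F v]]) (auto simp: ghost_def)
    show "v (dot d k z) \<noteq> 0" if "k \<in> ghost" for k
      using assemble_nonzeroD(2) that unfolding ghost_def by blast
  qed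
  ultimately have card: "card (bad \<union> ghost) \<le> 4 * s" "finite (bad \<union> ghost)"
    using card_Un_le[of bad ghost] by auto
  \<comment> \<open>An element of \<open>I\<close> is either treated correctly, and inherits the
    error of \<open>v\<close> at k . z, or it is lost (\<open>bad\<close>); any other nonzero entry
    is spurious (\<open>ghost\<close>).\<close>
  have e: "(?e k)\<^sup>2 \<le> (if k \<in> I then (cmod (?a (dot d k z) - v (dot d k z)))\<^sup>2 else 0)
      + (if k \<in> bad \<union> ghost then B\<^sup>2 else 0)" for k
  proof (cases "k \<in> I")
    case k: True
    let ?\<omega> = "dot d k z"
    show ?thesis
    proof (cases "found_freq d N z Ls F (v ?\<omega>) ?\<omega> = Some k \<or> v ?\<omega> = 0")
      case True
      then have "?b k = v ?\<omega>" by (auto simp: assemble_def Let_def)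
      then have "?e k = cmod (?a ?\<omega> - v ?\<omega>)"
        using k line_coeff[OF k] by (simp add: restr_def norm_minus_commute)
      then show ?thesis using k by simp
    next
      case False
      then have bad: "k \<in> bad" using k by (simp add: bad_def)
      have "?b k = 0" using False by (auto simp: assemble_def Let_def)
      then have "?e k = cmod (c k)" using k by (simp add: restr_def)
      also have "\<dots> \<le> cmod (v ?\<omega>) + cmod (c k - v ?\<omega>)"
        using norm_triangle_ineq[of "v ?\<omega>" "c k - v ?\<omega>"] by simp
      also have "\<dots> \<le> (8 + 5 * sqrt 2) * \<Delta> + sqrt 2 * \<Delta>"
        using misidentified_small[OF k] line(1)[of ?\<omega>] line_coeff[OF k] False by (intro add_mono) auto
      also have "\<dots> = B" by (simp add: B_def algebra_simps)
      finally have "(?e k)\<^sup>2 \<le> B\<^sup>2" by (intro power_mono) auto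
      then show ?thesis using bad k by (simp add: add_increasing)
    qed
  next
    case k: False
    show ?thesis
    proof (cases "?b k = 0")
      case True
      then show ?thesis using k by (simp add: restr_def)
    next
      case False
      let ?\<omega> = "dot d k z"
      have found: "found_freq d N z Ls F (v ?\<omega>) ?\<omega> = Some k" and v: "v ?\<omega> \<noteq> 0"
        using assemble_nonzeroD[OF False] by auto
      have b: "?b k = v ?\<omega>" using found by (simp add: assemble_def)
      have "cmod (v ?\<omega>) \<le> B"
      \<comment> \<open>A spurious entry has one of two origins: the value of some \<open>k0\<close>
        in \<open>I\<close> was put in the wrong place, or no element of \<open>I\<close> belongs to
        \<omega> and \<open>v\<close> is pure error there.\<close>
      proof (cases "\<exists>k0\<in>I. dot d k0 z = ?\<omega>")
        case True
        then obtain k0 where k0: "k0 \<in> I" "dot d k0 z = ?\<omega>" by blast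
        then have "cmod (v ?\<omega>) \<le> (8 + 5 * sqrt 2) * \<Delta>"
          using misidentified_small[OF k0(1)] found v k by auto
        also have "\<dots> \<le> B" unfolding B_def using \<Delta>0 by (intro mult_right_mono) auto
        finally show ?thesis .
      next
        case none: False
        then have "?a ?\<omega> = 0" by (intro sum.neutral) auto
        with line(1)[OF v] have "cmod (v ?\<omega>) \<le> sqrt 2 * \<Delta>" by simp
        also have "\<dots> \<le> B" unfolding B_def using \<Delta>0 by (intro mult_right_mono) auto
        finally show ?thesis .
      qed
      then have "(?e k)\<^sup>2 \<le> B\<^sup>2" using k b by (intro power_mono) (auto simp: restr_def)
      moreover have "k \<in> ghost" using k False by (simp add: ghost_def)
      ultimately show ?thesis using k by simp
    qed
  qed
  have sq: "(\<lambda>\<omega>. (cmod (?a \<omega> - v \<omega>))\<^sup>2) summable_on UNIV"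
  proof (rule summable_on_cong_neutral[THEN iffD1, OF _ _ _ summable_on_finite])
    show "finite ((\<lambda>k. dot d k z) ` I \<union> {\<omega>. v \<omega> \<noteq> 0})" using I(1) sparse(1) by simp
    fix \<omega> assume "\<omega> \<in> UNIV - ((\<lambda>k. dot d k z) ` I \<union> {\<omega>. v \<omega> \<noteq> 0})"
    then have "v \<omega> = 0" "?a \<omega> = 0" by (auto intro!: sum.neutral)
    then show "(cmod (?a \<omega> - v \<omega>))\<^sup>2 = 0" by simp
  qed auto
  fix K :: "(nat \<Rightarrow> int) set" assume K: "finite K"
  have "(\<Sum>k\<in>K. (?e k)\<^sup>2) \<le> (\<Sum>k\<in>K. (if k \<in> I then (cmod (?a (dot d k z) - v (dot d k z)))\<^sup>2 else 0)
      + (if k \<in> bad \<union> ghost then B\<^sup>2 else 0))"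
    using e by (rule sum_mono)
  also have "\<dots> = (\<Sum>k\<in>K \<inter> I. (cmod (?a (dot d k z) - v (dot d k z)))\<^sup>2)
      + (\<Sum>k\<in>K \<inter> (bad \<union> ghost). B\<^sup>2)"
    using K by (simp only: sum.distrib sum.inter_restrict)
  also have "(\<Sum>k\<in>K \<inter> I. (cmod (?a (dot d k z) - v (dot d k z)))\<^sup>2)
      = (\<Sum>\<omega>\<in>(\<lambda>k. dot d k z) ` (K \<inter> I). (cmod (?a \<omega> - v \<omega>))\<^sup>2)"
    using inj_on_subset[OF inj, of "K \<inter> I"] by (simp add: sum.reindex)
  also have "\<dots> \<le> (\<Sum>\<^sub>\<infinity>\<omega>. (cmod (?a \<omega> - v \<omega>))\<^sup>2)"
    using K by (intro finite_sum_le_infsum sq) auto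
  also have "\<dots> = (l2_norm UNIV (\<lambda>\<omega>. ?a \<omega> - v \<omega>))\<^sup>2"
    by (simp add: l2_norm_def infsum_nonneg)
  also have "\<dots> \<le> A\<^sup>2"
    using line(2) unfolding A_def by (intro power_mono) (auto simp: l2_norm_def infsum_nonneg)
  also have "(\<Sum>k\<in>K \<inter> (bad \<union> ghost). B\<^sup>2) \<le> 4 * real s * B\<^sup>2"
  proof -
    have "card (K \<inter> (bad \<union> ghost)) \<le> 4 * s"
      using card card_mono[OF card(2), of "K \<inter> (bad \<union> ghost)"] by simp
    then have "real (card (K \<inter> (bad \<union> ghost))) * B\<^sup>2 \<le> real (4 * s) * B\<^sup>2"
      by (intro mult_right_mono of_nat_mono) auto
    then show ?thesis by simp
  qed
  \<comment> \<open>Only a nonnegative cross term is added, and the square root can be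
    taken.\<close>
  also have "A\<^sup>2 + 4 * real s * B\<^sup>2 \<le> (A + 2 * sqrt s * B)\<^sup>2"
    using AB by (simp add: power2_sum power_mult_distrib)
  finally have "(\<Sum>k\<in>K. (?e k)\<^sup>2) \<le> (A + 2 * sqrt s * B)\<^sup>2" by simp
  then have "L2_set ?e K \<le> A + 2 * sqrt s * B"
    unfolding L2_set_def using AB by (intro real_le_lsqrt) (auto simp: sum_nonneg)
  also have "\<dots> = (23 + 20 * sqrt 2) * (sqrt s * \<Delta>)"
    by (simp add: A_def B_def algebra_simps)
  also have "\<dots> \<le> 98 * (sqrt s * \<Delta>)"
  proof (intro mult_right_mono)
    have "sqrt 2 \<le> 2" by (rule real_le_lsqrt) auto
    then show "23 + 20 * sqrt 2 \<le> 98" by simp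
  qed (use \<Delta>0 in simp)
  finally show "L2_set ?e K \<le> 98 * (sqrt s * \<Delta>)" .
qed (use \<Delta>0 in simp)

end

section \<open>The algorithm on noisy samples\<close>

lemma trig_poly_line_point:
  "trig_poly d I c (line_point d z t) = trig_poly1 I c (\<lambda>k. dot d k z) t"
  unfolding trig_poly_def trig_poly1_def phase_def line_point_def dot_def
  by (simp add: sum_distrib_left sum_distrib_right mult_ac)

lemma trig_poly_slice_point:
  assumes "l < d"
  shows "trig_poly d I c (slice_point d N z l j t) =
    trig_poly1 I (\<lambda>k. c k * cis (2 * pi * of_int (k l) * real j / real N)) (\<lambda>k. dot_except d l k z) t"
proof -
  have "phase d k (slice_point d N z l j t) =
      2 * pi * of_int (k l) * real j / real N + 2 * pi * of_int (dot_except d l k z) * t" for k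
  proof -
    have "(\<Sum>i<d. of_int (k i) * slice_point d N z l j t i) =
        of_int (k l) * slice_point d N z l j t l + (\<Sum>i\<in>{..<d} - {l}. of_int (k i) * slice_point d N z l j t i)"
      using assms by (simp add: sum.remove)
    also have "(\<Sum>i\<in>{..<d} - {l}. of_int (k i) * slice_point d N z l j t i) = of_int (dot_except d l k z) * t"
      unfolding dot_except_def of_int_sum sum_distrib_right
      by (intro sum.cong) (auto simp: slice_point_def)
    finally show ?thesis using assms by (simp add: phase_def slice_point_def distrib_left mult.assoc)
  qed
  then show ?thesis by (simp add: trig_poly_def trig_poly1_def cis_mult[symmetric] mult.assoc)
qed

lemma line_point_shift: "line_point d z (t + 1) = (\<lambda>i\<in>{..<d}. line_point d z t i + of_int (z i))"
  by (auto simp: line_point_def fun_eq_iff algebra_simps)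

lemma slice_point_shift:
  "slice_point d N z l j (t + 1) =
    (\<lambda>i\<in>{..<d}. slice_point d N z l j t i + of_int (if i = l then 0 else z i))"
  by (auto simp: slice_point_def fun_eq_iff algebra_simps)

text \<open>For odd length the frequency interval is symmetric, from -m to m; hence the form 2m + 1
  of the bandwidths.\<close>

lemma mem_freqs_odd: "\<bar>x\<bar> \<le> int m \<Longrightarrow> x \<in> freqs (2 * m + 1)"
proof -
  assume "\<bar>x\<bar> \<le> int m"
  moreover have "\<lceil>real (2 * m + 1) / 2\<rceil> = int m + 1" "\<lfloor>real (2 * m + 1) / 2\<rfloor> = int m"
    by (rule ceiling_unique; simp) (rule floor_unique; simp)
  ultimately show ?thesis unfolding freqs_def by auto
qed

lemma dot_mem_freqs:
  assumes "finite I" "k \<in> I"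
  shows "dot d k z \<in> freqs (line_bw d z I)" "dot_except d l k z \<in> freqs (slice_bw d z I l)"
proof -
  have "\<bar>h k\<bar> \<le> int (nat (Max ((\<lambda>k. \<bar>h k\<bar>) ` I)))" for h :: "(nat \<Rightarrow> int) \<Rightarrow> int"
  proof -
    have "\<bar>h k\<bar> \<le> Max ((\<lambda>k. \<bar>h k\<bar>) ` I)" using assms by (intro Max_ge) auto
    then show ?thesis by linarith
  qed
  note bound = mem_freqs_odd[OF this]
  show "dot d k z \<in> freqs (line_bw d z I)" unfolding line_bw_def by (rule bound)
  show "dot_except d l k z \<in> freqs (slice_bw d z I l)" unfolding slice_bw_def by (rule bound)
qed

text \<open>
  The coefficients outside \<open>I\<close> are treated as noise: each SFT runs on the restriction of a
  trigonometric polynomial with frequencies in \<open>I\<close>.  The flag \<open>metered\<close> is there because the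
  deterministic SFT has no cost bound for \<open>s = 1\<close>.
\<close>

locale setting =
  fixes d N s :: nat and z :: "nat \<Rightarrow> int" and I :: "(nat \<Rightarrow> int) set"
    and f :: "(nat \<Rightarrow> real) \<Rightarrow> complex" and \<eta> :: "sft_call \<Rightarrow> (nat \<Rightarrow> real) \<Rightarrow> complex" and e :: real
    and B :: "nat \<Rightarrow> (real, int \<Rightarrow> complex) prog" and \<epsilon> :: real and T :: real and metered :: bool
  assumes N: "1 \<le> N" and s: "1 \<le> s"
    and I: "finite I" "I \<subseteq> freq_box d N" and inj: "inj_on (\<lambda>k. dot d k z) I"
    and f: "wiener_cont d f"
    and e: "0 \<le> e" and \<eta>: "\<And>q. periodic d (\<eta> q)" "\<And>q x. x \<in> points d \<Longrightarrow> cmod (\<eta> q x) \<le> e"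
    and \<epsilon>: "0 \<le> \<epsilon>"
    and sft: "\<And>L a \<mu>. L \<in> insert (line_bw d z I) (slice_bw d z I ` {..<d}) \<Longrightarrow> sft_input a \<mu> \<Longrightarrow>
      sure (\<lambda>t. a t + \<mu> t) (B L) (sft_cost metered L s T) \<and>
      fail_prob (\<lambda>t. a t + \<mu> t) (B L) (\<lambda>v. sparse_on (freqs L) (2 * s) v \<and> sft_accurate s L a \<mu> v) \<le> \<epsilon>"
begin

abbreviation "c \<equiv> fourier d f"
abbreviation "noise_bound \<equiv> l1_norm (freq_lattice d) (\<lambda>k. c k - restr I c k) + e"
abbreviation "\<Delta> \<equiv> l1_norm (freq_lattice d) (\<lambda>k. restr I c k - best_approx s I (restr I c) k) / real s + noise_bound"
abbreviation "alg \<equiv> two_dim_dft B d N z (line_bw d z I) (slice_bw d z I)"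

definition noise :: "sft_call \<Rightarrow> (nat \<Rightarrow> real) \<Rightarrow> complex" where
  "noise q x = f x + \<eta> q x - trig_poly d I c x"

lemma I_lattice: "I \<subseteq> freq_lattice d"
  using I(2) by (auto simp: freq_box_def)

lemma noise_le: "x \<in> points d \<Longrightarrow> cmod (noise q x) \<le> noise_bound"
  using norm_diff_trig_poly_le[OF f I(1) I_lattice, of x] \<eta>(2)[of x q]
    norm_triangle_ineq[of "f x - trig_poly d I c x" "\<eta> q x"]
  by (simp add: noise_def algebra_simps)

lemma periodic_noise: "periodic d (noise q)"
  using f \<eta>(1)[of q] periodic_trig_poly[of d I c] by (simp add: noise_def periodic_def wiener_cont_def)

lemma line_point_mem: "line_point d z t \<in> points d"
  by (simp add: line_point_def)

lemma slice_point_mem: "slice_point d N z l j t \<in> points d"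
  by (simp add: slice_point_def)

definition line_noise :: "real \<Rightarrow> complex" where
  "line_noise t = noise Line (line_point d z t)"

definition slice_noise :: "nat \<Rightarrow> nat \<Rightarrow> real \<Rightarrow> complex" where
  "slice_noise l j t = noise (Slice l j) (slice_point d N z l j t)"

abbreviation "line_fun \<equiv> trig_poly1 I c (\<lambda>k. dot d k z)"
abbreviation "slice_fun l j \<equiv> trig_poly1 I (\<lambda>k. c k * cis (2 * pi * of_int (k l) * real j / real N))
  (\<lambda>k. dot_except d l k z)"

lemma sft_input_line: "sft_input line_fun line_noise"
proof (rule sft_input_trig_poly1[OF I(1)])
  show "periodic1 line_noise"
    using periodic_shift[OF periodic_noise line_point_mem]
    by (simp add: periodic1_def line_noise_def line_point_shift)
  show "cmod (line_noise t) \<le> noise_bound" for t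
    unfolding line_noise_def by (rule noise_le[OF line_point_mem])
qed

lemma sft_input_slice: "sft_input (slice_fun l j) (slice_noise l j)"
proof (rule sft_input_trig_poly1[OF I(1)])
  show "periodic1 (slice_noise l j)"
    using periodic_shift[OF periodic_noise slice_point_mem]
    by (simp add: periodic1_def slice_noise_def slice_point_shift)
  show "cmod (slice_noise l j t) \<le> noise_bound" for t
    unfolding slice_noise_def by (rule noise_le[OF slice_point_mem])
qed

lemma noisy_line: "noisy f \<eta> (Line, line_point d z t) = line_fun t + line_noise t"
  by (simp add: noisy_def line_noise_def noise_def trig_poly_line_point)

lemma noisy_slice:
  "l < d \<Longrightarrow> noisy f \<eta> (Slice l j, slice_point d N z l j t) = slice_fun l j t + slice_noise l j t"
  by (simp add: noisy_def slice_noise_def noise_def trig_poly_slice_point)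

lemma sure_alg:
  "sure (noisy f \<eta>) alg (\<lambda>b m n. sparse_on (freq_box d N) (2 * s) b \<and>
    (metered \<longrightarrow> real m \<le> T + real d * real N * T \<and>
     real n \<le> T + real d * (real N * (T + 8 * real s + 1)
         + 2 * real s * real N * (3 * real (dft_length N) + real N + 1) + 1)
       + 2 * real s * (real d * (9 * real N + 1) + 3 * real d + 3)))"
proof (rule sure_two_dim_dft)
  show "sure (\<lambda>t. noisy f \<eta> (Line, line_point d z t)) (B (line_bw d z I))
      (sft_cost metered (line_bw d z I) s T)"
    unfolding noisy_line using sft[OF _ sft_input_line] by blast
  show "sure (\<lambda>t. noisy f \<eta> (Slice l j, slice_point d N z l j t)) (B (slice_bw d z I l))
      (sft_cost metered (slice_bw d z I l) s T)" if "l < d" for l j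
    unfolding noisy_slice[OF that] using sft[OF _ sft_input_slice] that by blast
qed

lemma accurate_assemble:
  assumes v: "sparse_on (freqs (line_bw d z I)) (2 * s) v"
      "sft_accurate s (line_bw d z I) line_fun line_noise v"
    and vs: "\<And>l j. l < d \<Longrightarrow> j < N \<Longrightarrow> sparse_on (freqs (slice_bw d z I l)) (2 * s) (vs l j) \<and>
      sft_accurate s (slice_bw d z I l) (slice_fun l j) (slice_noise l j) (vs l j)"
    and F: "\<And>l. l < d \<Longrightarrow> F l = (\<lambda>\<omega>. dft N (\<lambda>j. vs l j \<omega>))"
  shows "l2_norm (freq_lattice d) (\<lambda>k. assemble d N z (slice_bw d z I) F v k - c k) \<le>
    98 * (sqrt s * \<Delta>) + l2_norm (freq_lattice d) (\<lambda>k. c k - restr I c k)"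
proof -
  obtain S where S: "S \<subseteq> I" "card S = min s (card I)"
    "best_approx s I (restr I c) = restr S (restr I c)"
    by (rule best_approx_obtain[OF I(1), of s "restr I c"]) (rule that)
  have "l1_norm (freq_lattice d) (\<lambda>k. restr I c k - best_approx s I (restr I c) k) =
      (\<Sum>k\<in>I - S. cmod (restr I c k))"
    by (rule l1_norm_best_approx[OF I(1) I_lattice S(1,3)]) (simp add: restr_def)
  also have "\<dots> = (\<Sum>k\<in>I - S. cmod (c k))" by (intro sum.cong) (auto simp: restr_def)
  \<comment> \<open>With the tail over an explicit set \<open>S\<close>, the same parameter serves
    the line and all slices, whose coefficients are merged and rotated differently.\<close>
  finally have \<Delta>: "\<Delta> = (\<Sum>k\<in>I - S. cmod (c k)) / real s + noise_bound" by simp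
  have cardS: "card S \<le> s" using S(2) by simp
  have nb: "0 \<le> noise_bound" using e by (simp add: l1_norm_def infsum_nonneg)
  have \<Delta>0: "0 \<le> \<Delta>" unfolding \<Delta> by (rule add_nonneg_nonneg[OF divide_nonneg_nonneg nb]) (simp_all add: sum_nonneg)
  have line_noise: "cmod (line_noise t) \<le> noise_bound" for t
    unfolding line_noise_def by (rule noise_le[OF line_point_mem])
  have slice_noise: "cmod (slice_noise l j t) \<le> noise_bound" for l j t
    unfolding slice_noise_def by (rule noise_le[OF slice_point_mem])
  note line = sft_accurate_trig_poly1[OF I(1) dot_mem_freqs(1)[OF I(1)] refl S(1) cardS s line_noise \<Delta> v(2,1),
      unfolded fourier1_trig_poly1]
  have slice: "cmod (F l \<omega> h - (\<Sum>k\<in>I. if dot_except d l k z = \<omega> \<and> k l = h then c k else 0))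
      \<le> (4 + 2 * sqrt 2) * \<Delta>" if l: "l < d" and h: "h \<in> freqs N" for l \<omega> h
  proof -
    have "cmod (dft N (\<lambda>j. fourier1 (slice_fun l j) \<omega>) h - dft N (\<lambda>j. vs l j \<omega>) h) \<le> (4 + 2 * sqrt 2) * \<Delta>"
    proof (rule dft_diff_le)
      fix j assume j: "j < N"
      show "cmod (fourier1 (slice_fun l j) \<omega> - vs l j \<omega>) \<le> (4 + 2 * sqrt 2) * \<Delta>"
        by (rule sft_accurate_trig_poly1(2)[OF I(1) dot_mem_freqs(2)[OF I(1)] _ S(1) cardS s slice_noise \<Delta>])
          (use vs[OF l j] in \<open>auto simp: norm_mult\<close>)
    qed (use N in simp)
    moreover have "dft N (\<lambda>j. fourier1 (slice_fun l j) \<omega>) h =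
        (\<Sum>k\<in>I. if dot_except d l k z = \<omega> \<and> k l = h then c k else 0)"
      unfolding fourier1_trig_poly1
      by (rule dft_fourier1) (use N h l I(2) in \<open>auto simp: freq_box_def\<close>)
    ultimately show ?thesis by (simp add: F[OF l] norm_minus_commute)
  qed
  have v': "finite {\<omega>. v \<omega> \<noteq> 0}" "card {\<omega>. v \<omega> \<noteq> 0} \<le> 2 * s"
    using v(1) by (auto simp: sparse_on_def)
  let ?b = "assemble d N z (slice_bw d z I) F v"
  have err: "l2_norm (freq_lattice d) (\<lambda>k. ?b k - restr I c k) \<le> 98 * (sqrt s * \<Delta>)"
    by (rule l2_norm_assemble_le[OF I inj s dot_mem_freqs(2)[OF I(1)] v' line(1,3) slice \<Delta>0])
  have finb: "finite {k. ?b k \<noteq> 0}"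
    using sparse_on_assemble[OF v'] by (simp add: sparse_on_def)
  have sum1: "(\<lambda>k. (cmod (?b k - restr I c k))\<^sup>2) summable_on freq_lattice d"
  proof (rule summable_on_cong_neutral[THEN iffD1, OF _ _ _ summable_on_finite])
    show "finite ((I \<union> {k. ?b k \<noteq> 0}) \<inter> freq_lattice d)" using I(1) finb by simp
  qed (auto simp: restr_def)
  have sumc: "(\<lambda>k. cmod (c k)) summable_on freq_lattice d" using f by (simp add: wiener_cont_def)
  have "(\<lambda>k. (cmod (c k - restr I c k))\<^sup>2) summable_on freq_lattice d"
    by (rule summable_on_comparison_test[OF summable_on_square[OF sumc]]) (auto simp: restr_def)
  \<comment> \<open>The error is split as (b - c_I) - (c - c_I).\<close>
  from l2_norm_triangle[OF sum1 this] err
  show ?thesis by simp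
qed

lemma fail_prob_alg:
  "fail_prob (noisy f \<eta>) alg (\<lambda>b. l2_norm (freq_lattice d) (\<lambda>k. b k - c k) \<le>
      98 * (sqrt s * \<Delta>) + l2_norm (freq_lattice d) (\<lambda>k. c k - restr I c k))
    \<le> (1 + real d * real N) * \<epsilon>"
proof -
  let ?good = "\<lambda>v. sparse_on (freqs (line_bw d z I)) (2 * s) v \<and>
      sft_accurate s (line_bw d z I) line_fun line_noise v"
  let ?good_slice = "\<lambda>l j v. sparse_on (freqs (slice_bw d z I l)) (2 * s) v \<and>
      sft_accurate s (slice_bw d z I l) (slice_fun l j) (slice_noise l j) v"
  have "fail_prob (noisy f \<eta>) alg (\<lambda>b. \<exists>v F vs. ?good v
      \<and> (\<forall>l<d. (\<forall>j<N. ?good_slice l j (vs l j)) \<and> F l = (\<lambda>\<omega>. dft N (\<lambda>j. vs l j \<omega>)))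
      \<and> b = assemble d N z (slice_bw d z I) F v) \<le> (1 + real d * real N) * \<epsilon>"
  proof (rule fail_prob_two_dim_dft)
    show "fail_prob (\<lambda>t. noisy f \<eta> (Line, line_point d z t)) (B (line_bw d z I)) ?good \<le> \<epsilon>"
      unfolding noisy_line using sft[OF _ sft_input_line] by blast
    show "fail_prob (\<lambda>t. noisy f \<eta> (Slice l j, slice_point d N z l j t)) (B (slice_bw d z I l))
        (?good_slice l j) \<le> \<epsilon>" if "l < d" for l j
      unfolding noisy_slice[OF that] using sft[OF _ sft_input_slice] that by blast
  qed (auto simp: sparse_on_def \<epsilon>)
  then show ?thesis
    by (rule order_trans[OF fail_prob_mono, rotated]) (use accurate_assemble in blast)
qed

end

section \<open>Constants of the complexity bounds\<close>

lemma one_le_ln: "3 \<le> x \<Longrightarrow> 1 \<le> ln (x::real)"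
  using exp_le by (subst ln_ge_iff) auto

text \<open>Up to \<open>C\<close>, the product \<open>s * Y\<close> is the cost of one SFT in
  either version. With P = d N s and X = N ln N, the bookkeeping adds up to at most 42 P, and 2 P
  DFTs at no more than 36 X + 86 N each become 172 P Y + 416 P X.\<close>

lemma cost_le:
  fixes d N s :: nat and T Y C :: real
  assumes "1 \<le> d" "1 \<le> N" "1 \<le> s" "1 \<le> Y" "0 \<le> C" "T = C * (real s * Y)"
  shows "T + real d * real N * T \<le> 2 * C * (real d * real N * real s * Y)"
    and "T + real d * (real N * (T + 8 * real s + 1)
         + 2 * real s * real N * (3 * real (dft_length N) + real N + 1) + 1)
       + 2 * real s * (real d * (9 * real N + 1) + 3 * real d + 3)
      \<le> (2 * C + 416) * (real d * real N * real s * (Y + real N * ln (real N)))"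
proof -
  define P where "P = real d * real N * real s"
  define X where "X = real N * ln (real N)"
  have one: "1 \<le> real d" "1 \<le> real N" "1 \<le> real s" using assms by auto
  have T0: "0 \<le> T" unfolding assms(6) using assms by simp
  have dN: "1 \<le> real d * real N" using mult_mono[OF one(1,2)] by simp
  have X0: "0 \<le> X" using one by (simp add: X_def)
  have PY: "real d * real N * T = C * (P * Y)" by (simp add: P_def assms(6))
  have TdN: "T \<le> real d * real N * T" using mult_right_mono[OF dN T0] by simp
  show "T + real d * real N * T \<le> 2 * C * (real d * real N * real s * Y)"
  proof -
    have "2 * C * (real d * real N * real s * Y) = 2 * (C * (P * Y))" by (simp add: P_def)
    then show ?thesis using TdN PY by linarith
  qed
  \<comment> \<open>The claimed bound has no plain term \<open>N\<close>: it is absorbed by N ln N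
    for N >= 2 and by Y >= 1 for N = 1.\<close>
  have NX: "real N \<le> Y + 2 * X"
  proof (cases "N = 1")
    case True
    then show ?thesis using assms(4) by (simp add: X_def)
  next
    case False
    then have "2 \<le> real N" using assms(2) by simp
    then have "ln 2 \<le> ln (real N)" by (intro ln_mono) auto
    then have "1 \<le> 2 * ln (real N)" using ln2_ge_two_thirds by simp
    then have "real N * 1 \<le> real N * (2 * ln (real N))" by (intro mult_left_mono) auto
    then show ?thesis using assms(4) by (simp add: X_def)
  qed
  have P1: "1 \<le> P" unfolding P_def using mult_mono[OF dN one(3)] by simp
  have dP: "real d \<le> P" "real s \<le> P" "real d * real N \<le> P" "real s * real d \<le> P"
  proof -
    have "real d * 1 * 1 \<le> P" "1 * 1 * real s \<le> P" "real d * real N * 1 \<le> P" "real d * 1 * real s \<le> P"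
      unfolding P_def using one by (intro mult_mono; simp)+
    then show "real d \<le> P" "real s \<le> P" "real d * real N \<le> P" "real s * real d \<le> P"
      by (simp_all add: mult.commute)
  qed
  have dft: "3 * real (dft_length N) + real N + 1 \<le> 36 * X + 86 * real N"
    using dft_length_le[of N] assms(2) by (simp add: X_def)
  have "real d * (real N * (T + 8 * real s + 1)
         + 2 * real s * real N * (3 * real (dft_length N) + real N + 1) + 1)
       + 2 * real s * (real d * (9 * real N + 1) + 3 * real d + 3)
      = real d * real N * T + 8 * P + real d * real N
        + 2 * P * (3 * real (dft_length N) + real N + 1) + real d + 18 * P + 8 * (real s * real d) + 6 * real s"
    by (simp add: P_def algebra_simps)
  also have "\<dots> \<le> real d * real N * T + 42 * P + 2 * P * (36 * X + 86 * real N)"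
  proof -
    have "2 * P * (3 * real (dft_length N) + real N + 1) \<le> 2 * P * (36 * X + 86 * real N)"
      using dft P1 by (intro mult_left_mono) auto
    then show ?thesis using dP by linarith
  qed
  also have "\<dots> \<le> real d * real N * T + 42 * P + 2 * P * (36 * X + 86 * (Y + 2 * X))"
    using NX P1 by (intro add_left_mono mult_left_mono) auto
  also have "\<dots> = real d * real N * T + 42 * P + 172 * (P * Y) + 416 * (P * X)"
    by (simp add: algebra_simps)
  finally have main: "T + real d * (real N * (T + 8 * real s + 1)
         + 2 * real s * real N * (3 * real (dft_length N) + real N + 1) + 1)
       + 2 * real s * (real d * (9 * real N + 1) + 3 * real d + 3)
     \<le> 2 * (C * (P * Y)) + 42 * P + 172 * (P * Y) + 416 * (P * X)"
    using TdN PY by simp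
  have PY1: "P * 1 \<le> P * Y" using P1 assms(4) by (intro mult_left_mono) auto
  have nonneg: "0 \<le> P * X" "0 \<le> C * (P * X)" using P1 X0 assms(5) by simp_all
  have "2 * (C * (P * Y)) + 42 * P + 172 * (P * Y) + 416 * (P * X) \<le> (2 * C + 416) * (P * (Y + X))"
  proof -
    have "(2 * C + 416) * (P * (Y + X)) = 2 * (C * (P * Y)) + 2 * (C * (P * X)) + 416 * (P * Y) + 416 * (P * X)"
      by (simp add: algebra_simps)
    then show ?thesis using PY1 nonneg P1 by linarith
  qed
  with main show "T + real d * (real N * (T + 8 * real s + 1)
         + 2 * real s * real N * (3 * real (dft_length N) + real N + 1) + 1)
       + 2 * real s * (real d * (9 * real N + 1) + 3 * real d + 3)
      \<le> (2 * C + 416) * (real d * real N * real s * (Y + real N * ln (real N)))"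
    unfolding P_def[symmetric] X_def[symmetric] by linarith
qed

text \<open>An odd bandwidth that is at least 2 is at least 3 > e, so its logarithm is at least 1
  and lower-order terms can be absorbed.\<close>

lemma bw_ge_3:
  assumes "1 \<le> s"
  shows "2 * s \<le> line_bw d z I \<Longrightarrow> 3 \<le> line_bw d z I"
    and "2 * s \<le> slice_bw d z I l \<Longrightarrow> 3 \<le> slice_bw d z I l"
proof -
  have *: "2 * s \<le> 2 * m + 1 \<Longrightarrow> 3 \<le> 2 * m + 1" for m using assms by presburger
  show "2 * s \<le> line_bw d z I \<Longrightarrow> 3 \<le> line_bw d z I" unfolding line_bw_def by (rule *)
  show "2 * s \<le> slice_bw d z I l \<Longrightarrow> 3 \<le> slice_bw d z I l" unfolding slice_bw_def by (rule *)
qed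

lemma bw_le_max_bw:
  "L \<in> insert (line_bw d z I) (slice_bw d z I ` {..<d}) \<Longrightarrow> L \<le> max_bw d z I"
  unfolding max_bw_def by (intro Max_ge) auto

text \<open>An event of probability 0 contains no outcome of the discrete distribution; so failure
  bound 0 turns a probabilistic estimate into one for every outcome.\<close>

lemma sure_outcome:
  assumes "sure g p Q" "fail_prob g p R \<le> 0"
  shows "\<forall>(a, m, n) \<in> set_pmf (run g p). Q a m n \<and> R a"
proof -
  have "fail_prob g p R = 0" using assms(2) fail_prob_nonneg[of g p R] by simp
  then have "set_pmf (run g p) \<inter> {(a, m, n). \<not> R a} = {}"
    unfolding fail_prob_def measure_pmf_zero_iff .
  then show ?thesis using assms(1) unfolding sure_def by blast
qed

lemma prob_ge_fail_prob:
  "measure_pmf.prob (run g p) {(a, m, n). R a} = 1 - fail_prob g p R"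
proof -
  have "{(a, m, n). R a} = UNIV - {(a, m :: nat, n :: nat). \<not> R a}" by auto
  then show ?thesis
    unfolding fail_prob_def using measure_pmf.prob_compl[of "{(a, m, n). \<not> R a}" "run g p"] by simp
qed

theorem corollary4:
  fixes A :: "nat \<Rightarrow> nat \<Rightarrow> (real, int \<Rightarrow> complex) prog"
    and A_mc :: "real \<Rightarrow> nat \<Rightarrow> nat \<Rightarrow> (real, int \<Rightarrow> complex) prog"
  shows "\<exists>(K::real) (\<tau> :: real \<Rightarrow> nat \<Rightarrow> nat \<Rightarrow> real).
    (\<forall>\<sigma> d N. 0 < \<sigma> \<and> \<sigma> \<le> 1 \<and> 1 \<le> d \<and> 1 \<le> N \<longrightarrow> 0 < \<tau> \<sigma> d N \<and> \<tau> \<sigma> d N \<le> 1 / 3) \<and>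
    (\<forall>(d::nat) (N::nat) (s::nat) (M::nat) (z :: nat \<Rightarrow> int) (I :: (nat \<Rightarrow> int) set)
      (f :: (nat \<Rightarrow> real) \<Rightarrow> complex) (\<eta> :: sft_call \<Rightarrow> (nat \<Rightarrow> real) \<Rightarrow> complex) (e :: real).
      1 \<le> d \<and> 1 \<le> N \<and> 1 \<le> s \<and> 1 \<le> M \<longrightarrow>
      finite I \<and> I \<noteq> {} \<and> I \<subseteq> freq_box d N \<longrightarrow>
      z \<in> {..<d} \<rightarrow>\<^sub>E {0..<int M} \<longrightarrow>
      reconstructing d z M I \<and> (\<forall>l<d. reconstructing d z M ((\<lambda>k. k(l := 0)) ` I)) \<longrightarrow>
      M \<le> line_bw d z I \<and> (\<forall>l<d. M \<le> slice_bw d z I l) \<longrightarrow>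
      2 * s \<le> line_bw d z I \<and> (\<forall>l<d. 2 * s \<le> slice_bw d z I l) \<longrightarrow>
      wiener_cont d f \<longrightarrow>
      0 \<le> e \<and> (\<forall>q. periodic d (\<eta> q) \<and> (\<forall>x\<in>points d. cmod (\<eta> q x) \<le> e)) \<longrightarrow>
      (let c = fourier d f;
           c_I = restr I c;
           bound = 98 * (l1_norm (freq_lattice d) (\<lambda>k. c_I k - best_approx s I c_I k) / sqrt s
                       + sqrt s * l1_norm (freq_lattice d) (\<lambda>k. c k - c_I k)
                       + sqrt s * e)
                   + l2_norm (freq_lattice d) (\<lambda>k. c k - c_I k);
           accurate = (\<lambda>b. l2_norm (freq_lattice d) (\<lambda>k. b k - c k) \<le> bound);
           L = real (max_bw d z I);
           alg = (\<lambda>B. two_dim_dft B d N z (line_bw d z I) (slice_bw d z I))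
       in
         (sublinear_sft A \<longrightarrow>
            (\<forall>(b, m, n) \<in> set_pmf (run (noisy f \<eta>) (alg (A s))).
               sparse_on (freq_box d N) (2 * s) b \<and> accurate b \<and>
               (2 \<le> s \<longrightarrow>
                  real m \<le> K * (real d * N * real s ^ 2 * ln L ^ 4 / ln s) \<and>
                  real n \<le> K * (real d * N * s * (s * ln L ^ 4 / ln s + N * ln N))))) \<and>
         (sublinear_sft_mc A_mc \<longrightarrow>
            (\<forall>\<sigma>. 0 < \<sigma> \<and> \<sigma> \<le> 1 \<longrightarrow>
               (let R = run (noisy f \<eta>) (alg (A_mc (\<tau> \<sigma> d N) s)) in
                 measure_pmf.prob R {(b, m, n). accurate b} \<ge> 1 - \<sigma> \<and>
                 (\<forall>(b, m, n) \<in> set_pmf R.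
                    sparse_on (freq_box d N) (2 * s) b \<and>
                    real m \<le> K * (real d * N * s * ln L ^ 3 * ln (real d * N * L / \<sigma>)) \<and>
                    real n \<le> K * (real d * N * s *
                      (ln L ^ 3 * ln (real d * N * L / \<sigma>) + N * ln N))))))))"
proof -
  \<comment> \<open>\<open>K\<close> has to be fixed before it is assumed that \<open>A\<close>
    meets its specification, so the constant is obtained in any case, with the specification as a
    premise. It is made nonnegative for the monotonicity arguments.\<close>
  obtain C1 where C1: "0 \<le> C1" and det: "\<And>s L a \<mu> v m n. sublinear_sft A \<Longrightarrow> 1 \<le> s \<Longrightarrow> 2 * s \<le> L \<Longrightarrow>
      sft_input a \<mu> \<Longrightarrow> (v, m, n) \<in> set_pmf (run (\<lambda>t. a t + \<mu> t) (A s L)) \<Longrightarrow>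
      sparse_on (freqs L) (2 * s) v \<and> sft_accurate s L a \<mu> v \<and>
      (2 \<le> s \<longrightarrow> real (max m n) \<le> C1 * (real s ^ 2 * ln (real L) ^ 4 / ln (real s)))"
  proof (cases "sublinear_sft A")
    case True
    then obtain C where C: "\<And>s L a \<mu> v m n. 1 \<le> s \<Longrightarrow> 2 * s \<le> L \<Longrightarrow>
      sft_input a \<mu> \<Longrightarrow> (v, m, n) \<in> set_pmf (run (\<lambda>t. a t + \<mu> t) (A s L)) \<Longrightarrow>
      sparse_on (freqs L) (2 * s) v \<and> sft_accurate s L a \<mu> v \<and>
      (2 \<le> s \<longrightarrow> real (max m n) \<le> C * (real s ^ 2 * ln (real L) ^ 4 / ln (real s)))"
      unfolding sublinear_sft_def by blast
    show ?thesis
    proof (rule that[of "max C 0"])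
      fix s L m n :: nat and a \<mu> :: "real \<Rightarrow> complex" and v :: "int \<Rightarrow> complex"
      assume *: "1 \<le> s" "2 * s \<le> L" "sft_input a \<mu>"
        "(v, m, n) \<in> set_pmf (run (\<lambda>t. a t + \<mu> t) (A s L))"
      have "C * (real s ^ 2 * ln (real L) ^ 4 / ln (real s)) \<le>
          max C 0 * (real s ^ 2 * ln (real L) ^ 4 / ln (real s))"
        using *(1) by (intro mult_right_mono) auto
      with C[OF *] show "sparse_on (freqs L) (2 * s) v \<and> sft_accurate s L a \<mu> v \<and>
        (2 \<le> s \<longrightarrow> real (max m n) \<le> max C 0 * (real s ^ 2 * ln (real L) ^ 4 / ln (real s)))"
        by (meson order_trans)
    qed simp
  qed (use that[of 0] in auto)
  obtain C2 where C2: "0 \<le> C2" and mc: "\<And>\<sigma> s L a \<mu>. sublinear_sft_mc A_mc \<Longrightarrow>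
      0 < \<sigma> \<Longrightarrow> \<sigma> \<le> 1 / 3 \<Longrightarrow> 1 \<le> s \<Longrightarrow> 2 * s \<le> L \<Longrightarrow> sft_input a \<mu> \<Longrightarrow>
      measure_pmf.prob (run (\<lambda>t. a t + \<mu> t) (A_mc \<sigma> s L)) {(v, m, n). sft_accurate s L a \<mu> v} \<ge> 1 - \<sigma> \<and>
      (\<forall>(v, m, n) \<in> set_pmf (run (\<lambda>t. a t + \<mu> t) (A_mc \<sigma> s L)).
         sparse_on (freqs L) (2 * s) v \<and>
         real (max m n) \<le> C2 * (real s * ln (real L) ^ 3 * ln (real L / \<sigma>)))"
  proof (cases "sublinear_sft_mc A_mc")
    case True
    then obtain C where C: "\<And>\<sigma> s L a \<mu>. 0 < \<sigma> \<Longrightarrow> \<sigma> \<le> 1 / 3 \<Longrightarrow> 1 \<le> s \<Longrightarrow> 2 * s \<le> L \<Longrightarrow>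
      sft_input a \<mu> \<Longrightarrow>
      measure_pmf.prob (run (\<lambda>t. a t + \<mu> t) (A_mc \<sigma> s L)) {(v, m, n). sft_accurate s L a \<mu> v} \<ge> 1 - \<sigma> \<and>
      (\<forall>(v, m, n) \<in> set_pmf (run (\<lambda>t. a t + \<mu> t) (A_mc \<sigma> s L)).
         sparse_on (freqs L) (2 * s) v \<and>
         real (max m n) \<le> C * (real s * ln (real L) ^ 3 * ln (real L / \<sigma>)))"
      unfolding sublinear_sft_mc_def by blast
    show ?thesis
    proof (rule that[of "max C 0"])
      fix \<sigma> :: real and s L :: nat and a \<mu> :: "real \<Rightarrow> complex"
      assume *: "0 < \<sigma>" "\<sigma> \<le> 1 / 3" "1 \<le> s" "2 * s \<le> L" "sft_input a \<mu>"
      have "1 * \<sigma> \<le> real L" using *(1-4) by linarith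
      then have "1 \<le> real L / \<sigma>" using *(1) by (simp add: pos_le_divide_eq)
      then have "C * (real s * ln (real L) ^ 3 * ln (real L / \<sigma>)) \<le>
          max C 0 * (real s * ln (real L) ^ 3 * ln (real L / \<sigma>))"
        using * by (intro mult_right_mono mult_nonneg_nonneg) auto
      with C[OF *] show "measure_pmf.prob (run (\<lambda>t. a t + \<mu> t) (A_mc \<sigma> s L)) {(v, m, n). sft_accurate s L a \<mu> v} \<ge> 1 - \<sigma> \<and>
        (\<forall>(v, m, n) \<in> set_pmf (run (\<lambda>t. a t + \<mu> t) (A_mc \<sigma> s L)).
           sparse_on (freqs L) (2 * s) v \<and>
           real (max m n) \<le> max C 0 * (real s * ln (real L) ^ 3 * ln (real L / \<sigma>)))"
        by (fastforce intro: order_trans)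
    qed simp
  qed (use that[of 0] in auto)
  \<comment> \<open>It dominates 2 C1 + 416 and 2 (2 C2) + 416, the constants of the two
    versions.\<close>
  define K where "K = 2 * C1 + 4 * C2 + 416"
  \<comment> \<open>The factor 3 puts the value into the admissible range up to 1/3, and 1 + d N <=
    3 d N keeps the sum of the failure probabilities below \<sigma>.\<close>
  define \<tau> :: "real \<Rightarrow> nat \<Rightarrow> nat \<Rightarrow> real" where "\<tau> = (\<lambda>\<sigma> d N. \<sigma> / (3 * real d * real N))"
  have \<tau>: "0 < \<tau> \<sigma> d N \<and> \<tau> \<sigma> d N \<le> 1 / 3" if "0 < \<sigma> \<and> \<sigma> \<le> 1 \<and> 1 \<le> d \<and> 1 \<le> N" for \<sigma> d N
  proof -
    have "1 * 1 \<le> real d * real N" using that by (intro mult_mono) auto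
    then show ?thesis using that by (simp add: \<tau>_def field_simps)
  qed
  show ?thesis
    unfolding Let_def
  proof (intro exI[of _ K] exI[of _ \<tau>] conjI allI impI)
    show "0 < \<tau> \<sigma> d N" "\<tau> \<sigma> d N \<le> 1 / 3" if "0 < \<sigma> \<and> \<sigma> \<le> 1 \<and> 1 \<le> d \<and> 1 \<le> N" for \<sigma> d N
      using \<tau>[OF that] by auto
  next
    fix d N s M :: nat and z :: "nat \<Rightarrow> int" and I :: "(nat \<Rightarrow> int) set"
      and f :: "(nat \<Rightarrow> real) \<Rightarrow> complex" and \<eta> :: "sft_call \<Rightarrow> (nat \<Rightarrow> real) \<Rightarrow> complex" and e :: real
    assume pos: "1 \<le> d \<and> 1 \<le> N \<and> 1 \<le> s \<and> 1 \<le> M"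
      and I: "finite I \<and> I \<noteq> {} \<and> I \<subseteq> freq_box d N"
      and rec: "reconstructing d z M I \<and> (\<forall>l<d. reconstructing d z M ((\<lambda>k. k(l := 0)) ` I))"
      and bw: "2 * s \<le> line_bw d z I \<and> (\<forall>l<d. 2 * s \<le> slice_bw d z I l)"
      and f: "wiener_cont d f"
      and noise: "0 \<le> e \<and> (\<forall>q. periodic d (\<eta> q) \<and> (\<forall>x\<in>points d. cmod (\<eta> q x) \<le> e))"
    \<comment> \<open>Equal integers are congruent, so injectivity modulo \<open>M\<close> gives
      injectivity over the integers, which is what the test k . z = \<omega> refers to.\<close>
    have inj: "inj_on (\<lambda>k. dot d k z) I"
      using rec unfolding reconstructing_def by (auto simp: inj_on_def)
    let ?Ls = "insert (line_bw d z I) (slice_bw d z I ` {..<d})"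
    let ?L = "real (max_bw d z I)"
    have bw': "2 * s \<le> L" "3 \<le> L" "real L \<le> ?L" if "L \<in> ?Ls" for L
      using bw that bw_le_max_bw[OF that] pos bw_ge_3[of s] by auto
    have L3: "3 \<le> ?L" using bw'(2,3)[of "line_bw d z I"] by simp
    have lnL: "1 \<le> ln ?L" using L3 by (rule one_le_ln)
    let ?c = "fourier d f"
    let ?bound = "98 * (l1_norm (freq_lattice d) (\<lambda>k. restr I ?c k - best_approx s I (restr I ?c) k) / sqrt s
                       + sqrt s * l1_norm (freq_lattice d) (\<lambda>k. ?c k - restr I ?c k)
                       + sqrt s * e)
                   + l2_norm (freq_lattice d) (\<lambda>k. ?c k - restr I ?c k)"
    have bound: "98 * (sqrt s * (l1_norm (freq_lattice d) (\<lambda>k. restr I ?c k - best_approx s I (restr I ?c) k) / real s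
          + (l1_norm (freq_lattice d) (\<lambda>k. ?c k - restr I ?c k) + e)))
        + l2_norm (freq_lattice d) (\<lambda>k. ?c k - restr I ?c k) = ?bound"
    proof -
      have "sqrt s * (l / real s) = l / sqrt s" for l using pos by (simp add: field_simps)
      then show ?thesis by (simp only: distrib_left add.assoc)
    qed
    {
      assume A: "sublinear_sft A"
      \<comment> \<open>One factor \<open>s\<close> of the SFT cost is split off to match the common
        cost estimate; \<open>Y\<close> is at least 1 for s >= 2 because ln s <= s.\<close>
      define Y where "Y = real s * ln ?L ^ 4 / ln (real s)"
      define T where "T = C1 * (real s * Y)"
      interpret setting d N s z I f \<eta> e "A s" 0 T "2 \<le> s"
      proof unfold_locales
        fix L a \<mu> assume L: "L \<in> ?Ls" and a: "sft_input a \<mu>"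
        note out = det[OF A _ bw'(1)[OF L] a]
        have "C1 * (real s ^ 2 * ln (real L) ^ 4 / ln (real s)) \<le> T"
        proof -
          have "ln (real L) ^ 4 \<le> ln ?L ^ 4"
            using bw'(2,3)[OF L] by (intro power_mono ln_mono ln_ge_zero) auto
          then have "real s ^ 2 * ln (real L) ^ 4 / ln (real s) \<le> real s ^ 2 * ln ?L ^ 4 / ln (real s)"
            using pos by (intro divide_right_mono mult_left_mono) auto
          also have "\<dots> = real s * Y" by (simp add: Y_def power2_eq_square)
          finally show ?thesis unfolding T_def using C1 by (rule mult_left_mono)
        qed
        then have sure: "sure (\<lambda>t. a t + \<mu> t) (A s L) (\<lambda>v m n. sft_cost (2 \<le> s) L s T v m n)"
          using out pos unfolding sure_def sft_cost_def by fastforce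
        moreover have "fail_prob (\<lambda>t. a t + \<mu> t) (A s L)
            (\<lambda>v. sparse_on (freqs L) (2 * s) v \<and> sft_accurate s L a \<mu> v) = 0"
          unfolding fail_prob_def measure_pmf_zero_iff using out pos by blast
        ultimately show "sure (\<lambda>t. a t + \<mu> t) (A s L) (sft_cost (2 \<le> s) L s T) \<and>
            fail_prob (\<lambda>t. a t + \<mu> t) (A s L)
            (\<lambda>v. sparse_on (freqs L) (2 * s) v \<and> sft_accurate s L a \<mu> v) \<le> 0"
          by simp
      qed (use pos I inj f noise in auto)
      have "\<forall>(b, m, n) \<in> set_pmf (run (noisy f \<eta>) alg). (sparse_on (freq_box d N) (2 * s) b \<and>
        (2 \<le> s \<longrightarrow> real m \<le> T + real d * real N * T \<and>
         real n \<le> T + real d * (real N * (T + 8 * real s + 1)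
             + 2 * real s * real N * (3 * real (dft_length N) + real N + 1) + 1)
           + 2 * real s * (real d * (9 * real N + 1) + 3 * real d + 3))) \<and>
        l2_norm (freq_lattice d) (\<lambda>k. b k - ?c k) \<le> ?bound"
        using sure_outcome[OF sure_alg] fail_prob_alg unfolding bound by simp
      moreover have "real m \<le> K * (real d * N * real s ^ 2 * ln ?L ^ 4 / ln s) \<and>
          real n \<le> K * (real d * N * s * (s * ln ?L ^ 4 / ln s + N * ln N))"
        if s: "2 \<le> s" and m: "real m \<le> T + real d * real N * T" and
          n: "real n \<le> T + real d * (real N * (T + 8 * real s + 1)
             + 2 * real s * real N * (3 * real (dft_length N) + real N + 1) + 1)
           + 2 * real s * (real d * (9 * real N + 1) + 3 * real d + 3)" for m n
      proof -
        have "0 < ln (real s)" using s by simp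
        moreover have "ln (real s) \<le> real s" using s by (intro less_imp_le ln_less_self) auto
        ultimately have "1 \<le> real s / ln (real s)" by simp
        then have "1 * 1 \<le> ln ?L ^ 4 * (real s / ln (real s))"
          using lnL by (intro mult_mono one_le_power) auto
        then have Y: "1 \<le> Y" by (simp add: Y_def mult.commute)
        have nonneg: "0 \<le> real d * real N * real s * Y"
          "0 \<le> real d * real N * real s * (Y + real N * ln (real N))"
          using Y pos by simp_all
        have "T + real d * real N * T \<le> 2 * C1 * (real d * real N * real s * Y)"
          using pos by (intro cost_le(1)[OF _ _ _ Y C1 T_def]) auto
        also have "\<dots> \<le> K * (real d * real N * real s * Y)"
          using C1 C2 nonneg(1) by (intro mult_right_mono) (auto simp: K_def)
        also have "real d * real N * real s * Y = real d * N * real s ^ 2 * ln ?L ^ 4 / ln s"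
          by (simp add: Y_def power2_eq_square)
        finally have 1: "T + real d * real N * T \<le> K * (real d * N * real s ^ 2 * ln ?L ^ 4 / ln s)" .
        note n
        also have "T + real d * (real N * (T + 8 * real s + 1)
             + 2 * real s * real N * (3 * real (dft_length N) + real N + 1) + 1)
           + 2 * real s * (real d * (9 * real N + 1) + 3 * real d + 3)
           \<le> (2 * C1 + 416) * (real d * real N * real s * (Y + real N * ln (real N)))"
          using pos by (intro cost_le(2)[OF _ _ _ Y C1 T_def]) auto
        also have "\<dots> \<le> K * (real d * real N * real s * (Y + real N * ln (real N)))"
          using C1 C2 nonneg(2) by (intro mult_right_mono) (auto simp: K_def)
        finally have 2: "real n \<le> K * (real d * real N * real s * (Y + real N * ln (real N)))" .
        show ?thesis using m 1 2 unfolding Y_def by simp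
      qed
      ultimately show "\<forall>(b, m, n) \<in> set_pmf (run (noisy f \<eta>)
          (two_dim_dft (A s) d N z (line_bw d z I) (slice_bw d z I))).
         sparse_on (freq_box d N) (2 * s) b \<and> l2_norm (freq_lattice d) (\<lambda>k. b k - ?c k) \<le> ?bound \<and>
         (2 \<le> s \<longrightarrow>
            real m \<le> K * (real d * N * real s ^ 2 * ln ?L ^ 4 / ln s) \<and>
            real n \<le> K * (real d * N * s * (s * ln ?L ^ 4 / ln s + N * ln N)))"
        by blast
    }
    {
      fix \<sigma> :: real
      assume A: "sublinear_sft_mc A_mc" and \<sigma>: "0 < \<sigma> \<and> \<sigma> \<le> 1"
      define X where "X = real d * N * ?L / \<sigma>"
      define Y where "Y = ln ?L ^ 3 * ln X"
      \<comment> \<open>The 2 pays for the individual failure probability: L / \<tau> is at most 3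
        X, and X >= 3 gives ln (3 X) <= 2 ln X.\<close>
      define T where "T = (2 * C2) * (real s * Y)"
      have \<tau>': "0 < \<tau> \<sigma> d N" "\<tau> \<sigma> d N \<le> 1 / 3" using \<tau> \<sigma> pos by auto
      have dN: "1 \<le> real d * real N" using pos mult_mono[of 1 "real d" 1 "real N"] by simp
      have "1 * 3 \<le> (real d * real N) * ?L" using dN L3 by (intro mult_mono) auto
      also have "\<dots> \<le> X" using \<sigma> L3 by (simp add: X_def pos_le_divide_eq mult_left_le)
      finally have X3: "3 \<le> X" by simp
      have lnX: "1 \<le> ln X" using X3 by (rule one_le_ln)
      interpret setting d N s z I f \<eta> e "A_mc (\<tau> \<sigma> d N) s" "\<tau> \<sigma> d N" T True
      proof unfold_locales
        fix L a \<mu> assume L: "L \<in> ?Ls" and a: "sft_input a \<mu>"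
        note out = mc[OF A \<tau>' _ bw'(1)[OF L] a]
        have "C2 * (real s * ln (real L) ^ 3 * ln (real L / \<tau> \<sigma> d N)) \<le> T"
        proof -
          have 1: "ln (real L) ^ 3 \<le> ln ?L ^ 3"
            using bw'(2,3)[OF L] by (intro power_mono ln_mono ln_ge_zero) auto
          have "real L / \<tau> \<sigma> d N = 3 * (real d * real N * real L / \<sigma>)" by (simp add: \<tau>_def)
          also have "\<dots> \<le> 3 * X"
            unfolding X_def using bw'(3)[OF L] \<sigma> by (intro mult_left_mono divide_right_mono) auto
          finally have "real L / \<tau> \<sigma> d N \<le> 3 * X" .
          moreover have "0 < real L / \<tau> \<sigma> d N" using bw'(2)[OF L] \<tau>'(1) by simp
          ultimately have "ln (real L / \<tau> \<sigma> d N) \<le> ln (3 * X)" by (intro ln_mono) auto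
          also have "\<dots> = ln 3 + ln X" using X3 by (simp add: ln_mult)
          also have "ln 3 \<le> ln X" using X3 by (intro ln_mono) auto
          finally have 2: "ln (real L / \<tau> \<sigma> d N) \<le> 2 * ln X" by simp
          have 3: "0 \<le> ln (real L / \<tau> \<sigma> d N)"
          proof (rule ln_ge_zero)
            show "1 \<le> real L / \<tau> \<sigma> d N" using bw'(2)[OF L] \<tau>' by (simp add: pos_le_divide_eq)
          qed
          have "ln (real L) ^ 3 * ln (real L / \<tau> \<sigma> d N) \<le> ln ?L ^ 3 * (2 * ln X)"
            using 1 2 3 lnL by (intro mult_mono) auto
          then have "C2 * (real s * (ln (real L) ^ 3 * ln (real L / \<tau> \<sigma> d N))) \<le> C2 * (real s * (ln ?L ^ 3 * (2 * ln X)))"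
            using C2 by (intro mult_left_mono) auto
          then show ?thesis by (simp add: T_def Y_def mult_ac)
        qed
        then have "sure (\<lambda>t. a t + \<mu> t) (A_mc (\<tau> \<sigma> d N) s L) (\<lambda>v m n. sft_cost True L s T v m n)"
          using out pos unfolding sure_def sft_cost_def by fastforce
        moreover have "fail_prob (\<lambda>t. a t + \<mu> t) (A_mc (\<tau> \<sigma> d N) s L)
            (\<lambda>v. sparse_on (freqs L) (2 * s) v \<and> sft_accurate s L a \<mu> v) \<le> \<tau> \<sigma> d N"
        proof -
          \<comment> \<open>Sparsity holds in every outcome, so inaccuracy is the only way to
            fail.\<close>
          have "fail_prob (\<lambda>t. a t + \<mu> t) (A_mc (\<tau> \<sigma> d N) s L)
              (\<lambda>v. sparse_on (freqs L) (2 * s) v \<and> sft_accurate s L a \<mu> v)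
            = fail_prob (\<lambda>t. a t + \<mu> t) (A_mc (\<tau> \<sigma> d N) s L) (sft_accurate s L a \<mu>)"
            unfolding fail_prob_def using out pos
            by (intro measure_pmf.finite_measure_eq_AE AE_pmfI) auto
          also have "\<dots> \<le> \<tau> \<sigma> d N"
            using out pos prob_ge_fail_prob[of "\<lambda>t. a t + \<mu> t" "A_mc (\<tau> \<sigma> d N) s L" "sft_accurate s L a \<mu>"]
            by auto
          finally show ?thesis .
        qed
        ultimately show "sure (\<lambda>t. a t + \<mu> t) (A_mc (\<tau> \<sigma> d N) s L) (sft_cost True L s T) \<and>
            fail_prob (\<lambda>t. a t + \<mu> t) (A_mc (\<tau> \<sigma> d N) s L)
            (\<lambda>v. sparse_on (freqs L) (2 * s) v \<and> sft_accurate s L a \<mu> v) \<le> \<tau> \<sigma> d N"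
          by simp
      qed (use pos I inj f noise \<tau>' in auto)
      have "(1 + real d * real N) * \<tau> \<sigma> d N \<le> (3 * (real d * real N)) * \<tau> \<sigma> d N"
        using dN \<tau>' by (intro mult_right_mono) linarith+
      also have "\<dots> = \<sigma>" using pos by (simp add: \<tau>_def)
      finally have "1 - \<sigma> \<le> 1 - fail_prob (noisy f \<eta>) alg
          (\<lambda>b. l2_norm (freq_lattice d) (\<lambda>k. b k - ?c k) \<le> ?bound)"
        using fail_prob_alg unfolding bound by linarith
      then show "measure_pmf.prob (run (noisy f \<eta>)
          (two_dim_dft (A_mc (\<tau> \<sigma> d N) s) d N z (line_bw d z I) (slice_bw d z I)))
          {(b, m, n). l2_norm (freq_lattice d) (\<lambda>k. b k - ?c k) \<le> ?bound} \<ge> 1 - \<sigma>"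
        unfolding prob_ge_fail_prob .
      have Y: "1 \<le> Y"
        unfolding Y_def using mult_mono[OF one_le_power[OF lnL, of 3] lnX] lnL by simp
      have C2': "0 \<le> 2 * C2" using C2 by simp
      have nonneg: "0 \<le> real d * real N * real s * Y"
        "0 \<le> real d * real N * real s * (Y + real N * ln (real N))"
        using Y pos by simp_all
      have "T + real d * real N * T \<le> 2 * (2 * C2) * (real d * real N * real s * Y)"
        using pos by (intro cost_le(1)[OF _ _ _ Y C2' T_def]) auto
      also have "\<dots> \<le> K * (real d * real N * real s * Y)"
        using C1 C2 nonneg(1) by (intro mult_right_mono) (auto simp: K_def)
      finally have 1: "T + real d * real N * T \<le> K * (real d * N * s * ln ?L ^ 3 * ln X)"
        by (simp add: Y_def mult.assoc)
      have "T + real d * (real N * (T + 8 * real s + 1)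
           + 2 * real s * real N * (3 * real (dft_length N) + real N + 1) + 1)
         + 2 * real s * (real d * (9 * real N + 1) + 3 * real d + 3)
         \<le> (2 * (2 * C2) + 416) * (real d * real N * real s * (Y + real N * ln (real N)))"
        using pos by (intro cost_le(2)[OF _ _ _ Y C2' T_def]) auto
      also have "\<dots> \<le> K * (real d * real N * real s * (Y + real N * ln (real N)))"
        using C1 C2 nonneg(2) by (intro mult_right_mono) (auto simp: K_def)
      finally have 2: "T + real d * (real N * (T + 8 * real s + 1)
           + 2 * real s * real N * (3 * real (dft_length N) + real N + 1) + 1)
         + 2 * real s * (real d * (9 * real N + 1) + 3 * real d + 3)
         \<le> K * (real d * N * s * (ln ?L ^ 3 * ln X + N * ln N))"
        by (simp only: Y_def)
      show "\<forall>(b, m, n) \<in> set_pmf (run (noisy f \<eta>)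
          (two_dim_dft (A_mc (\<tau> \<sigma> d N) s) d N z (line_bw d z I) (slice_bw d z I))).
         sparse_on (freq_box d N) (2 * s) b \<and>
         real m \<le> K * (real d * N * s * ln ?L ^ 3 * ln (real d * N * ?L / \<sigma>)) \<and>
         real n \<le> K * (real d * N * s * (ln ?L ^ 3 * ln (real d * N * ?L / \<sigma>) + N * ln N))"
        using sure_alg 1 2 unfolding sure_def X_def[symmetric] by (fastforce intro: order_trans)
    }
  qed
qed

end
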